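(* Let $G$ be a finite group, let $\alpha=(D_g,\alpha_g)_{g\in G}$ be a unital partial action of $G$ on a commutative ring $R$, and assume that $R\supseteq R^\alpha$ is an $\alpha$-partial Galois extension. Then there is a (well-defined) group homomorphism $$\varphi_2\colon \mathbf{Pic}(R^\alpha)\to \mathbf{PicS}(R)^{\alpha^*}\cap\mathbf{Pic}(R),\qquad [E]\mapsto [R\otimes_{R^\alpha}E].$$
   Context: A unital partial action $\alpha=(D_g,\alpha_g)_{g\in G}$ of a group $G$ on a commutative ring $R$ consists of ideals $D_g=R1_g$ generated by idempotents $1_g$ (possibly zero) and ring isomorphisms $\alpha_g\colon D_{g^{-1}}\to D_g$ such that $D_1=R$, $\alpha_1=\mathrm{id}_R$, $\alpha_g(D_{g^{-1}}D_h)=D_gD_{gh}$, and $\alpha_g(\alpha_h(t))=\alpha_{gh}(t)$ for all $t\in D_{h^{-1}}D_{(gh)^{-1}}$. $R^\alpha=\{r\in R:\alpha_g(r1_{g^{-1}})=r1_g\ \forall g\in G\}$. The extension $R\supseteq R^\alpha$ is $\alpha$-partial Galois if there are $m\in\mathbb N$ and $x_i,y_i\in R$ ($1\le i\le m$) with $\sum_i x_i\alpha_g(y_i1_{g^{-1}})=\delta_{1,g}$ for all $g\in G$. $\mathbf{Pic}(S)$, for a commutative ring $S$, is the group of isomorphism classes of finitely generated projective $S$-modules of rank $1$ under $\otimes_S$. Modules over a commutative ring are regarded as central bimodules. $\mathbf{PicS}(R)$ is the commutative monoid (under $[E][F]=[E\otimes_R F]$) of isomorphism classes of finitely generated projective $R$-modules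 $E$ such that there is a surjective $R$-algebra homomorphism $R\to\mathrm{End}_R(E)$ (equivalently, such that for every prime $\mathfrak p$ of $R$ either $E_{\mathfrak p}=0$ or $E_{\mathfrak p}\cong R_{\mathfrak p}$). Its group of units is $\mathbf{Pic}(R)$. For $g\in G$ and an $R$-module $E$ with $1_{g^{-1}}x=x$ for all $x\in E$, $E_g$ denotes the abelian group $E$ with the $R$-action $r\bullet x=\alpha_{g^{-1}}(r1_g)x$. Finally $$\mathbf{PicS}(R)^{\alpha^*}=\{[E]\in\mathbf{PicS}(R):(D_{g^{-1}}\otimes_R E)_g\cong D_g\otimes_R E\text{ as $R$-modules for all }g\in G\}.$$ *)

theory Defs
  imports "HOL-Algebra.Ideal_Product" "HOL-Algebra.QuotRing" "HOL-Algebra.Module"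
begin

text \<open>
  Throughout, modules over a commutative ring are records of HOL-Algebra's type
  \<open>('a, 'b) module\<close>.  That type inherits the fields \<open>mult\<close> and \<open>one\<close> from rings; they are
  irrelevant for modules and are set to \<open>undefined\<close> below, unless a multiplication is meant.
\<close>


section \<open>Modules over a commutative ring\<close>

definition mod_hom :: "'a ring \<Rightarrow> ('a, 'e) module \<Rightarrow> ('a, 'f) module \<Rightarrow> ('e \<Rightarrow> 'f) set" where
  "mod_hom R E F =
    {f \<in> carrier E \<rightarrow> carrier F.
       (\<forall>x\<in>carrier E. \<forall>y\<in>carrier E. f (x \<oplus>\<^bsub>E\<^esub> y) = f x \<oplus>\<^bsub>F\<^esub> f y) \<and>
       (\<forall>r\<in>carrier R. \<forall>x\<in>carrier E. f (r \<odot>\<^bsub>E\<^esub> x) = r \<odot>\<^bsub>F\<^esub> f x)}"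

definition mod_iso :: "'a ring \<Rightarrow> ('a, 'e) module \<Rightarrow> ('a, 'f) module \<Rightarrow> bool" where
  "mod_iso R E F \<longleftrightarrow> (\<exists>f\<in>mod_hom R E F. bij_betw f (carrier E) (carrier F))"

definition self_module :: "'a ring \<Rightarrow> ('a, 'a) module" where
  "self_module R =
    \<lparr>carrier = carrier R, mult = mult R, one = \<one>\<^bsub>R\<^esub>, zero = \<zero>\<^bsub>R\<^esub>, add = add R, smult = mult R\<rparr>"

text \<open>The free module on \<open>I\<close>: finitely supported functions, extended by zero outside \<open>I\<close>.\<close>

definition free_module :: "'a ring \<Rightarrow> 'i set \<Rightarrow> ('a, 'i \<Rightarrow> 'a) module" where
  "free_module R I =
    \<lparr>carrier = {x. (\<forall>i\<in>I. x i \<in> carrier R) \<and> (\<forall>i. i \<notin> I \<longrightarrow> x i = \<zero>\<^bsub>R\<^esub>) \<and>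
                   finite {i. x i \<noteq> \<zero>\<^bsub>R\<^esub>}},
     mult = undefined, one = undefined,
     zero = (\<lambda>_. \<zero>\<^bsub>R\<^esub>), add = (\<lambda>x y i. x i \<oplus>\<^bsub>R\<^esub> y i), smult = (\<lambda>r x i. r \<otimes>\<^bsub>R\<^esub> x i)\<rparr>"

definition basis_vec :: "'a ring \<Rightarrow> 'i \<Rightarrow> 'i \<Rightarrow> 'a" where
  "basis_vec R i = (\<lambda>j. if j = i then \<one>\<^bsub>R\<^esub> else \<zero>\<^bsub>R\<^esub>)"

definition gen_submodule :: "'a ring \<Rightarrow> ('a, 'e) module \<Rightarrow> 'e set \<Rightarrow> 'e set" where
  "gen_submodule R E A = \<Inter>{N. submodule N R E \<and> A \<subseteq> N}"

definition quot_module :: "'a ring \<Rightarrow> ('a, 'e) module \<Rightarrow> 'e set \<Rightarrow> ('a, 'e set) module" where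
  "quot_module R E N =
    \<lparr>carrier = a_rcosets\<^bsub>E\<^esub> N, mult = undefined, one = undefined,
     zero = N, add = set_add E, smult = (\<lambda>r X. \<Union>x\<in>X. N +>\<^bsub>E\<^esub> (r \<odot>\<^bsub>E\<^esub> x))\<rparr>"

definition fin_gen :: "'a ring \<Rightarrow> ('a, 'e) module \<Rightarrow> bool" where
  "fin_gen R E \<longleftrightarrow> (\<exists>A. finite A \<and> A \<subseteq> carrier E \<and> gen_submodule R E A = carrier E)"

text \<open>
  Projective: isomorphic to a direct summand \<open>P\<close> of a free module \<open>F = P \<oplus> Q\<close>.  Taking the index
  set \<open>I\<close> inside the type of elements of \<open>E\<close> is no restriction, because a projective module is a
  direct summand of the free module on its own underlying set.
\<close>

definition projective :: "'a ring \<Rightarrow> ('a, 'e) module \<Rightarrow> bool" where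
  "projective R E \<longleftrightarrow>
    (\<exists>(I :: 'e set) P Q. let F = free_module R I in
       submodule P R F \<and> submodule Q R F \<and> P \<inter> Q = {\<zero>\<^bsub>F\<^esub>} \<and> P <+>\<^bsub>F\<^esub> Q = carrier F \<and>
       mod_iso R E (F\<lparr>carrier := P\<rparr>))"

definition fgp_module :: "'a ring \<Rightarrow> ('a, 'e) module \<Rightarrow> bool" where
  "fgp_module R E \<longleftrightarrow> module R E \<and> fin_gen R E \<and> projective R E"


section \<open>Tensor products\<close>

definition tensor_rels :: "'a ring \<Rightarrow> ('a, 'e) module \<Rightarrow> ('a, 'f) module \<Rightarrow> ('e \<times> 'f \<Rightarrow> 'a) set" where
  "tensor_rels R E F =
    (let M = free_module R (carrier E \<times> carrier F); \<delta> = (\<lambda>x y. basis_vec R (x, y)) in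
      {\<delta> (x \<oplus>\<^bsub>E\<^esub> x') y \<ominus>\<^bsub>M\<^esub> (\<delta> x y \<oplus>\<^bsub>M\<^esub> \<delta> x' y) | x x' y.
         x \<in> carrier E \<and> x' \<in> carrier E \<and> y \<in> carrier F} \<union>
      {\<delta> x (y \<oplus>\<^bsub>F\<^esub> y') \<ominus>\<^bsub>M\<^esub> (\<delta> x y \<oplus>\<^bsub>M\<^esub> \<delta> x y') | x y y'.
         x \<in> carrier E \<and> y \<in> carrier F \<and> y' \<in> carrier F} \<union>
      {\<delta> (r \<odot>\<^bsub>E\<^esub> x) y \<ominus>\<^bsub>M\<^esub> (r \<odot>\<^bsub>M\<^esub> \<delta> x y) | r x y.
         r \<in> carrier R \<and> x \<in> carrier E \<and> y \<in> carrier F} \<union>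
      {\<delta> x (r \<odot>\<^bsub>F\<^esub> y) \<ominus>\<^bsub>M\<^esub> (r \<odot>\<^bsub>M\<^esub> \<delta> x y) | r x y.
         r \<in> carrier R \<and> x \<in> carrier E \<and> y \<in> carrier F})"

definition tensor_ker :: "'a ring \<Rightarrow> ('a, 'e) module \<Rightarrow> ('a, 'f) module \<Rightarrow> ('e \<times> 'f \<Rightarrow> 'a) set" where
  "tensor_ker R E F =
    gen_submodule R (free_module R (carrier E \<times> carrier F)) (tensor_rels R E F)"

definition tensor ::
  "'a ring \<Rightarrow> ('a, 'e) module \<Rightarrow> ('a, 'f) module \<Rightarrow> ('a, ('e \<times> 'f \<Rightarrow> 'a) set) module" where
  "tensor R E F = quot_module R (free_module R (carrier E \<times> carrier F)) (tensor_ker R E F)"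

definition pure_tensor ::
  "'a ring \<Rightarrow> ('a, 'e) module \<Rightarrow> ('a, 'f) module \<Rightarrow> 'e \<Rightarrow> 'f \<Rightarrow> ('e \<times> 'f \<Rightarrow> 'a) set" where
  "pure_tensor R E F x y =
    tensor_ker R E F +>\<^bsub>free_module R (carrier E \<times> carrier F)\<^esub> basis_vec R (x, y)"

text \<open>
  For a subring \<open>S\<close> of \<open>R\<close> and an \<open>S\<close>-module \<open>E\<close>: the \<open>S\<close>-module \<open>R \<otimes>\<^sub>S E\<close> with the
  \<open>R\<close>-action in which \<open>r\<close> acts by the unique \<open>S\<close>-linear map sending \<open>a \<otimes> x\<close> to \<open>ra \<otimes> x\<close>.
  Note that \<open>self_module R\<close> is also an \<open>S\<close>-module, by restriction of scalars.
\<close>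

definition base_change ::
  "'a ring \<Rightarrow> 'a ring \<Rightarrow> ('a, 'e) module \<Rightarrow> ('a, ('a \<times> 'e \<Rightarrow> 'a) set) module" where
  "base_change S R E =
    (let T = tensor S (self_module R) E; pt = pure_tensor S (self_module R) E in
      T\<lparr>smult := \<lambda>r. THE h. h \<in> mod_hom S T T \<and> h \<in> extensional (carrier T) \<and>
           (\<forall>a\<in>carrier R. \<forall>x\<in>carrier E. h (pt a x) = pt (r \<otimes>\<^bsub>R\<^esub> a) x)\<rparr>)"


section \<open>Localization and rank\<close>

text \<open>Here \<open>U\<close> is a multiplicatively closed subset of \<open>R\<close>; fractions \<open>m / s\<close> are equivalence classes.\<close>

definition frac_rel :: "'a ring \<Rightarrow> 'a set \<Rightarrow> ('a, 'e) module \<Rightarrow> (('e \<times> 'a) \<times> ('e \<times> 'a)) set" where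
  "frac_rel R U E =
    {((m, s), (n, t)) | m s n t. m \<in> carrier E \<and> s \<in> U \<and> n \<in> carrier E \<and> t \<in> U \<and>
       (\<exists>u\<in>U. u \<odot>\<^bsub>E\<^esub> (t \<odot>\<^bsub>E\<^esub> m) = u \<odot>\<^bsub>E\<^esub> (s \<odot>\<^bsub>E\<^esub> n))}"

definition fraction :: "'a ring \<Rightarrow> 'a set \<Rightarrow> ('a, 'e) module \<Rightarrow> 'e \<Rightarrow> 'a \<Rightarrow> ('e \<times> 'a) set" where
  "fraction R U E m s = frac_rel R U E `` {(m, s)}"

definition loc_ring :: "'a ring \<Rightarrow> 'a set \<Rightarrow> ('a \<times> 'a) set ring" where
  "loc_ring R U =
    (let fr = fraction R U (self_module R) in
      \<lparr>carrier = (carrier R \<times> U) // frac_rel R U (self_module R),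
       mult = (\<lambda>X Y. \<Union>(a, s)\<in>X. \<Union>(b, t)\<in>Y. fr (a \<otimes>\<^bsub>R\<^esub> b) (s \<otimes>\<^bsub>R\<^esub> t)),
       one = fr \<one>\<^bsub>R\<^esub> \<one>\<^bsub>R\<^esub>,
       zero = fr \<zero>\<^bsub>R\<^esub> \<one>\<^bsub>R\<^esub>,
       add = (\<lambda>X Y. \<Union>(a, s)\<in>X. \<Union>(b, t)\<in>Y. fr (t \<otimes>\<^bsub>R\<^esub> a \<oplus>\<^bsub>R\<^esub> s \<otimes>\<^bsub>R\<^esub> b) (s \<otimes>\<^bsub>R\<^esub> t))\<rparr>)"

definition loc_module ::
  "'a ring \<Rightarrow> 'a set \<Rightarrow> ('a, 'e) module \<Rightarrow> (('a \<times> 'a) set, ('e \<times> 'a) set) module" where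
  "loc_module R U E =
    (let fr = fraction R U E in
      \<lparr>carrier = (carrier E \<times> U) // frac_rel R U E,
       mult = undefined, one = undefined,
       zero = fr \<zero>\<^bsub>E\<^esub> \<one>\<^bsub>R\<^esub>,
       add = (\<lambda>X Y. \<Union>(m, s)\<in>X. \<Union>(n, t)\<in>Y. fr (t \<odot>\<^bsub>E\<^esub> m \<oplus>\<^bsub>E\<^esub> s \<odot>\<^bsub>E\<^esub> n) (s \<otimes>\<^bsub>R\<^esub> t)),
       smult = (\<lambda>A X. \<Union>(a, s)\<in>A. \<Union>(m, t)\<in>X. fr (a \<odot>\<^bsub>E\<^esub> m) (s \<otimes>\<^bsub>R\<^esub> t))\<rparr>)"

definition rank_one :: "'a ring \<Rightarrow> ('a, 'e) module \<Rightarrow> bool" where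
  "rank_one R E \<longleftrightarrow>
    (\<forall>P. primeideal P R \<longrightarrow>
      (let U = carrier R - P; R\<^sub>P = loc_ring R U in
        mod_iso R\<^sub>P (loc_module R U E) (self_module R\<^sub>P)))"


section \<open>Picard group and Picard semigroup\<close>

text \<open>
  The isomorphism class of \<open>E\<close> is represented by its members with elements in the type
  \<open>nat \<Rightarrow> 'a\<close>.  This keeps all finitely generated projective modules (up to isomorphism), since
  these embed in some \<open>R\<^sup>n\<close>, while \<open>E\<close> itself may have elements of any type.
\<close>

definition iso_class :: "'a ring \<Rightarrow> ('a, 'e) module \<Rightarrow> ('a, nat \<Rightarrow> 'a) module set" where
  "iso_class R E = {M. module R M \<and> mod_iso R M E}"

definition class_mult ::
  "'a ring \<Rightarrow> ('a, nat \<Rightarrow> 'a) module set \<Rightarrow> ('a, nat \<Rightarrow> 'a) module set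
    \<Rightarrow> ('a, nat \<Rightarrow> 'a) module set" where
  "class_mult R X Y = (\<Union>E\<in>X. \<Union>F\<in>Y. iso_class R (tensor R E F))"

definition pic_module :: "'a ring \<Rightarrow> ('a, 'e) module \<Rightarrow> bool" where
  "pic_module R E \<longleftrightarrow> fgp_module R E \<and> rank_one R E"

definition Pic :: "'a ring \<Rightarrow> ('a, nat \<Rightarrow> 'a) module set monoid" where
  "Pic R =
    \<lparr>carrier = {iso_class R E | E :: ('a, nat \<Rightarrow> 'a) module. pic_module R E},
     mult = class_mult R, one = iso_class R (self_module R)\<rparr>"

definition End_alg :: "'a ring \<Rightarrow> ('a, 'e) module \<Rightarrow> ('a, 'e \<Rightarrow> 'e) module" where
  "End_alg R E =
    \<lparr>carrier = mod_hom R E E \<inter> extensional (carrier E),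
     mult = compose (carrier E),
     one = (\<lambda>x\<in>carrier E. x),
     zero = (\<lambda>x\<in>carrier E. \<zero>\<^bsub>E\<^esub>),
     add = (\<lambda>f g. \<lambda>x\<in>carrier E. f x \<oplus>\<^bsub>E\<^esub> g x),
     smult = (\<lambda>r f. \<lambda>x\<in>carrier E. r \<odot>\<^bsub>E\<^esub> f x)\<rparr>"

definition pics_module :: "'a ring \<Rightarrow> ('a, 'e) module \<Rightarrow> bool" where
  "pics_module R E \<longleftrightarrow> fgp_module R E \<and>
    (\<exists>h \<in> ring_hom R (End_alg R E) \<inter> mod_hom R (self_module R) (End_alg R E).
       h ` carrier R = carrier (End_alg R E))"

definition PicS :: "'a ring \<Rightarrow> ('a, nat \<Rightarrow> 'a) module set monoid" where
  "PicS R =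
    \<lparr>carrier = {iso_class R E | E :: ('a, nat \<Rightarrow> 'a) module. pics_module R E},
     mult = class_mult R, one = iso_class R (self_module R)\<rparr>"


section \<open>Unital partial actions\<close>

text \<open>
  A unital partial action is given by the maps \<open>\<alpha> g\<close> and the idempotents \<open>u g\<close> (written
  \<open>1\<^sub>g\<close> in the literature); the ideals are \<open>D g = R (u g)\<close>, which are rings with identity \<open>u g\<close>.
\<close>

definition D_ring :: "'a ring \<Rightarrow> 'a \<Rightarrow> 'a ring" where
  "D_ring R a = R\<lparr>carrier := PIdl\<^bsub>R\<^esub> a, one := a\<rparr>"

definition D_module :: "'a ring \<Rightarrow> 'a \<Rightarrow> ('a, 'a) module" where
  "D_module R a = (self_module R)\<lparr>carrier := PIdl\<^bsub>R\<^esub> a\<rparr>"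

locale unital_partial_action = G: group G + R: cring R
  for G :: "'g monoid" and R :: "'a ring" +
  fixes u :: "'g \<Rightarrow> 'a" and \<alpha> :: "'g \<Rightarrow> 'a \<Rightarrow> 'a"
  assumes u_closed: "g \<in> carrier G \<Longrightarrow> u g \<in> carrier R"
    and u_idem: "g \<in> carrier G \<Longrightarrow> u g \<otimes>\<^bsub>R\<^esub> u g = u g"
    and \<alpha>_iso: "g \<in> carrier G \<Longrightarrow>
      \<alpha> g \<in> ring_iso (D_ring R (u (inv\<^bsub>G\<^esub> g))) (D_ring R (u g))"
    and D_one: "PIdl\<^bsub>R\<^esub> (u \<one>\<^bsub>G\<^esub>) = carrier R"
    and \<alpha>_one: "r \<in> carrier R \<Longrightarrow> \<alpha> \<one>\<^bsub>G\<^esub> r = r"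
    and \<alpha>_image: "\<lbrakk>g \<in> carrier G; h \<in> carrier G\<rbrakk> \<Longrightarrow>
      \<alpha> g ` ideal_prod R (PIdl\<^bsub>R\<^esub> (u (inv\<^bsub>G\<^esub> g))) (PIdl\<^bsub>R\<^esub> (u h)) =
      ideal_prod R (PIdl\<^bsub>R\<^esub> (u g)) (PIdl\<^bsub>R\<^esub> (u (g \<otimes>\<^bsub>G\<^esub> h)))"
    and \<alpha>_mult: "\<lbrakk>g \<in> carrier G; h \<in> carrier G;
      t \<in> ideal_prod R (PIdl\<^bsub>R\<^esub> (u (inv\<^bsub>G\<^esub> h))) (PIdl\<^bsub>R\<^esub> (u (inv\<^bsub>G\<^esub> (g \<otimes>\<^bsub>G\<^esub> h))))\<rbrakk> \<Longrightarrow>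
      \<alpha> g (\<alpha> h t) = \<alpha> (g \<otimes>\<^bsub>G\<^esub> h) t"

definition invariants ::
  "'g monoid \<Rightarrow> 'a ring \<Rightarrow> ('g \<Rightarrow> 'a) \<Rightarrow> ('g \<Rightarrow> 'a \<Rightarrow> 'a) \<Rightarrow> 'a ring" where
  "invariants G R u \<alpha> =
    R\<lparr>carrier := {r \<in> carrier R. \<forall>g\<in>carrier G.
                    \<alpha> g (r \<otimes>\<^bsub>R\<^esub> u (inv\<^bsub>G\<^esub> g)) = r \<otimes>\<^bsub>R\<^esub> u g}\<rparr>"

definition partial_galois ::
  "'g monoid \<Rightarrow> 'a ring \<Rightarrow> ('g \<Rightarrow> 'a) \<Rightarrow> ('g \<Rightarrow> 'a \<Rightarrow> 'a) \<Rightarrow> bool" where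
  "partial_galois G R u \<alpha> \<longleftrightarrow>
    (\<exists>(m :: nat) x y. (\<forall>i\<in>{1..m}. x i \<in> carrier R \<and> y i \<in> carrier R) \<and>
      (\<forall>g\<in>carrier G.
        (\<Oplus>\<^bsub>R\<^esub>i\<in>{1..m}. x i \<otimes>\<^bsub>R\<^esub> \<alpha> g (y i \<otimes>\<^bsub>R\<^esub> u (inv\<^bsub>G\<^esub> g))) =
        (if g = \<one>\<^bsub>G\<^esub> then \<one>\<^bsub>R\<^esub> else \<zero>\<^bsub>R\<^esub>)))"

definition twist ::
  "'g monoid \<Rightarrow> 'a ring \<Rightarrow> ('g \<Rightarrow> 'a) \<Rightarrow> ('g \<Rightarrow> 'a \<Rightarrow> 'a) \<Rightarrow> 'g \<Rightarrow> ('a, 'e) module \<Rightarrow> ('a, 'e) module"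
  where
  "twist G R u \<alpha> g E = E\<lparr>smult := \<lambda>r x. \<alpha> (inv\<^bsub>G\<^esub> g) (r \<otimes>\<^bsub>R\<^esub> u g) \<odot>\<^bsub>E\<^esub> x\<rparr>"

definition PicS_inv ::
  "'g monoid \<Rightarrow> 'a ring \<Rightarrow> ('g \<Rightarrow> 'a) \<Rightarrow> ('g \<Rightarrow> 'a \<Rightarrow> 'a) \<Rightarrow> ('a, nat \<Rightarrow> 'a) module set set" where
  "PicS_inv G R u \<alpha> =
    {iso_class R E | E :: ('a, nat \<Rightarrow> 'a) module. pics_module R E \<and>
       (\<forall>g\<in>carrier G.
          mod_iso R (twist G R u \<alpha> g (tensor R (D_module R (u (inv\<^bsub>G\<^esub> g))) E))
            (tensor R (D_module R (u g)) E))}"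

text \<open>
  The assignment induced on isomorphism classes by \<open>E \<mapsto> R \<otimes> E\<close> over the subring \<open>S\<close>, taken over
  all representatives at once.
\<close>

definition phi2 ::
  "'a ring \<Rightarrow> 'a ring \<Rightarrow> ('a, nat \<Rightarrow> 'a) module set \<Rightarrow> ('a, nat \<Rightarrow> 'a) module set" where
  "phi2 S R X = (\<Union>E\<in>X. iso_class R (base_change S R E))"

end

theory Submission
  imports Defs
begin

text \<open>
  The idea is to replace "finitely generated projective of rank one" by a condition that is global,
  elementary, and visibly stable under every construction in the theorem.  Call a linear functional
  \<open>f\<close> on an \<open>R\<close>-module \<open>E\<close> an exchange functional if \<open>f(x) y = f(y) x\<close> for all \<open>x, y\<close>, and call
  \<open>E\<close> invertible if the values of its exchange functionals generate the unit ideal.  Over a local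
  ring this says \<open>E \<cong> R\<close>: some \<open>s = f(e)\<close> is a unit, and \<open>s x = f(x) e\<close> makes \<open>e\<close> a basis.  Hence
  invertible modules have rank one, and writing \<open>1\<close> as a sum of such values makes them finitely
  generated projective.  Conversely, if \<open>E\<close> is finitely generated projective of rank one, then for
  each prime \<open>P\<close> clearing denominators in a local basis produces an exchange functional with a value
  outside \<open>P\<close>; so the ideal of values lies in no prime ideal.  This is the equivalence
  \<open>pic_module_iff\<close>.

  Three consequences do most of the work.  A statement about a scalar \<open>r\<close> that is closed under linear
  combinations holds for \<open>1\<close> as soon as it holds for the values of exchange functionals
  (\<open>invertible_induct\<close>).  Therefore invertible modules are faithful and their exchange functionals
  separate points, and so a surjective homomorphism between invertible modules is an isomorphism
  (\<open>onto_imp_iso\<close>).  Thus every canonical isomorphism - associativity and unit of the tensor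
  product, functoriality, the evaluation \<open>E\<^sup>* \<otimes> E \<rightarrow> R\<close>, and the compatibility of base change
  with tensor products - only needs a map defined by a universal property and the remark that its
  image contains generators; no inverse has to be constructed.  Finally, exchange functionals can be
  tensored, dualized and base changed, so invertibility is inherited.  This yields the group structure
  on \<open>Pic\<close>, the inverse of \<open>[E]\<close> being the class of the module of exchange functionals.

  For the partial action write \<open>act g r = \<alpha>\<^sub>g (r 1\<^sub>g\<^sub>-\<^sub>1)\<close>.  Since \<open>R1\<^sub>g \<otimes> E \<cong> 1\<^sub>g E\<close>, the condition that
  defines the invariant classes says that there is an additive bijection from \<open>1\<^sub>g\<^sub>-\<^sub>1 E\<close> onto \<open>1\<^sub>g E\<close>
  that is semilinear with respect to \<open>act g\<close> (\<open>twist_tensor_iff_transportable\<close>).  Such bijections can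
  be tensored and dualized, so the invariant classes form a subgroup of \<open>Pic R\<close>.  On
  \<open>R \<otimes> E\<close> over the ring \<open>S\<close> of invariants the map \<open>r \<otimes> x \<mapsto> act g r \<otimes> x\<close> is well defined, because
  \<open>act g\<close> multiplies an invariant \<open>s\<close> by \<open>1\<^sub>g\<close>; it is the required semilinear bijection.
\<close>


section \<open>Homomorphisms and isomorphisms of modules\<close>

lemma mod_homI:
  assumes "\<And>x. x \<in> carrier E \<Longrightarrow> f x \<in> carrier F"
    and "\<And>x y. x \<in> carrier E \<Longrightarrow> y \<in> carrier E \<Longrightarrow> f (x \<oplus>\<^bsub>E\<^esub> y) = f x \<oplus>\<^bsub>F\<^esub> f y"
    and "\<And>r x. r \<in> carrier R \<Longrightarrow> x \<in> carrier E \<Longrightarrow> f (r \<odot>\<^bsub>E\<^esub> x) = r \<odot>\<^bsub>F\<^esub> f x"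
  shows "f \<in> mod_hom R E F"
  using assms unfolding mod_hom_def by auto

lemma mod_hom_closed: "f \<in> mod_hom R E F \<Longrightarrow> x \<in> carrier E \<Longrightarrow> f x \<in> carrier F"
  and mod_hom_add: "f \<in> mod_hom R E F \<Longrightarrow> x \<in> carrier E \<Longrightarrow> y \<in> carrier E \<Longrightarrow>
    f (x \<oplus>\<^bsub>E\<^esub> y) = f x \<oplus>\<^bsub>F\<^esub> f y"
  and mod_hom_smult: "f \<in> mod_hom R E F \<Longrightarrow> r \<in> carrier R \<Longrightarrow> x \<in> carrier E \<Longrightarrow>
    f (r \<odot>\<^bsub>E\<^esub> x) = r \<odot>\<^bsub>F\<^esub> f x"
  unfolding mod_hom_def by auto

lemma mod_hom_zero:
  assumes "module R E" "module R F" "f \<in> mod_hom R E F"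
  shows "f \<zero>\<^bsub>E\<^esub> = \<zero>\<^bsub>F\<^esub>"
proof -
  interpret E: module R E by fact
  interpret F: module R F by fact
  have "f (\<zero>\<^bsub>R\<^esub> \<odot>\<^bsub>E\<^esub> \<zero>\<^bsub>E\<^esub>) = \<zero>\<^bsub>R\<^esub> \<odot>\<^bsub>F\<^esub> f \<zero>\<^bsub>E\<^esub>"
    using assms(3) by (intro mod_hom_smult) auto
  then show ?thesis
    using mod_hom_closed[OF assms(3), of "\<zero>\<^bsub>E\<^esub>"] by simp
qed

lemma mod_hom_comp:
  "f \<in> mod_hom R E F \<Longrightarrow> g \<in> mod_hom R F H \<Longrightarrow> (\<lambda>x. g (f x)) \<in> mod_hom R E H"
  unfolding mod_hom_def by (auto simp: Pi_iff)

lemma mod_iso_refl: "mod_iso R E E"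
  unfolding mod_iso_def by (rule bexI[of _ "\<lambda>x. x"]) (auto simp: mod_hom_def bij_betw_def)

lemma mod_iso_trans: "mod_iso R E F \<Longrightarrow> mod_iso R F H \<Longrightarrow> mod_iso R E H"
  unfolding mod_iso_def
  using mod_hom_comp bij_betw_trans unfolding comp_def by blast

lemma mod_hom_inverse:
  assumes "module R E" and f: "f \<in> mod_hom R E F" and b: "bij_betw f (carrier E) (carrier F)"
  shows "inv_into (carrier E) f \<in> mod_hom R F E"
proof -
  interpret E: module R E by fact
  let ?g = "inv_into (carrier E) f"
  have g: "?g y \<in> carrier E" "f (?g y) = y" if "y \<in> carrier F" for y
    using that b by (auto simp: bij_betw_def inv_into_into f_inv_into_f)
  have gf: "?g (f x) = x" if "x \<in> carrier E" for x
    using that b by (simp add: bij_betw_def)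
  show ?thesis
  proof (rule mod_homI)
    fix x y assume "x \<in> carrier F" "y \<in> carrier F"
    then show "?g (x \<oplus>\<^bsub>F\<^esub> y) = ?g x \<oplus>\<^bsub>E\<^esub> ?g y"
      using gf[of "?g x \<oplus>\<^bsub>E\<^esub> ?g y"] g mod_hom_add[OF f] by simp
  next
    fix r x assume "r \<in> carrier R" "x \<in> carrier F"
    then show "?g (r \<odot>\<^bsub>F\<^esub> x) = r \<odot>\<^bsub>E\<^esub> ?g x"
      using gf[of "r \<odot>\<^bsub>E\<^esub> ?g x"] g mod_hom_smult[OF f] by simp
  qed (use g in auto)
qed

lemma mod_iso_sym: "module R E \<Longrightarrow> mod_iso R E F \<Longrightarrow> mod_iso R F E"
  unfolding mod_iso_def using mod_hom_inverse bij_betw_inv_into by metis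

text \<open>
  Quotients and modules obtained by transport of structure are modules for the same reason: the module
  axioms are equations, and these pass to images.
\<close>

lemma module_surj_image:
  assumes "module R M"
    and surj: "q ` carrier M = carrier Q"
    and add: "\<And>x y. x \<in> carrier M \<Longrightarrow> y \<in> carrier M \<Longrightarrow> q x \<oplus>\<^bsub>Q\<^esub> q y = q (x \<oplus>\<^bsub>M\<^esub> y)"
    and smult: "\<And>r x. r \<in> carrier R \<Longrightarrow> x \<in> carrier M \<Longrightarrow> r \<odot>\<^bsub>Q\<^esub> q x = q (r \<odot>\<^bsub>M\<^esub> x)"
    and zero: "q \<zero>\<^bsub>M\<^esub> = \<zero>\<^bsub>Q\<^esub>"
  shows "module R Q"
proof -
  interpret M: module R M by fact
  have q: "q x \<in> carrier Q" if "x \<in> carrier M" for x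
    using that surj by auto
  have rep: "\<exists>x\<in>carrier M. y = q x" if "y \<in> carrier Q" for y
    using that surj by auto
  have ab: "abelian_group Q"
  proof (rule abelian_groupI)
    show "\<zero>\<^bsub>Q\<^esub> \<in> carrier Q"
      using q[of "\<zero>\<^bsub>M\<^esub>"] zero by simp
  next
    fix x y assume "x \<in> carrier Q" "y \<in> carrier Q"
    then obtain a b where "x = q a" "y = q b" "a \<in> carrier M" "b \<in> carrier M"
      using rep by blast
    then show "x \<oplus>\<^bsub>Q\<^esub> y \<in> carrier Q" "x \<oplus>\<^bsub>Q\<^esub> y = y \<oplus>\<^bsub>Q\<^esub> x"
      by (simp_all add: add q M.a_comm)
  next
    fix x y z assume "x \<in> carrier Q" "y \<in> carrier Q" "z \<in> carrier Q"
    then obtain a b c where "x = q a" "y = q b" "z = q c"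
        "a \<in> carrier M" "b \<in> carrier M" "c \<in> carrier M"
      using rep by metis
    then show "x \<oplus>\<^bsub>Q\<^esub> y \<oplus>\<^bsub>Q\<^esub> z = x \<oplus>\<^bsub>Q\<^esub> (y \<oplus>\<^bsub>Q\<^esub> z)"
      by (simp add: add M.a_assoc)
  next
    fix x assume "x \<in> carrier Q"
    then obtain a where a: "x = q a" "a \<in> carrier M"
      using rep by blast
    then show "\<zero>\<^bsub>Q\<^esub> \<oplus>\<^bsub>Q\<^esub> x = x"
      using add[of "\<zero>\<^bsub>M\<^esub>" a] zero by simp
    show "\<exists>y\<in>carrier Q. y \<oplus>\<^bsub>Q\<^esub> x = \<zero>\<^bsub>Q\<^esub>"
      using a add[of "\<ominus>\<^bsub>M\<^esub> a" a] zero q M.l_neg by (intro bexI[of _ "q (\<ominus>\<^bsub>M\<^esub> a)"]) auto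
  qed
  show ?thesis
  proof (rule moduleI)
    show "cring R" by (rule M.R.is_cring)
    show "abelian_group Q" by (rule ab)
  next
    fix a x assume "a \<in> carrier R" "x \<in> carrier Q"
    then show "a \<odot>\<^bsub>Q\<^esub> x \<in> carrier Q"
      using rep[of x] by (auto simp: smult q)
  next
    fix a b x assume "a \<in> carrier R" "b \<in> carrier R" "x \<in> carrier Q"
    then show "(a \<oplus>\<^bsub>R\<^esub> b) \<odot>\<^bsub>Q\<^esub> x = a \<odot>\<^bsub>Q\<^esub> x \<oplus>\<^bsub>Q\<^esub> b \<odot>\<^bsub>Q\<^esub> x"
        "(a \<otimes>\<^bsub>R\<^esub> b) \<odot>\<^bsub>Q\<^esub> x = a \<odot>\<^bsub>Q\<^esub> (b \<odot>\<^bsub>Q\<^esub> x)"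
      using rep[of x] by (auto simp: smult add M.smult_l_distr M.smult_assoc1)
  next
    fix a x y assume a: "a \<in> carrier R" and "x \<in> carrier Q" "y \<in> carrier Q"
    then obtain b c where "x = q b" "y = q c" "b \<in> carrier M" "c \<in> carrier M"
      using rep by metis
    with a show "a \<odot>\<^bsub>Q\<^esub> (x \<oplus>\<^bsub>Q\<^esub> y) = a \<odot>\<^bsub>Q\<^esub> x \<oplus>\<^bsub>Q\<^esub> a \<odot>\<^bsub>Q\<^esub> y"
      by (simp add: smult add M.smult_r_distr)
  next
    fix x assume "x \<in> carrier Q"
    then show "\<one>\<^bsub>R\<^esub> \<odot>\<^bsub>Q\<^esub> x = x"
      using rep[of x] by (auto simp: smult)
  qed
qed

lemma self_module_simps [simp]:
  "carrier (self_module R) = carrier R" "zero (self_module R) = \<zero>\<^bsub>R\<^esub>"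
  "add (self_module R) = add R" "smult (self_module R) = mult R"
  by (simp_all add: self_module_def)

lemma module_self:
  assumes "cring R"
  shows "module R (self_module R)"
proof -
  interpret R: cring R by fact
  show ?thesis
  proof (rule moduleI)
    show "abelian_group (self_module R)"
      by (rule abelian_groupI) (auto simp: R.a_ac intro: R.l_neg)
  qed (auto simp: R.l_distr R.r_distr R.m_assoc R.is_cring)
qed

lemma restrict_scalars:
  assumes "module R M" "cring (R\<lparr>carrier := A\<rparr>)" "A \<subseteq> carrier R"
  shows "module (R\<lparr>carrier := A\<rparr>) M"
proof -
  interpret M: module R M by fact
  show ?thesis
    using assms(2,3)
    by (intro moduleI M.abelian_group_axioms)
      (auto simp: M.smult_l_distr M.smult_r_distr M.smult_assoc1 subset_iff)
qed

lemma submodule_kernel: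
  assumes "module R E" "module R F" and f: "f \<in> mod_hom R E F"
  shows "submodule {x \<in> carrier E. f x = \<zero>\<^bsub>F\<^esub>} R E"
proof -
  interpret E: module R E by fact
  interpret F: module R F by fact
  \<comment> \<open>Homomorphisms preserve negatives because these are multiples by the scalar \<open>-1\<close>.\<close>
  have "f (\<ominus>\<^bsub>E\<^esub> a) = \<ominus>\<^bsub>F\<^esub> f a" if "a \<in> carrier E" for a
  proof -
    have "f (\<ominus>\<^bsub>E\<^esub> a) = f ((\<ominus>\<^bsub>R\<^esub> \<one>\<^bsub>R\<^esub>) \<odot>\<^bsub>E\<^esub> a)"
      using that by (simp add: E.smult_l_minus)
    also have "\<dots> = (\<ominus>\<^bsub>R\<^esub> \<one>\<^bsub>R\<^esub>) \<odot>\<^bsub>F\<^esub> f a"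
      using that by (intro mod_hom_smult[OF f]) auto
    also have "\<dots> = \<ominus>\<^bsub>F\<^esub> f a"
      using that by (simp add: F.smult_l_minus mod_hom_closed[OF f])
    finally show ?thesis .
  qed
  then show ?thesis
    using mod_hom_zero[OF assms] mod_hom_add[OF f] mod_hom_smult[OF f]
    by (intro E.submoduleI) auto
qed

lemma submodule_gen_submodule:
  assumes "module R E" "A \<subseteq> carrier E"
  shows "submodule (gen_submodule R E A) R E"
proof -
  interpret E: module R E by fact
  have sub: "gen_submodule R E A \<subseteq> carrier E"
    unfolding gen_submodule_def using E.carrier_is_submodule assms(2) by auto
  show ?thesis
    using sub
    by (intro E.submoduleI)
      (auto simp: gen_submodule_def E.submoduleE dest: E.submoduleE
        submodule.axioms(1)[THEN subgroup.one_closed])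
qed

lemma gen_submodule_incl: "A \<subseteq> gen_submodule R E A"
  unfolding gen_submodule_def by auto

lemma gen_submodule_least: "submodule N R E \<Longrightarrow> A \<subseteq> N \<Longrightarrow> gen_submodule R E A \<subseteq> N"
  unfolding gen_submodule_def by auto


section \<open>Quotients and free modules\<close>

lemma quot_module_facts:
  assumes "module R M" "submodule N R M"
  shows module_quot: "module R (quot_module R M N)"
    and coset_hom: "(\<lambda>x. N +>\<^bsub>M\<^esub> x) \<in> mod_hom R M (quot_module R M N)"
    and coset_surj: "carrier (quot_module R M N) = (\<lambda>x. N +>\<^bsub>M\<^esub> x) ` carrier M"
    and coset_eq: "\<And>x y. x \<in> carrier M \<Longrightarrow> y \<in> carrier M \<Longrightarrow>
      N +>\<^bsub>M\<^esub> x = N +>\<^bsub>M\<^esub> y \<longleftrightarrow> x \<ominus>\<^bsub>M\<^esub> y \<in> N"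
    and coset_mem: "\<And>x y. x \<in> carrier M \<Longrightarrow> y \<in> N +>\<^bsub>M\<^esub> x \<Longrightarrow> 
      y \<in> carrier M \<and> y \<ominus>\<^bsub>M\<^esub> x \<in> N"
    and coset_self: "\<And>x. x \<in> carrier M \<Longrightarrow> x \<in> N +>\<^bsub>M\<^esub> x"
proof -
  interpret M: module R M by fact
  interpret N: abelian_subgroup N M
    using assms(2) M.abelian_group_axioms
    by (intro abelian_subgroupI3 additive_subgroupI) (auto simp: submodule_def)
  note sm = M.submoduleE(4)[OF assms(2)]
  have carr: "carrier (quot_module R M N) = (\<lambda>x. N +>\<^bsub>M\<^esub> x) ` carrier M"
    by (auto simp: quot_module_def A_RCOSETS_def')
  then show "carrier (quot_module R M N) = (\<lambda>x. N +>\<^bsub>M\<^esub> x) ` carrier M" .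
  show mem: "y \<in> carrier M \<and> y \<ominus>\<^bsub>M\<^esub> x \<in> N" if "x \<in> carrier M" "y \<in> N +>\<^bsub>M\<^esub> x" for x y
  proof -
    have y: "y \<in> carrier M" using that by (rule N.a_elemrcos_carrier)
    then show ?thesis
      using iffD1[OF N.a_rcos_module[OF that(1) y] that(2)] by (simp only: M.minus_eq simp_thms)
  qed
  show self: "x \<in> N +>\<^bsub>M\<^esub> x" if "x \<in> carrier M" for x
    using that by (rule N.a_rcos_self)
  show eq: "N +>\<^bsub>M\<^esub> x = N +>\<^bsub>M\<^esub> y \<longleftrightarrow> x \<ominus>\<^bsub>M\<^esub> y \<in> N"
    if "x \<in> carrier M" "y \<in> carrier M" for x y
  proof -
    have "N +>\<^bsub>M\<^esub> x = N +>\<^bsub>M\<^esub> y \<longleftrightarrow> x \<in> N +>\<^bsub>M\<^esub> y"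
      using N.a_repr_independence'[of x y] that self[OF that(1)] by metis
    also have "\<dots> \<longleftrightarrow> x \<ominus>\<^bsub>M\<^esub> y \<in> N"
      unfolding M.minus_eq by (rule N.a_rcos_module[OF that(2,1)])
    finally show ?thesis .
  qed
  have add: "(N +>\<^bsub>M\<^esub> x) \<oplus>\<^bsub>quot_module R M N\<^esub> (N +>\<^bsub>M\<^esub> y) = N +>\<^bsub>M\<^esub> (x \<oplus>\<^bsub>M\<^esub> y)"
    if "x \<in> carrier M" "y \<in> carrier M" for x y
    using that by (simp add: quot_module_def N.a_rcos_sum)
  have smult: "r \<odot>\<^bsub>quot_module R M N\<^esub> (N +>\<^bsub>M\<^esub> x) = N +>\<^bsub>M\<^esub> (r \<odot>\<^bsub>M\<^esub> x)"
    if "r \<in> carrier R" "x \<in> carrier M" for r x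
  proof -
    have "N +>\<^bsub>M\<^esub> (r \<odot>\<^bsub>M\<^esub> y) = N +>\<^bsub>M\<^esub> (r \<odot>\<^bsub>M\<^esub> x)" if y: "y \<in> N +>\<^bsub>M\<^esub> x" for y
    proof -
      have yM: "y \<in> carrier M" "y \<ominus>\<^bsub>M\<^esub> x \<in> N"
        using mem[OF _ y] \<open>x \<in> carrier M\<close> by auto
      have "r \<odot>\<^bsub>M\<^esub> y \<ominus>\<^bsub>M\<^esub> r \<odot>\<^bsub>M\<^esub> x = r \<odot>\<^bsub>M\<^esub> (y \<ominus>\<^bsub>M\<^esub> x)"
        using that(1) yM(1) \<open>r \<in> carrier R\<close> \<open>x \<in> carrier M\<close>
        by (simp add: M.minus_eq M.smult_r_distr M.smult_r_minus)
      then show ?thesis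
        using sm yM \<open>r \<in> carrier R\<close> \<open>x \<in> carrier M\<close> by (subst eq) auto
    qed
    then have "(\<Union>y\<in>N +>\<^bsub>M\<^esub> x. N +>\<^bsub>M\<^esub> (r \<odot>\<^bsub>M\<^esub> y)) = N +>\<^bsub>M\<^esub> (r \<odot>\<^bsub>M\<^esub> x)"
      using self[OF that(2)] by blast
    then show ?thesis
      by (simp add: quot_module_def)
  qed
  show "module R (quot_module R M N)"
    by (rule module_surj_image[OF assms(1), where q = "\<lambda>x. N +>\<^bsub>M\<^esub> x"])
      (simp_all add: carr add smult, simp add: quot_module_def N.a_subset)
  show "(\<lambda>x. N +>\<^bsub>M\<^esub> x) \<in> mod_hom R M (quot_module R M N)"
    by (rule mod_homI) (auto simp: carr add smult)
qed

lemma quot_module_lift: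
  assumes "module R M" "submodule N R M" "module R H" and \<Phi>: "\<Phi> \<in> mod_hom R M H"
    and ker: "\<And>x. x \<in> N \<Longrightarrow> \<Phi> x = \<zero>\<^bsub>H\<^esub>"
  obtains \<Psi> where "\<Psi> \<in> mod_hom R (quot_module R M N) H"
    "\<And>x. x \<in> carrier M \<Longrightarrow> \<Psi> (N +>\<^bsub>M\<^esub> x) = \<Phi> x"
proof -
  interpret M: module R M by fact
  interpret H: module R H by fact
  note Q = quot_module_facts[OF assms(1,2)]
  define \<Psi> where "\<Psi> X = \<Phi> (SOME x. x \<in> X)" for X
  have \<Psi>: "\<Psi> (N +>\<^bsub>M\<^esub> x) = \<Phi> x" if x: "x \<in> carrier M" for x
  proof -
    define y where "y = (SOME y. y \<in> N +>\<^bsub>M\<^esub> x)"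
    have "y \<in> N +>\<^bsub>M\<^esub> x"
      unfolding y_def using Q(6)[OF x] by (rule someI)
    then have y: "y \<in> carrier M" "y \<ominus>\<^bsub>M\<^esub> x \<in> N"
      using Q(5)[OF x] by auto
    have "y = (y \<ominus>\<^bsub>M\<^esub> x) \<oplus>\<^bsub>M\<^esub> x"
      using x y by (simp add: M.minus_eq M.a_assoc M.l_neg)
    then have "\<Phi> y = \<Phi> (y \<ominus>\<^bsub>M\<^esub> x) \<oplus>\<^bsub>H\<^esub> \<Phi> x"
      using mod_hom_add[OF \<Phi>, of "y \<ominus>\<^bsub>M\<^esub> x" x] x y by simp
    then show ?thesis
      using ker[OF y(2)] mod_hom_closed[OF \<Phi> x] by (simp add: \<Psi>_def y_def)
  qed
  show thesis
  proof (rule that[OF mod_homI \<Psi>])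
    fix X assume "X \<in> carrier (quot_module R M N)"
    then show "\<Psi> X \<in> carrier H"
      using \<Psi> mod_hom_closed[OF \<Phi>] by (auto simp: Q(3))
  next
    fix X Y assume "X \<in> carrier (quot_module R M N)" "Y \<in> carrier (quot_module R M N)"
    then obtain x y where "X = N +>\<^bsub>M\<^esub> x" "Y = N +>\<^bsub>M\<^esub> y" "x \<in> carrier M" "y \<in> carrier M"
      by (auto simp: Q(3))
    then show "\<Psi> (X \<oplus>\<^bsub>quot_module R M N\<^esub> Y) = \<Psi> X \<oplus>\<^bsub>H\<^esub> \<Psi> Y"
      using mod_hom_add[OF Q(2), of x y, symmetric] by (simp add: \<Psi> mod_hom_add[OF \<Phi>])
  next
    fix r X assume r: "r \<in> carrier R" and "X \<in> carrier (quot_module R M N)"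
    then obtain x where "X = N +>\<^bsub>M\<^esub> x" "x \<in> carrier M"
      by (auto simp: Q(3))
    then show "\<Psi> (r \<odot>\<^bsub>quot_module R M N\<^esub> X) = r \<odot>\<^bsub>H\<^esub> \<Psi> X"
      using mod_hom_smult[OF Q(2), of r x, symmetric] r by (simp add: \<Psi> mod_hom_smult[OF \<Phi>])
  qed
qed

lemma free_module_simps [simp]:
  "zero (free_module R I) = (\<lambda>_. \<zero>\<^bsub>R\<^esub>)"
  "add (free_module R I) = (\<lambda>x y i. x i \<oplus>\<^bsub>R\<^esub> y i)"
  "smult (free_module R I) = (\<lambda>r x i. r \<otimes>\<^bsub>R\<^esub> x i)"
  by (simp_all add: free_module_def)

lemma free_module_carrier:
  "x \<in> carrier (free_module R I) \<longleftrightarrow> (\<forall>i\<in>I. x i \<in> carrier R) \<and> (\<forall>i. i \<notin> I \<longrightarrow> x i = \<zero>\<^bsub>R\<^esub>) \<and>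
     finite {i. x i \<noteq> \<zero>\<^bsub>R\<^esub>}"
  by (simp add: free_module_def)

lemma free_module_coord: 
  assumes "cring R" "x \<in> carrier (free_module R I)"
  shows "x i \<in> carrier R"
proof -
  interpret R: cring R by fact
  show ?thesis using assms(2) by (cases "i \<in> I") (auto simp: free_module_carrier)
qed

lemma basis_vec_in_free:
  assumes "cring R" "i \<in> I"
  shows "basis_vec R i \<in> carrier (free_module R I)"
proof -
  interpret R: cring R by fact
  have "{j. basis_vec R i j \<noteq> \<zero>\<^bsub>R\<^esub>} \<subseteq> {i}"
    by (auto simp: basis_vec_def)
  then have "finite {j. basis_vec R i j \<noteq> \<zero>\<^bsub>R\<^esub>}"
    by (rule finite_subset) simp
  then show ?thesis
    using assms(2) by (auto simp: free_module_carrier basis_vec_def)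
qed

lemma module_free:
  assumes "cring R"
  shows "module R (free_module R I)"
proof -
  interpret R: cring R by fact
  let ?F = "free_module R I"
  have fin_add: "finite {i. x i \<oplus>\<^bsub>R\<^esub> y i \<noteq> \<zero>\<^bsub>R\<^esub>}"
    if "finite {i. x i \<noteq> \<zero>\<^bsub>R\<^esub>}" "finite {i. y i \<noteq> \<zero>\<^bsub>R\<^esub>}" for x y :: "'b \<Rightarrow> 'a"
    by (rule finite_subset[OF _ finite_UnI[OF that]]) auto
  have fin_smult: "finite {i. r \<otimes>\<^bsub>R\<^esub> x i \<noteq> \<zero>\<^bsub>R\<^esub>}"
    if "finite {i. x i \<noteq> \<zero>\<^bsub>R\<^esub>}" "r \<in> carrier R" for r and x :: "'b \<Rightarrow> 'a"
    by (rule finite_subset[OF _ that(1)]) (use that(2) in auto)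
  have coord: "\<And>i. x i \<in> carrier R" if "x \<in> carrier ?F" for x
    using free_module_coord[OF assms that] .
  have closed_add: "(\<lambda>i. x i \<oplus>\<^bsub>R\<^esub> y i) \<in> carrier ?F" if "x \<in> carrier ?F" "y \<in> carrier ?F" for x y
    using that by (auto simp: free_module_carrier fin_add)
  have closed_smult: "(\<lambda>i. r \<otimes>\<^bsub>R\<^esub> x i) \<in> carrier ?F" if "x \<in> carrier ?F" "r \<in> carrier R" for r x
    using that by (auto simp: free_module_carrier fin_smult)
  have closed_zero: "(\<lambda>_. \<zero>\<^bsub>R\<^esub>) \<in> carrier ?F"
    by (simp add: free_module_carrier)
  show ?thesis
  proof (rule moduleI)
    show "abelian_group ?F"
    proof (rule abelian_groupI)
      fix x assume x: "x \<in> carrier ?F"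
      have "(\<lambda>i. \<ominus>\<^bsub>R\<^esub> \<one>\<^bsub>R\<^esub> \<otimes>\<^bsub>R\<^esub> x i) \<in> carrier ?F"
        using x fin_smult[of x "\<ominus>\<^bsub>R\<^esub> \<one>\<^bsub>R\<^esub>"] by (auto simp: free_module_carrier)
      moreover have "(\<ominus>\<^bsub>R\<^esub> \<one>\<^bsub>R\<^esub> \<otimes>\<^bsub>R\<^esub> x i) \<oplus>\<^bsub>R\<^esub> x i = \<zero>\<^bsub>R\<^esub>" for i
        using coord[OF x, of i] by (simp add: R.l_minus R.l_neg)
      ultimately show "\<exists>y\<in>carrier ?F. y \<oplus>\<^bsub>?F\<^esub> x = \<zero>\<^bsub>?F\<^esub>"
        by (intro bexI[of _ "\<lambda>i. \<ominus>\<^bsub>R\<^esub> \<one>\<^bsub>R\<^esub> \<otimes>\<^bsub>R\<^esub> x i"]) auto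
    qed (simp_all add: coord R.a_ac closed_add closed_zero)
  qed (simp_all add: coord R.l_distr R.r_distr R.m_assoc R.is_cring closed_smult)
qed

lemma free_module_induct [consumes 2, case_names zero step]:
  assumes "cring R" "z \<in> carrier (free_module R I)"
    and zero: "P (\<lambda>_. \<zero>\<^bsub>R\<^esub>)"
    and step: "\<And>z r i. z \<in> carrier (free_module R I) \<Longrightarrow> P z \<Longrightarrow> r \<in> carrier R \<Longrightarrow> i \<in> I \<Longrightarrow>
      P (z \<oplus>\<^bsub>free_module R I\<^esub> r \<odot>\<^bsub>free_module R I\<^esub> basis_vec R i)"
  shows "P z"
proof -
  interpret R: cring R by fact
  have "\<forall>z. z \<in> carrier (free_module R I) \<longrightarrow> {i. z i \<noteq> \<zero>\<^bsub>R\<^esub>} \<subseteq> A \<longrightarrow> P z" if "finite A" for A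
    using that
  proof induction
    case empty
    have "P z" if "{i. z i \<noteq> \<zero>\<^bsub>R\<^esub>} \<subseteq> {}" for z
    proof -
      have "z = (\<lambda>_. \<zero>\<^bsub>R\<^esub>)" using that by auto
      then show ?thesis using zero by simp
    qed
    then show ?case by blast
  next
    case (insert i A)
    show ?case
    proof (intro allI impI)
      fix z assume z: "z \<in> carrier (free_module R I)" and supp: "{i. z i \<noteq> \<zero>\<^bsub>R\<^esub>} \<subseteq> insert i A"
      show "P z"
      proof (cases "i \<in> I")
        case False
        then have "{i. z i \<noteq> \<zero>\<^bsub>R\<^esub>} \<subseteq> A"
          using z supp unfolding free_module_carrier by auto
        then show ?thesis using z insert.IH by blast
      next
        case True
        define z' where "z' = z(i := \<zero>\<^bsub>R\<^esub>)"
        have sub: "{j. z' j \<noteq> \<zero>\<^bsub>R\<^esub>} \<subseteq> A" using supp by (auto simp: z'_def)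
        have z': "z' \<in> carrier (free_module R I)"
          using z finite_subset[OF sub insert.hyps(1)] by (simp add: free_module_carrier z'_def)
        have "P z'" using z' sub insert.IH by blast
        from step[OF z' this free_module_coord[OF assms(1) z, of i] True]
        have "P (z' \<oplus>\<^bsub>free_module R I\<^esub> z i \<odot>\<^bsub>free_module R I\<^esub> basis_vec R i)" .
        moreover have "z' \<oplus>\<^bsub>free_module R I\<^esub> z i \<odot>\<^bsub>free_module R I\<^esub> basis_vec R i = z"
        proof
          fix j
          show "(z' \<oplus>\<^bsub>free_module R I\<^esub> z i \<odot>\<^bsub>free_module R I\<^esub> basis_vec R i) j = z j"
            using free_module_coord[OF assms(1) z, of j] free_module_coord[OF assms(1) z, of i]
            by (simp add: basis_vec_def z'_def)
        qed
        ultimately show ?thesis by simp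
      qed
    qed
  qed
  moreover have "finite {i. z i \<noteq> \<zero>\<^bsub>R\<^esub>}"
    using assms(2) by (simp add: free_module_carrier)
  ultimately show ?thesis using assms(2) by blast
qed

lemma free_module_lift:
  assumes "module R H" and \<beta>: "\<And>i. i \<in> I \<Longrightarrow> \<beta> i \<in> carrier H"
  obtains \<Phi> where "\<Phi> \<in> mod_hom R (free_module R I) H"
    "\<And>i. i \<in> I \<Longrightarrow> \<Phi> (basis_vec R i) = \<beta> i"
proof -
  interpret H: module R H by fact
  have cr: "cring R" by (rule H.R.is_cring)
  let ?F = "free_module R I"
  define \<Phi> where "\<Phi> z = (\<Oplus>\<^bsub>H\<^esub>i\<in>{i. z i \<noteq> \<zero>\<^bsub>R\<^esub>}. z i \<odot>\<^bsub>H\<^esub> \<beta> i)" for z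
  have \<Phi>: "\<Phi> z = (\<Oplus>\<^bsub>H\<^esub>i\<in>A. z i \<odot>\<^bsub>H\<^esub> \<beta> i)"
    if "z \<in> carrier ?F" "finite A" "A \<subseteq> I" "{i. z i \<noteq> \<zero>\<^bsub>R\<^esub>} \<subseteq> A" for z A
    unfolding \<Phi>_def using that \<beta>
    by (intro H.add.finprod_mono_neutral_cong_left)
      (auto simp: subset_iff free_module_coord[OF cr] Pi_iff)
  have supp: "finite {i. z i \<noteq> \<zero>\<^bsub>R\<^esub>}" "{i. z i \<noteq> \<zero>\<^bsub>R\<^esub>} \<subseteq> I" if "z \<in> carrier ?F" for z
    using that by (auto simp: free_module_carrier)
  interpret F: module R ?F by (rule module_free[OF cr])
  show thesis
  proof (rule that[OF mod_homI])
    fix z assume z: "z \<in> carrier ?F"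
    then show "\<Phi> z \<in> carrier H"
      unfolding \<Phi>_def using supp[OF z] \<beta>
      by (intro H.finsum_closed) (auto simp: free_module_coord[OF cr])
  next
    fix z w assume z: "z \<in> carrier ?F" and w: "w \<in> carrier ?F"
    let ?A = "{i. z i \<noteq> \<zero>\<^bsub>R\<^esub>} \<union> {i. w i \<noteq> \<zero>\<^bsub>R\<^esub>}"
    have A: "finite ?A" "?A \<subseteq> I" using supp[OF z] supp[OF w] by auto
    have "\<Phi> (z \<oplus>\<^bsub>?F\<^esub> w) = (\<Oplus>\<^bsub>H\<^esub>i\<in>?A. (z \<oplus>\<^bsub>?F\<^esub> w) i \<odot>\<^bsub>H\<^esub> \<beta> i)"
      using A F.a_closed[OF z w] by (intro \<Phi>) auto
    also have "\<dots> = (\<Oplus>\<^bsub>H\<^esub>i\<in>?A. z i \<odot>\<^bsub>H\<^esub> \<beta> i \<oplus>\<^bsub>H\<^esub> w i \<odot>\<^bsub>H\<^esub> \<beta> i)"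
      using z w A \<beta> 
      by (intro H.finsum_cong') (auto simp: free_module_coord[OF cr] H.smult_l_distr subset_iff)
    also have "\<dots> = (\<Oplus>\<^bsub>H\<^esub>i\<in>?A. z i \<odot>\<^bsub>H\<^esub> \<beta> i) \<oplus>\<^bsub>H\<^esub> (\<Oplus>\<^bsub>H\<^esub>i\<in>?A. w i \<odot>\<^bsub>H\<^esub> \<beta> i)"
      using z w A \<beta> by (intro H.finsum_addf) (auto simp: free_module_coord[OF cr] subset_iff)
    also have "\<dots> = \<Phi> z \<oplus>\<^bsub>H\<^esub> \<Phi> w"
      using \<Phi>[OF z A] \<Phi>[OF w A] by simp
    finally show "\<Phi> (z \<oplus>\<^bsub>?F\<^esub> w) = \<Phi> z \<oplus>\<^bsub>H\<^esub> \<Phi> w" .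
  next
    fix r z assume r: "r \<in> carrier R" and z: "z \<in> carrier ?F"
    let ?A = "{i. z i \<noteq> \<zero>\<^bsub>R\<^esub>}"
    have "\<Phi> (r \<odot>\<^bsub>?F\<^esub> z) = (\<Oplus>\<^bsub>H\<^esub>i\<in>?A. (r \<odot>\<^bsub>?F\<^esub> z) i \<odot>\<^bsub>H\<^esub> \<beta> i)"
      using r supp[OF z] F.smult_closed[OF r z] by (intro \<Phi>) auto
    also have "\<dots> = (\<Oplus>\<^bsub>H\<^esub>i\<in>?A. r \<odot>\<^bsub>H\<^esub> (z i \<odot>\<^bsub>H\<^esub> \<beta> i))"
      using z r supp[OF z] \<beta> 
      by (intro H.finsum_cong') (auto simp: free_module_coord[OF cr] H.smult_assoc1 subset_iff)
    also have "\<dots> = r \<odot>\<^bsub>H\<^esub> \<Phi> z"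
      unfolding \<Phi>_def using z r supp[OF z] \<beta> 
      by (intro H.finsum_smult_ldistr[symmetric]) (auto simp: free_module_coord[OF cr] subset_iff)
    finally show "\<Phi> (r \<odot>\<^bsub>?F\<^esub> z) = r \<odot>\<^bsub>H\<^esub> \<Phi> z" .
  next
    fix i assume i: "i \<in> I"
    have "\<Phi> (basis_vec R i) = (\<Oplus>\<^bsub>H\<^esub>j\<in>{i}. basis_vec R i j \<odot>\<^bsub>H\<^esub> \<beta> j)"
      using i basis_vec_in_free[OF cr i] by (intro \<Phi>) (auto simp: basis_vec_def)
    also have "\<dots> = \<beta> i"
      using \<beta>[OF i] by (simp add: basis_vec_def)
    finally show "\<Phi> (basis_vec R i) = \<beta> i" .
  qed
qed


section \<open>Tensor products\<close>

lemma tensor_rels_subsetI: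
  fixes R :: "'a ring" and E :: "('a, 'e) module" and F :: "('a, 'f) module"
  defines "M \<equiv> free_module R (carrier E \<times> carrier F)"
  assumes "\<And>x x' y. x \<in> carrier E \<Longrightarrow> x' \<in> carrier E \<Longrightarrow> y \<in> carrier F \<Longrightarrow>
      basis_vec R (x \<oplus>\<^bsub>E\<^esub> x', y) \<ominus>\<^bsub>M\<^esub> (basis_vec R (x, y) \<oplus>\<^bsub>M\<^esub> basis_vec R (x', y)) \<in> Z"
    and "\<And>x y y'. x \<in> carrier E \<Longrightarrow> y \<in> carrier F \<Longrightarrow> y' \<in> carrier F \<Longrightarrow>
      basis_vec R (x, y \<oplus>\<^bsub>F\<^esub> y') \<ominus>\<^bsub>M\<^esub> (basis_vec R (x, y) \<oplus>\<^bsub>M\<^esub> basis_vec R (x, y')) \<in> Z"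
    and "\<And>r x y. r \<in> carrier R \<Longrightarrow> x \<in> carrier E \<Longrightarrow> y \<in> carrier F \<Longrightarrow>
      basis_vec R (r \<odot>\<^bsub>E\<^esub> x, y) \<ominus>\<^bsub>M\<^esub> (r \<odot>\<^bsub>M\<^esub> basis_vec R (x, y)) \<in> Z"
    and "\<And>r x y. r \<in> carrier R \<Longrightarrow> x \<in> carrier E \<Longrightarrow> y \<in> carrier F \<Longrightarrow>
      basis_vec R (x, r \<odot>\<^bsub>F\<^esub> y) \<ominus>\<^bsub>M\<^esub> (r \<odot>\<^bsub>M\<^esub> basis_vec R (x, y)) \<in> Z"
  shows "tensor_rels R E F \<subseteq> Z"
  unfolding tensor_rels_def Let_def M_def[symmetric]
  by (intro Un_least subsetI; elim CollectE exE conjE; simp only: assms(2-))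

lemma tensor_rels_subset:
  assumes "module R E" "module R F"
  shows "tensor_rels R E F \<subseteq> carrier (free_module R (carrier E \<times> carrier F))"
proof -
  interpret E: module R E by fact
  interpret F: module R F by fact
  interpret M: module R "free_module R (carrier E \<times> carrier F)"
    by (rule module_free[OF E.R.is_cring])
  note b = basis_vec_in_free[OF E.R.is_cring]
  show ?thesis
    by (intro tensor_rels_subsetI M.minus_closed M.a_closed M.smult_closed b SigmaI
        E.a_closed F.a_closed E.smult_closed F.smult_closed)
qed

lemma submodule_tensor_ker:
  assumes "module R E" "module R F"
  shows "submodule (tensor_ker R E F) R (free_module R (carrier E \<times> carrier F))"
  unfolding tensor_ker_def
  by (intro submodule_gen_submodule tensor_rels_subset module_free assms module.axioms(1)[OF assms(1)])

lemma module_tensor: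
  assumes "module R E" "module R F"
  shows "module R (tensor R E F)"
  unfolding tensor_def
  by (intro module_quot submodule_tensor_ker module_free assms module.axioms(1)[OF assms(1)])

lemma pure_tensor_facts:
  assumes "module R E" "module R F"
  shows pure_tensor_closed: "\<And>x y. x \<in> carrier E \<Longrightarrow> y \<in> carrier F \<Longrightarrow>
      pure_tensor R E F x y \<in> carrier (tensor R E F)"
    and pure_tensor_add_left: "\<And>x x' y. x \<in> carrier E \<Longrightarrow> x' \<in> carrier E \<Longrightarrow> y \<in> carrier F \<Longrightarrow>
      pure_tensor R E F (x \<oplus>\<^bsub>E\<^esub> x') y =
      pure_tensor R E F x y \<oplus>\<^bsub>tensor R E F\<^esub> pure_tensor R E F x' y"
    and pure_tensor_add_right: "\<And>x y y'. x \<in> carrier E \<Longrightarrow> y \<in> carrier F \<Longrightarrow> y' \<in> carrier F \<Longrightarrow>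
      pure_tensor R E F x (y \<oplus>\<^bsub>F\<^esub> y') =
      pure_tensor R E F x y \<oplus>\<^bsub>tensor R E F\<^esub> pure_tensor R E F x y'"
    and pure_tensor_smult_left: "\<And>r x y. r \<in> carrier R \<Longrightarrow> x \<in> carrier E \<Longrightarrow> y \<in> carrier F \<Longrightarrow>
      pure_tensor R E F (r \<odot>\<^bsub>E\<^esub> x) y = r \<odot>\<^bsub>tensor R E F\<^esub> pure_tensor R E F x y"
    and pure_tensor_smult_right: "\<And>r x y. r \<in> carrier R \<Longrightarrow> x \<in> carrier E \<Longrightarrow> y \<in> carrier F \<Longrightarrow>
      pure_tensor R E F x (r \<odot>\<^bsub>F\<^esub> y) = r \<odot>\<^bsub>tensor R E F\<^esub> pure_tensor R E F x y"
proof -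
  interpret E: module R E by fact
  interpret F: module R F by fact
  let ?M = "free_module R (carrier E \<times> carrier F)"
  let ?K = "tensor_ker R E F"
  interpret M: module R ?M by (rule module_free[OF E.R.is_cring])
  have b: "basis_vec R (x, y) \<in> carrier ?M" if "x \<in> carrier E" "y \<in> carrier F" for x y
    by (rule basis_vec_in_free[OF E.R.is_cring]) (use that in auto)
  note Q = quot_module_facts[OF M.module_axioms submodule_tensor_ker[OF assms]]
  note h = mod_hom_closed[OF Q(2)] mod_hom_add[OF Q(2), symmetric] mod_hom_smult[OF Q(2), symmetric]
  have K: "tensor_rels R E F \<subseteq> ?K"
    unfolding tensor_ker_def by (rule gen_submodule_incl)
  fix x x' y y' r
  assume x: "x \<in> carrier E"
  { assume y: "y \<in> carrier F"
    then show "pure_tensor R E F x y \<in> carrier (tensor R E F)"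
      using x b h(1) by (simp add: pure_tensor_def tensor_def) 
    { assume x': "x' \<in> carrier E"
      have "basis_vec R (x \<oplus>\<^bsub>E\<^esub> x', y) \<ominus>\<^bsub>?M\<^esub> (basis_vec R (x, y) \<oplus>\<^bsub>?M\<^esub> basis_vec R (x', y)) \<in> ?K"
        using x x' y unfolding tensor_rels_def Let_def
          by (intro subsetD[OF K[unfolded tensor_rels_def Let_def]])
            (rule UnI1, rule UnI1, rule UnI1, blast)
      then show "pure_tensor R E F (x \<oplus>\<^bsub>E\<^esub> x') y =
          pure_tensor R E F x y \<oplus>\<^bsub>tensor R E F\<^esub> pure_tensor R E F x' y"
        using x x' y b unfolding pure_tensor_def tensor_def
        by (subst h(2)) (auto simp: Q(4) simp del: free_module_simps) }
    { assume y': "y' \<in> carrier F"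
      have "basis_vec R (x, y \<oplus>\<^bsub>F\<^esub> y') \<ominus>\<^bsub>?M\<^esub> (basis_vec R (x, y) \<oplus>\<^bsub>?M\<^esub> basis_vec R (x, y')) \<in> ?K"
        using x y' y unfolding tensor_rels_def Let_def
          by (intro subsetD[OF K[unfolded tensor_rels_def Let_def]])
            (rule UnI1, rule UnI1, rule UnI2, blast)
      then show "pure_tensor R E F x (y \<oplus>\<^bsub>F\<^esub> y') =
          pure_tensor R E F x y \<oplus>\<^bsub>tensor R E F\<^esub> pure_tensor R E F x y'"
        using x y' y b unfolding pure_tensor_def tensor_def
        by (subst h(2)) (auto simp: Q(4) simp del: free_module_simps) } }
  assume r: "r \<in> carrier R"
  note [simp del] = free_module_simps
  show "pure_tensor R E F (r \<odot>\<^bsub>E\<^esub> x) y = r \<odot>\<^bsub>tensor R E F\<^esub> pure_tensor R E F x y"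
    if y: "y \<in> carrier F"
  proof -
    have "basis_vec R (r \<odot>\<^bsub>E\<^esub> x, y) \<ominus>\<^bsub>?M\<^esub> (r \<odot>\<^bsub>?M\<^esub> basis_vec R (x, y)) \<in> ?K"
      using x y r
      by (intro subsetD[OF K[unfolded tensor_rels_def Let_def]]) (rule UnI1, rule UnI2, blast)
    then show ?thesis
      using x y r b unfolding pure_tensor_def tensor_def
      by (subst h(3)) (auto simp: Q(4))
  qed
  show "pure_tensor R E F x (r \<odot>\<^bsub>F\<^esub> y) = r \<odot>\<^bsub>tensor R E F\<^esub> pure_tensor R E F x y"
    if y: "y \<in> carrier F"
  proof -
    have "basis_vec R (x, r \<odot>\<^bsub>F\<^esub> y) \<ominus>\<^bsub>?M\<^esub> (r \<odot>\<^bsub>?M\<^esub> basis_vec R (x, y)) \<in> ?K"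
      using x y r
      by (intro subsetD[OF K[unfolded tensor_rels_def Let_def]]) (rule UnI2, blast)
    then show ?thesis
      using x y r b unfolding pure_tensor_def tensor_def
      by (subst h(3)) (auto simp: Q(4))
  qed
qed

text \<open>
  Scalars can be moved into the first factor of a pure tensor, so sums of pure tensors already
  exhaust the tensor product and induction does not need a step for scalar multiples.
\<close>

lemma tensor_induct [consumes 3, case_names pure add]:
  assumes "module R E" "module R F" "t \<in> carrier (tensor R E F)"
    and pure: "\<And>x y. x \<in> carrier E \<Longrightarrow> y \<in> carrier F \<Longrightarrow> P (pure_tensor R E F x y)"
    and add: "\<And>s t. s \<in> carrier (tensor R E F) \<Longrightarrow> t \<in> carrier (tensor R E F) \<Longrightarrow> P s \<Longrightarrow> P t \<Longrightarrow>
      P (s \<oplus>\<^bsub>tensor R E F\<^esub> t)"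
  shows "P t"
proof -
  interpret E: module R E by fact
  interpret F: module R F by fact
  let ?M = "free_module R (carrier E \<times> carrier F)"
  let ?K = "tensor_ker R E F"
  have cr: "cring R" by (rule E.R.is_cring)
  interpret M: module R ?M by (rule module_free[OF cr])
  interpret T: module R "tensor R E F" by (rule module_tensor[OF assms(1,2)])
  note [simp del] = free_module_simps
  note Q = quot_module_facts[OF M.module_axioms submodule_tensor_ker[OF assms(1,2)]]
  note pt = pure_tensor_facts[OF assms(1,2)]
  obtain z where z: "z \<in> carrier ?M" "t = ?K +>\<^bsub>?M\<^esub> z"
    using assms(3) unfolding tensor_def Q(3) by blast
  have h: "?K +>\<^bsub>?M\<^esub> (a \<oplus>\<^bsub>?M\<^esub> b) = (?K +>\<^bsub>?M\<^esub> a) \<oplus>\<^bsub>tensor R E F\<^esub> (?K +>\<^bsub>?M\<^esub> b)"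
    if "a \<in> carrier ?M" "b \<in> carrier ?M" for a b
    using mod_hom_add[OF Q(2)] that by (simp add: tensor_def)
  have hc: "?K +>\<^bsub>?M\<^esub> a \<in> carrier (tensor R E F)" if "a \<in> carrier ?M" for a
    using mod_hom_closed[OF Q(2)] that by (simp add: tensor_def)
  have hs: "?K +>\<^bsub>?M\<^esub> (r \<odot>\<^bsub>?M\<^esub> basis_vec R (x, y)) = pure_tensor R E F (r \<odot>\<^bsub>E\<^esub> x) y"
    if "r \<in> carrier R" "x \<in> carrier E" "y \<in> carrier F" for r x y
    using mod_hom_smult[OF Q(2), of r "basis_vec R (x, y)"] that
      basis_vec_in_free[OF cr, of "(x, y)" "carrier E \<times> carrier F"]
    by (simp add: tensor_def pure_tensor_def[symmetric] pt(4))
  from cr z(1) have "P (?K +>\<^bsub>?M\<^esub> z)"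
  proof (rule free_module_induct)
    have "?K +>\<^bsub>?M\<^esub> (\<lambda>_. \<zero>\<^bsub>R\<^esub>) = \<zero>\<^bsub>tensor R E F\<^esub>"
      using mod_hom_zero[OF M.module_axioms Q(1) Q(2)] by (simp add: tensor_def free_module_simps)
    also have "\<dots> = \<zero>\<^bsub>R\<^esub> \<odot>\<^bsub>tensor R E F\<^esub> pure_tensor R E F \<zero>\<^bsub>E\<^esub> \<zero>\<^bsub>F\<^esub>"
      by (simp add: pt(1))
    also have "\<dots> = pure_tensor R E F \<zero>\<^bsub>E\<^esub> \<zero>\<^bsub>F\<^esub>"
      by (subst pt(4)[symmetric]) auto
    finally show "P (?K +>\<^bsub>?M\<^esub> (\<lambda>_. \<zero>\<^bsub>R\<^esub>))"
      using pure by simp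
  next
    fix z r i
    assume z: "z \<in> carrier ?M" "P (?K +>\<^bsub>?M\<^esub> z)" and r: "r \<in> carrier R" and i: "i \<in> carrier E \<times> carrier F"
    obtain x y where xy: "i = (x, y)" "x \<in> carrier E" "y \<in> carrier F"
      using i by auto
    have b: "r \<odot>\<^bsub>?M\<^esub> basis_vec R i \<in> carrier ?M"
      using basis_vec_in_free[OF cr i] r by simp
    show "P (?K +>\<^bsub>?M\<^esub> (z \<oplus>\<^bsub>?M\<^esub> r \<odot>\<^bsub>?M\<^esub> basis_vec R i))"
      unfolding h[OF z(1) b]
      using z r xy b hc hs pt(1) by (intro add) (auto intro!: pure)
  qed
  with z(2) show ?thesis by simp
qed

lemma tensor_lift:
  assumes "module R E" "module R F" "module R H"
    and closed: "\<And>x y. x \<in> carrier E \<Longrightarrow> y \<in> carrier F \<Longrightarrow> \<beta> x y \<in> carrier H"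
    and add_left: "\<And>x x' y. x \<in> carrier E \<Longrightarrow> x' \<in> carrier E \<Longrightarrow> y \<in> carrier F \<Longrightarrow>
      \<beta> (x \<oplus>\<^bsub>E\<^esub> x') y = \<beta> x y \<oplus>\<^bsub>H\<^esub> \<beta> x' y"
    and add_right: "\<And>x y y'. x \<in> carrier E \<Longrightarrow> y \<in> carrier F \<Longrightarrow> y' \<in> carrier F \<Longrightarrow>
      \<beta> x (y \<oplus>\<^bsub>F\<^esub> y') = \<beta> x y \<oplus>\<^bsub>H\<^esub> \<beta> x y'"
    and smult_left: "\<And>r x y. r \<in> carrier R \<Longrightarrow> x \<in> carrier E \<Longrightarrow> y \<in> carrier F \<Longrightarrow>
      \<beta> (r \<odot>\<^bsub>E\<^esub> x) y = r \<odot>\<^bsub>H\<^esub> \<beta> x y"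
    and smult_right: "\<And>r x y. r \<in> carrier R \<Longrightarrow> x \<in> carrier E \<Longrightarrow> y \<in> carrier F \<Longrightarrow>
      \<beta> x (r \<odot>\<^bsub>F\<^esub> y) = r \<odot>\<^bsub>H\<^esub> \<beta> x y"
  obtains \<Phi> where "\<Phi> \<in> mod_hom R (tensor R E F) H"
    "\<And>x y. x \<in> carrier E \<Longrightarrow> y \<in> carrier F \<Longrightarrow> \<Phi> (pure_tensor R E F x y) = \<beta> x y"
proof -
  interpret E: module R E by fact
  interpret F: module R F by fact
  interpret H: module R H by fact
  let ?M = "free_module R (carrier E \<times> carrier F)"
  let ?K = "tensor_ker R E F"
  have cr: "cring R" by (rule E.R.is_cring)
  interpret M: module R ?M by (rule module_free[OF cr])
  note [simp del] = free_module_simps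
  obtain \<Phi> where \<Phi>: "\<Phi> \<in> mod_hom R ?M H"
      and \<Phi>b: "\<And>i. i \<in> carrier E \<times> carrier F \<Longrightarrow> \<Phi> (basis_vec R i) = case_prod \<beta> i"
    by (rule free_module_lift[OF assms(3), of "carrier E \<times> carrier F" "case_prod \<beta>"])
      (auto simp: closed)
  have b: "basis_vec R (x, y) \<in> carrier ?M" if "x \<in> carrier E" "y \<in> carrier F" for x y
    by (rule basis_vec_in_free[OF cr]) (use that in auto)
  have eq_ker: "a \<ominus>\<^bsub>?M\<^esub> c \<in> {x \<in> carrier ?M. \<Phi> x = \<zero>\<^bsub>H\<^esub>}"
    if "a \<in> carrier ?M" "c \<in> carrier ?M" "\<Phi> a = \<Phi> c" for a c
  proof -
    have "\<Phi> (a \<ominus>\<^bsub>?M\<^esub> c) = \<Phi> (a \<oplus>\<^bsub>?M\<^esub> (\<ominus>\<^bsub>R\<^esub> \<one>\<^bsub>R\<^esub>) \<odot>\<^bsub>?M\<^esub> c)"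
      using that by (simp add: M.smult_l_minus M.minus_eq)
    also have "\<dots> = \<Phi> a \<oplus>\<^bsub>H\<^esub> (\<ominus>\<^bsub>R\<^esub> \<one>\<^bsub>R\<^esub>) \<odot>\<^bsub>H\<^esub> \<Phi> c"
      using that by (simp add: mod_hom_add[OF \<Phi>] mod_hom_smult[OF \<Phi>])
    also have "\<dots> = \<zero>\<^bsub>H\<^esub>"
      using that mod_hom_closed[OF \<Phi>] by (simp add: H.smult_l_minus H.r_neg)
    finally show ?thesis using that by simp
  qed
  let ?Z = "{x \<in> carrier ?M. \<Phi> x = \<zero>\<^bsub>H\<^esub>}"
  have \<Phi>b': "\<Phi> (basis_vec R (x, y)) = \<beta> x y" if "x \<in> carrier E" "y \<in> carrier F" for x y
    using \<Phi>b[of "(x, y)"] that by simp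
  note \<Phi>_simps = \<Phi>b' mod_hom_add[OF \<Phi>] mod_hom_smult[OF \<Phi>] b
  have "tensor_rels R E F \<subseteq> ?Z"
    by (rule tensor_rels_subsetI; rule eq_ker)
      (simp_all add: \<Phi>_simps add_left add_right smult_left smult_right)
  then have K: "?K \<subseteq> ?Z"
    unfolding tensor_ker_def
    by (rule gen_submodule_least[OF submodule_kernel[OF M.module_axioms assms(3) \<Phi>]])
  then have ker: "\<Phi> x = \<zero>\<^bsub>H\<^esub>" if "x \<in> ?K" for x
    using that by auto
  show thesis
  proof (rule quot_module_lift[OF M.module_axioms submodule_tensor_ker[OF assms(1,2)] assms(3) \<Phi> ker])
    fix \<Psi> assume \<Psi>: "\<Psi> \<in> mod_hom R (quot_module R ?M ?K) H"
      "\<And>x. x \<in> carrier ?M \<Longrightarrow> \<Psi> (?K +>\<^bsub>?M\<^esub> x) = \<Phi> x"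
    show thesis
    proof (rule that)
      show "\<Psi> \<in> mod_hom R (tensor R E F) H"
        unfolding tensor_def by (rule \<Psi>(1))
      show "\<Psi> (pure_tensor R E F x y) = \<beta> x y" if "x \<in> carrier E" "y \<in> carrier F" for x y
        unfolding pure_tensor_def using that b \<Psi>(2) \<Phi>b' by simp
    qed
  qed
qed


section \<open>Invertible modules and their exchange functionals\<close>

text \<open>
  On a module that is locally free of rank one every functional has this property, because there it is
  locally a multiple of the coordinate.  Conversely, the property makes \<open>e\<close> a basis vector with
  coordinate \<open>f / f e\<close> wherever the scalar \<open>f e\<close> is invertible.
\<close>

definition exchange_functionals :: "'a ring \<Rightarrow> ('a, 'e) module \<Rightarrow> ('e \<Rightarrow> 'a) set" where
  "exchange_functionals R E =
    {f \<in> mod_hom R E (self_module R). \<forall>x\<in>carrier E. \<forall>y\<in>carrier E. f x \<odot>\<^bsub>E\<^esub> y = f y \<odot>\<^bsub>E\<^esub> x}"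

definition invertible_module :: "'a ring \<Rightarrow> ('a, 'e) module \<Rightarrow> bool" where
  "invertible_module R E \<longleftrightarrow> module R E \<and>
    \<one>\<^bsub>R\<^esub> \<in> genideal R {f x | f x. f \<in> exchange_functionals R E \<and> x \<in> carrier E}"

lemma exchange_facts:
  assumes "f \<in> exchange_functionals R E"
  shows exchange_closed: "\<And>x. x \<in> carrier E \<Longrightarrow> f x \<in> carrier R"
    and exchange_add: "\<And>x y. x \<in> carrier E \<Longrightarrow> y \<in> carrier E \<Longrightarrow> f (x \<oplus>\<^bsub>E\<^esub> y) = f x \<oplus>\<^bsub>R\<^esub> f y"
    and exchange_smult: "\<And>r x. r \<in> carrier R \<Longrightarrow> x \<in> carrier E \<Longrightarrow> f (r \<odot>\<^bsub>E\<^esub> x) = r \<otimes>\<^bsub>R\<^esub> f x"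
    and exchange: "\<And>x y. x \<in> carrier E \<Longrightarrow> y \<in> carrier E \<Longrightarrow> f x \<odot>\<^bsub>E\<^esub> y = f y \<odot>\<^bsub>E\<^esub> x"
    and exchange_hom: "f \<in> mod_hom R E (self_module R)"
  using assms unfolding exchange_functionals_def mod_hom_def by (auto simp: Pi_iff)

lemma exchangeI:
  assumes "\<And>x. x \<in> carrier E \<Longrightarrow> f x \<in> carrier R"
    and "\<And>x y. x \<in> carrier E \<Longrightarrow> y \<in> carrier E \<Longrightarrow> f (x \<oplus>\<^bsub>E\<^esub> y) = f x \<oplus>\<^bsub>R\<^esub> f y"
    and "\<And>r x. r \<in> carrier R \<Longrightarrow> x \<in> carrier E \<Longrightarrow> f (r \<odot>\<^bsub>E\<^esub> x) = r \<otimes>\<^bsub>R\<^esub> f x"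
    and "\<And>x y. x \<in> carrier E \<Longrightarrow> y \<in> carrier E \<Longrightarrow> f x \<odot>\<^bsub>E\<^esub> y = f y \<odot>\<^bsub>E\<^esub> x"
  shows "f \<in> exchange_functionals R E"
  using assms unfolding exchange_functionals_def mod_hom_def by (auto simp: Pi_iff)

lemma exchange_cong:
  assumes "module R E" "f \<in> exchange_functionals R E" "\<And>x. x \<in> carrier E \<Longrightarrow> g x = f x"
  shows "g \<in> exchange_functionals R E"
proof -
  interpret E: module R E by fact
  note f = exchange_facts[OF assms(2)]
  show ?thesis
    by (rule exchangeI) (simp_all add: assms(3) f(1,2,3), rule f(4))
qed

lemma exchange_zero:
  assumes "module R E"
  shows "(\<lambda>_. \<zero>\<^bsub>R\<^esub>) \<in> exchange_functionals R E"
proof -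
  interpret E: module R E by fact
  show ?thesis by (rule exchangeI) simp_all
qed

lemma exchange_sum:
  assumes "module R E" "f \<in> exchange_functionals R E" "g \<in> exchange_functionals R E"
  shows "(\<lambda>x. f x \<oplus>\<^bsub>R\<^esub> g x) \<in> exchange_functionals R E"
proof -
  interpret E: module R E by fact
  note f = exchange_facts[OF assms(2)] and g = exchange_facts[OF assms(3)]
  show ?thesis
  proof (rule exchangeI)
    fix x y assume "x \<in> carrier E" "y \<in> carrier E"
    then show "(f x \<oplus>\<^bsub>R\<^esub> g x) \<odot>\<^bsub>E\<^esub> y = (f y \<oplus>\<^bsub>R\<^esub> g y) \<odot>\<^bsub>E\<^esub> x"
      using f(4)[of x y] g(4)[of x y] f(1) g(1) by (simp add: E.smult_l_distr)
  qed (simp_all add: f(1-3) g(1-3) E.R.r_distr E.R.a_ac)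
qed

lemma exchange_scale:
  assumes "module R E" "f \<in> exchange_functionals R E" "r \<in> carrier R"
  shows "(\<lambda>x. r \<otimes>\<^bsub>R\<^esub> f x) \<in> exchange_functionals R E"
proof -
  interpret E: module R E by fact
  note f = exchange_facts[OF assms(2)]
  show ?thesis
  proof (rule exchangeI)
    fix x y assume "x \<in> carrier E" "y \<in> carrier E"
    then show "(r \<otimes>\<^bsub>R\<^esub> f x) \<odot>\<^bsub>E\<^esub> y = (r \<otimes>\<^bsub>R\<^esub> f y) \<odot>\<^bsub>E\<^esub> x"
      using f(4)[of x y] f(1) assms(3) by (simp add: E.smult_assoc1)
  qed (simp_all add: f(1-3) assms(3) E.R.r_distr E.R.m_ac)
qed

lemma ideal_Collect:
  assumes "cring R" "P \<zero>\<^bsub>R\<^esub>"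
    and add: "\<And>r s. r \<in> carrier R \<Longrightarrow> s \<in> carrier R \<Longrightarrow> P r \<Longrightarrow> P s \<Longrightarrow> P (r \<oplus>\<^bsub>R\<^esub> s)"
    and mult: "\<And>r s. r \<in> carrier R \<Longrightarrow> s \<in> carrier R \<Longrightarrow> P s \<Longrightarrow> P (r \<otimes>\<^bsub>R\<^esub> s)"
  shows "ideal {r \<in> carrier R. P r} R"
proof -
  interpret R: cring R by fact
  have minus: "P (\<ominus>\<^bsub>R\<^esub> r)" if "r \<in> carrier R" "P r" for r
    using mult[of "\<ominus>\<^bsub>R\<^esub> \<one>\<^bsub>R\<^esub>" r] that by (simp add: R.l_minus)
  show ?thesis
  proof (rule idealI)
    show "subgroup {r \<in> carrier R. P r} (add_monoid R)"
      by (rule R.add.subgroupI) (use assms(2) in \<open>auto simp: add minus\<close>)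
    fix a x assume "a \<in> {r \<in> carrier R. P r}" "x \<in> carrier R"
    then show "x \<otimes>\<^bsub>R\<^esub> a \<in> {r \<in> carrier R. P r}" "a \<otimes>\<^bsub>R\<^esub> x \<in> {r \<in> carrier R. P r}"
      using mult[of x a] by (simp_all add: R.m_comm)
  qed (rule R.ring_axioms)
qed

text \<open>
  The scalars with property \<open>P\<close> form an ideal; it contains the values that generate the unit ideal.
  This plays the part of the principle that local statements hold globally.
\<close>

lemma invertible_induct [consumes 1, case_names functional add mult]:
  assumes "invertible_module R E"
    and val: "\<And>f x. f \<in> exchange_functionals R E \<Longrightarrow> x \<in> carrier E \<Longrightarrow> P (f x)"
    and add: "\<And>r s. r \<in> carrier R \<Longrightarrow> s \<in> carrier R \<Longrightarrow> P r \<Longrightarrow> P s \<Longrightarrow> P (r \<oplus>\<^bsub>R\<^esub> s)"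
    and mult: "\<And>r s. r \<in> carrier R \<Longrightarrow> s \<in> carrier R \<Longrightarrow> P s \<Longrightarrow> P (r \<otimes>\<^bsub>R\<^esub> s)"
  shows "P \<one>\<^bsub>R\<^esub>"
proof -
  have E: "module R E" using assms(1) by (simp add: invertible_module_def)
  interpret E: module R E by fact
  have "P \<zero>\<^bsub>R\<^esub>"
    by (rule val[OF exchange_zero[OF E] E.zero_closed])
  then have "ideal {r \<in> carrier R. P r} R"
    using add mult by (rule ideal_Collect[of R P, OF E.R.is_cring])
  moreover have "{f x | f x. f \<in> exchange_functionals R E \<and> x \<in> carrier E} \<subseteq> {r \<in> carrier R. P r}"
    by (auto intro: val exchange_closed)
  ultimately have "\<one>\<^bsub>R\<^esub> \<in> {r \<in> carrier R. P r}"
    using assms(1) unfolding invertible_module_def genideal_def by (auto simp del: mem_Collect_eq)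
  then show ?thesis by simp
qed

lemma invertibleI:
  assumes "module R E"
    and "\<And>I. ideal I R \<Longrightarrow> (\<And>f x. f \<in> exchange_functionals R E \<Longrightarrow> x \<in> carrier E \<Longrightarrow> f x \<in> I) \<Longrightarrow>
      \<one>\<^bsub>R\<^esub> \<in> I"
  shows "invertible_module R E"
  using assms unfolding invertible_module_def genideal_def by blast

lemma invertible_imp_module: "invertible_module R E \<Longrightarrow> module R E"
  by (simp add: invertible_module_def)

lemma invertible_faithful:
  assumes "invertible_module R E" "r \<in> carrier R"
    and kill: "\<And>x. x \<in> carrier E \<Longrightarrow> r \<odot>\<^bsub>E\<^esub> x = \<zero>\<^bsub>E\<^esub>"
  shows "r = \<zero>\<^bsub>R\<^esub>"
proof -
  interpret E: module R E using assms(1) by (rule invertible_imp_module)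
  from assms(1) have "r \<otimes>\<^bsub>R\<^esub> \<one>\<^bsub>R\<^esub> = \<zero>\<^bsub>R\<^esub>"
  proof (induction rule: invertible_induct)
    case (functional f x)
    have "r \<otimes>\<^bsub>R\<^esub> f x = f \<zero>\<^bsub>E\<^esub>"
      using exchange_smult[OF functional(1) assms(2) functional(2)] kill[OF functional(2)] by simp
    also have "\<dots> = \<zero>\<^bsub>R\<^esub>"
      using mod_hom_zero[OF E.module_axioms module_self[OF E.R.is_cring] exchange_hom[OF functional(1)]]
      by simp
    finally show ?case .
  next
    case (mult s t)
    then show ?case using assms(2) by (subst E.R.m_lcomm) simp_all
  qed (simp add: assms(2) E.R.r_distr)
  then show ?thesis using assms(2) by simp
qed

lemma invertible_separating:
  assumes "invertible_module R E" "x \<in> carrier E"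
    and kill: "\<And>f. f \<in> exchange_functionals R E \<Longrightarrow> f x = \<zero>\<^bsub>R\<^esub>"
  shows "x = \<zero>\<^bsub>E\<^esub>"
proof -
  interpret E: module R E using assms(1) by (rule invertible_imp_module)
  from assms(1) have "\<one>\<^bsub>R\<^esub> \<odot>\<^bsub>E\<^esub> x = \<zero>\<^bsub>E\<^esub>"
  proof (induction rule: invertible_induct)
    case (functional f y)
    then show ?case
      using exchange[OF functional(1) functional(2) assms(2)] kill[OF functional(1)] by simp
  qed (simp_all add: assms(2) E.smult_l_distr E.smult_assoc1)
  then show ?thesis using assms(2) by simp
qed

lemma hom_injI:
  assumes "module R E" "module R F" and f: "f \<in> mod_hom R E F"
    and ker: "\<And>x. x \<in> carrier E \<Longrightarrow> f x = \<zero>\<^bsub>F\<^esub> \<Longrightarrow> x = \<zero>\<^bsub>E\<^esub>"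
  shows "inj_on f (carrier E)"
proof
  interpret E: module R E by fact
  interpret F: module R F by fact
  fix x y assume x: "x \<in> carrier E" and y: "y \<in> carrier E" and eq: "f x = f y"
  have "f (x \<ominus>\<^bsub>E\<^esub> y) = f (x \<oplus>\<^bsub>E\<^esub> (\<ominus>\<^bsub>R\<^esub> \<one>\<^bsub>R\<^esub>) \<odot>\<^bsub>E\<^esub> y)"
    using x y by (simp add: E.smult_l_minus E.minus_eq)
  also have "\<dots> = \<zero>\<^bsub>F\<^esub>"
    using x y mod_hom_closed[OF f y]
    by (simp add: mod_hom_add[OF f] mod_hom_smult[OF f] eq F.smult_l_minus F.r_neg)
  finally have "x \<ominus>\<^bsub>E\<^esub> y = \<zero>\<^bsub>E\<^esub>"
    using ker x y by simp
  moreover have "x = (x \<ominus>\<^bsub>E\<^esub> y) \<oplus>\<^bsub>E\<^esub> y"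
    using x y by (simp add: E.minus_eq E.a_assoc E.l_neg)
  ultimately show "x = y" using y by simp
qed

text \<open>
  If \<open>\<phi> x = 0\<close>, then \<open>f x\<close> annihilates every \<open>\<phi> y\<close>, because \<open>f x\<close> times \<open>\<phi> y\<close> is \<open>\<phi> (f y x) = 0\<close>.
  As \<open>\<phi>\<close> is onto and the target is faithful, \<open>f x = 0\<close> for every exchange functional \<open>f\<close>, and these
  separate points.
\<close>

lemma onto_imp_iso:
  assumes "invertible_module R E" "invertible_module R F"
    and \<phi>: "\<phi> \<in> mod_hom R E F" and onto: "carrier F \<subseteq> \<phi> ` carrier E"
  shows "mod_iso R E F"
proof -
  interpret E: module R E using assms(1) by (rule invertible_imp_module)
  interpret F: module R F using assms(2) by (rule invertible_imp_module)
  have "inj_on \<phi> (carrier E)"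
  proof (rule hom_injI[OF E.module_axioms F.module_axioms \<phi>])
    fix x assume x: "x \<in> carrier E" and 0: "\<phi> x = \<zero>\<^bsub>F\<^esub>"
    show "x = \<zero>\<^bsub>E\<^esub>"
    proof (rule invertible_separating[OF assms(1) x])
      fix f assume f: "f \<in> exchange_functionals R E"
      note fc = exchange_closed[OF f]
      show "f x = \<zero>\<^bsub>R\<^esub>"
      proof (rule invertible_faithful[OF assms(2) fc[OF x]])
        fix z assume "z \<in> carrier F"
        then obtain y where y: "y \<in> carrier E" "z = \<phi> y"
          using onto by auto
        have "f x \<odot>\<^bsub>F\<^esub> z = \<phi> (f x \<odot>\<^bsub>E\<^esub> y)"
          using mod_hom_smult[OF \<phi> fc[OF x] y(1)] y(2) by simp
        also have "\<dots> = \<phi> (f y \<odot>\<^bsub>E\<^esub> x)"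
          using exchange[OF f x y(1)] by simp
        also have "\<dots> = \<zero>\<^bsub>F\<^esub>"
          using mod_hom_smult[OF \<phi> fc[OF y(1)] x] 0 fc[OF y(1)] by simp
        finally show "f x \<odot>\<^bsub>F\<^esub> z = \<zero>\<^bsub>F\<^esub>" .
      qed
    qed
  qed
  moreover have "\<phi> ` carrier E = carrier F"
    using onto mod_hom_closed[OF \<phi>] by auto
  ultimately show ?thesis
    unfolding mod_iso_def bij_betw_def using \<phi> by blast
qed

lemma invertible_iso:
  assumes "invertible_module R E" "module R F" "mod_iso R E F"
  shows "invertible_module R F"
proof -
  interpret E: module R E using assms(1) by (rule invertible_imp_module)
  interpret F: module R F by fact
  obtain \<phi> where \<phi>: "\<phi> \<in> mod_hom R E F" and bij: "bij_betw \<phi> (carrier E) (carrier F)"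
    using assms(3) unfolding mod_iso_def by blast
  let ?\<psi> = "inv_into (carrier E) \<phi>"
  have \<psi>: "?\<psi> \<in> mod_hom R F E"
    by (rule mod_hom_inverse[OF E.module_axioms \<phi> bij])
  have \<phi>\<psi>: "\<phi> (?\<psi> y) = y" if "y \<in> carrier F" for y
    using that bij by (simp add: bij_betw_def f_inv_into_f)
  have \<psi>\<phi>: "?\<psi> (\<phi> x) = x" if "x \<in> carrier E" for x
    using that bij by (simp add: bij_betw_def)
  have exch: "(\<lambda>y. f (?\<psi> y)) \<in> exchange_functionals R F" if f: "f \<in> exchange_functionals R E" for f
  proof (rule exchangeI)
    fix x y assume xy: "x \<in> carrier F" "y \<in> carrier F"
    note \<psi>xy = mod_hom_closed[OF \<psi> xy(1)] mod_hom_closed[OF \<psi> xy(2)]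
    have "f (?\<psi> x) \<odot>\<^bsub>F\<^esub> y = \<phi> (f (?\<psi> x) \<odot>\<^bsub>E\<^esub> ?\<psi> y)"
      using mod_hom_smult[OF \<phi> exchange_closed[OF f \<psi>xy(1)] \<psi>xy(2)] xy by (simp add: \<phi>\<psi>)
    also have "\<dots> = \<phi> (f (?\<psi> y) \<odot>\<^bsub>E\<^esub> ?\<psi> x)"
      using exchange[OF f \<psi>xy] by simp
    also have "\<dots> = f (?\<psi> y) \<odot>\<^bsub>F\<^esub> x"
      using mod_hom_smult[OF \<phi> exchange_closed[OF f \<psi>xy(2)] \<psi>xy(1)] xy by (simp add: \<phi>\<psi>)
    finally show "f (?\<psi> x) \<odot>\<^bsub>F\<^esub> y = f (?\<psi> y) \<odot>\<^bsub>F\<^esub> x" .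
  qed (simp_all add: mod_hom_closed[OF \<psi>] mod_hom_add[OF \<psi>] mod_hom_smult[OF \<psi>]
      exchange_closed[OF f] exchange_add[OF f] exchange_smult[OF f])
  show ?thesis
  proof (rule invertibleI[OF assms(2)])
    fix I assume "ideal I R" and I: "\<And>f x. f \<in> exchange_functionals R F \<Longrightarrow> x \<in> carrier F \<Longrightarrow> f x \<in> I"
    interpret I: ideal I R by fact
    from assms(1) show "\<one>\<^bsub>R\<^esub> \<in> I"
    proof (induction rule: invertible_induct)
      case (functional f x)
      then show ?case
        using I[OF exch[OF functional(1)] mod_hom_closed[OF \<phi> functional(2)]] \<psi>\<phi> by simp
    qed (simp_all add: I.I_l_closed)
  qed
qed

lemma invertible_self:
  assumes "cring R"
  shows "invertible_module R (self_module R)"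
proof (rule invertibleI[OF module_self[OF assms]])
  interpret R: cring R by fact
  fix I assume I: "\<And>f x. f \<in> exchange_functionals R (self_module R) \<Longrightarrow>
    x \<in> carrier (self_module R) \<Longrightarrow> f x \<in> I"
  have "(\<lambda>x. x) \<in> exchange_functionals R (self_module R)"
    by (rule exchangeI) (simp_all add: R.m_comm)
  from I[OF this, of "\<one>\<^bsub>R\<^esub>"] show "\<one>\<^bsub>R\<^esub> \<in> I" by simp
qed

text \<open>
  The tensor product of exchange functionals is an exchange functional, and \<open>f x g y\<close> is one of its
  values.  Both generation statements are applied one after the other: first \<open>g\<close> and \<open>y\<close> vary with
  \<open>f x\<close> fixed, then \<open>f\<close> and \<open>x\<close>.
\<close>

lemma invertible_tensor:
  assumes "invertible_module R E" "invertible_module R F"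
  shows "invertible_module R (tensor R E F)"
proof -
  interpret E: module R E using assms(1) by (rule invertible_imp_module)
  interpret F: module R F using assms(2) by (rule invertible_imp_module)
  let ?T = "tensor R E F" and ?p = "pure_tensor R E F"
  note EF = E.module_axioms F.module_axioms
  interpret T: module R ?T by (rule module_tensor[OF EF])
  note pt = pure_tensor_facts[OF EF]
  have exch: "\<exists>h \<in> exchange_functionals R ?T. \<forall>x\<in>carrier E. \<forall>y\<in>carrier F. h (?p x y) = f x \<otimes>\<^bsub>R\<^esub> g y"
    if f: "f \<in> exchange_functionals R E" and g: "g \<in> exchange_functionals R F" for f g
  proof -
    note fs = exchange_facts[OF f] and gs = exchange_facts[OF g]
    obtain h where h: "h \<in> mod_hom R ?T (self_module R)"
        and hp: "\<And>x y. x \<in> carrier E \<Longrightarrow> y \<in> carrier F \<Longrightarrow> h (?p x y) = f x \<otimes>\<^bsub>R\<^esub> g y"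
      by (rule tensor_lift[OF EF module_self[OF E.R.is_cring], of "\<lambda>x y. f x \<otimes>\<^bsub>R\<^esub> g y"])
        (simp_all add: fs(1-3) gs(1-3) E.R.l_distr E.R.r_distr E.R.m_ac)
    have hc: "h t \<in> carrier R" if "t \<in> carrier ?T" for t
      using mod_hom_closed[OF h that] by simp
    have ha: "h (s \<oplus>\<^bsub>?T\<^esub> t) = h s \<oplus>\<^bsub>R\<^esub> h t" if "s \<in> carrier ?T" "t \<in> carrier ?T" for s t
      using mod_hom_add[OF h that] by simp
    have "h s \<odot>\<^bsub>?T\<^esub> t = h t \<odot>\<^bsub>?T\<^esub> s" if s: "s \<in> carrier ?T" and t: "t \<in> carrier ?T" for s t
      using EF s
    proof (induction rule: tensor_induct)
      case (pure x y)
      from EF t show ?case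
      proof (induction rule: tensor_induct)
        case (pure x' y')
        have "h (?p x y) \<odot>\<^bsub>?T\<^esub> ?p x' y' = ?p (f x \<odot>\<^bsub>E\<^esub> x') (g y \<odot>\<^bsub>F\<^esub> y')"
          using pure \<open>x \<in> carrier E\<close> \<open>y \<in> carrier F\<close> fs(1) gs(1)
          by (simp add: hp pt(1,4,5) T.smult_assoc1[symmetric] E.R.m_comm)
        also have "\<dots> = ?p (f x' \<odot>\<^bsub>E\<^esub> x) (g y' \<odot>\<^bsub>F\<^esub> y)"
          using fs(4)[of x x'] gs(4)[of y y'] pure \<open>x \<in> carrier E\<close> \<open>y \<in> carrier F\<close> by simp
        also have "\<dots> = h (?p x' y') \<odot>\<^bsub>?T\<^esub> ?p x y"
          using pure \<open>x \<in> carrier E\<close> \<open>y \<in> carrier F\<close> fs(1) gs(1)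
          by (simp add: hp pt(1,4,5) T.smult_assoc1[symmetric] E.R.m_comm)
        finally show ?case .
      next
        case (add s t)
        then show ?case
          using \<open>x \<in> carrier E\<close> \<open>y \<in> carrier F\<close>
          by (simp add: ha hc pt(1) T.smult_l_distr T.smult_r_distr)
      qed
    next
      case (add u v)
      then show ?case
        using t by (simp add: ha hc T.smult_l_distr T.smult_r_distr)
    qed
    moreover have "h (r \<odot>\<^bsub>?T\<^esub> t) = r \<otimes>\<^bsub>R\<^esub> h t" if "r \<in> carrier R" "t \<in> carrier ?T" for r t
      using mod_hom_smult[OF h that] by simp
    ultimately have "h \<in> exchange_functionals R ?T"
      using hc ha by (intro exchangeI)
    then show ?thesis using hp by blast
  qed
  show ?thesis
  proof (rule invertibleI[OF T.module_axioms])
    fix I assume "ideal I R" and I: "\<And>f x. f \<in> exchange_functionals R ?T \<Longrightarrow> x \<in> carrier ?T \<Longrightarrow> f x \<in> I"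
    interpret I: ideal I R by fact
    from assms(1) show "\<one>\<^bsub>R\<^esub> \<in> I"
    proof (induction rule: invertible_induct)
      case (functional f x)
      note fx = exchange_closed[OF functional]
      from assms(2) have "f x \<otimes>\<^bsub>R\<^esub> \<one>\<^bsub>R\<^esub> \<in> I"
      proof (induction rule: invertible_induct)
        case (functional g y)
        obtain h where "h \<in> exchange_functionals R ?T" "h (?p x y) = f x \<otimes>\<^bsub>R\<^esub> g y"
          using exch[OF \<open>f \<in> exchange_functionals R E\<close> functional(1)] functional(2) \<open>x \<in> carrier E\<close> by blast
        then show ?case
          using I[of h "?p x y"] functional(2) \<open>x \<in> carrier E\<close> pt(1) by simp
      next
        case (mult r s)
        then show ?case
          using fx by (subst E.R.m_lcomm) (simp_all add: I.I_l_closed)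
      qed (simp add: fx E.R.r_distr)
      then show ?case using fx by simp
    qed (simp_all add: I.I_l_closed)
  qed
qed


section \<open>Canonical isomorphisms of tensor products\<close>

lemma hom_onto_tensor:
  assumes "module R M" "module R E" "module R F" and \<Phi>: "\<Phi> \<in> mod_hom R M (tensor R E F)"
    and pure: "\<And>x y. x \<in> carrier E \<Longrightarrow> y \<in> carrier F \<Longrightarrow> pure_tensor R E F x y \<in> \<Phi> ` carrier M"
  shows "carrier (tensor R E F) \<subseteq> \<Phi> ` carrier M"
proof
  interpret M: module R M by fact
  fix t assume "t \<in> carrier (tensor R E F)"
  with assms(2,3) show "t \<in> \<Phi> ` carrier M"
  proof (induction rule: tensor_induct)
    case (add s t)
    then obtain a b where "a \<in> carrier M" "s = \<Phi> a" "b \<in> carrier M" "t = \<Phi> b"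
      by blast
    then show ?case
      by (intro image_eqI[of _ _ "a \<oplus>\<^bsub>M\<^esub> b"]) (simp_all add: mod_hom_add[OF \<Phi>])
  qed (rule pure)
qed

lemma tensor_self:
  assumes "invertible_module R E"
  shows "mod_iso R (tensor R (self_module R) E) E"
proof -
  interpret E: module R E using assms by (rule invertible_imp_module)
  note S = invertible_self[OF E.R.is_cring]
  note SM = invertible_imp_module[OF S]
  obtain \<Phi> where \<Phi>: "\<Phi> \<in> mod_hom R (tensor R (self_module R) E) E"
      "\<And>r x. r \<in> carrier (self_module R) \<Longrightarrow> x \<in> carrier E \<Longrightarrow> 
        \<Phi> (pure_tensor R (self_module R) E r x) = r \<odot>\<^bsub>E\<^esub> x"
  proof (rule tensor_lift[OF SM E.module_axioms E.module_axioms, of "\<lambda>r x. r \<odot>\<^bsub>E\<^esub> x"])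
    fix r s x assume "r \<in> carrier R" "s \<in> carrier (self_module R)" "x \<in> carrier E"
    then show "s \<odot>\<^bsub>E\<^esub> (r \<odot>\<^bsub>E\<^esub> x) = r \<odot>\<^bsub>E\<^esub> (s \<odot>\<^bsub>E\<^esub> x)"
      by (simp add: E.smult_assoc1[symmetric] E.R.m_comm)
  qed (simp_all add: E.smult_l_distr E.smult_r_distr E.smult_assoc1)
  show ?thesis
  proof (rule onto_imp_iso[OF invertible_tensor[OF S assms] assms \<Phi>(1)])
    show "carrier E \<subseteq> \<Phi> ` carrier (tensor R (self_module R) E)"
    proof
      fix x assume x: "x \<in> carrier E"
      then have "x = \<Phi> (pure_tensor R (self_module R) E \<one>\<^bsub>R\<^esub> x)"
        by (simp add: \<Phi>(2))
      then show "x \<in> \<Phi> ` carrier (tensor R (self_module R) E)"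
        using pure_tensor_closed[OF SM E.module_axioms, of "\<one>\<^bsub>R\<^esub>" x] x by auto
    qed
  qed
qed

lemma tensor_cong:
  assumes "invertible_module R E" "invertible_module R F" "module R E'" "module R F'"
    and "mod_iso R E E'" "mod_iso R F F'"
  shows "mod_iso R (tensor R E F) (tensor R E' F')"
proof -
  note E = invertible_imp_module[OF assms(1)] and F = invertible_imp_module[OF assms(2)]
  note E' = invertible_iso[OF assms(1,3,5)] and F' = invertible_iso[OF assms(2,4,6)]
  obtain f g where f: "f \<in> mod_hom R E E'" "bij_betw f (carrier E) (carrier E')"
      and g: "g \<in> mod_hom R F F'" "bij_betw g (carrier F) (carrier F')"
    using assms(5,6) unfolding mod_iso_def by blast
  note pt = pure_tensor_facts[OF assms(3,4)]
  obtain \<Phi> where \<Phi>: "\<Phi> \<in> mod_hom R (tensor R E F) (tensor R E' F')"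
      "\<And>x y. x \<in> carrier E \<Longrightarrow> y \<in> carrier F \<Longrightarrow>
        \<Phi> (pure_tensor R E F x y) = pure_tensor R E' F' (f x) (g y)"
    by (rule tensor_lift[OF E F module_tensor[OF assms(3,4)],
          of "\<lambda>x y. pure_tensor R E' F' (f x) (g y)"])
      (simp_all add: pt mod_hom_closed[OF f(1)] mod_hom_closed[OF g(1)] mod_hom_add[OF f(1)]
        mod_hom_add[OF g(1)] mod_hom_smult[OF f(1)] mod_hom_smult[OF g(1)])
  show ?thesis
  proof (rule onto_imp_iso[OF invertible_tensor[OF assms(1,2)] invertible_tensor[OF E' F'] \<Phi>(1)])
    show "carrier (tensor R E' F') \<subseteq> \<Phi> ` carrier (tensor R E F)"
    proof (rule hom_onto_tensor[OF module_tensor[OF E F] assms(3,4) \<Phi>(1)])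
      fix x' y' assume "x' \<in> carrier E'" "y' \<in> carrier F'"
      then obtain x y where "x \<in> carrier E" "x' = f x" "y \<in> carrier F" "y' = g y"
        using f(2) g(2) unfolding bij_betw_def by blast
      then show "pure_tensor R E' F' x' y' \<in> \<Phi> ` carrier (tensor R E F)"
        using \<Phi>(2)[of x y] pure_tensor_closed[OF E F, of x y] by auto
    qed
  qed
qed

text \<open>
  For fixed \<open>z\<close> the universal property gives a linear map \<open>\<Lambda> z\<close> with
  \<open>x \<otimes> y \<mapsto> x \<otimes> (y \<otimes> z)\<close>.  It depends linearly on \<open>z\<close>, since that can be checked on pure tensors,
  and so the universal property applies a second time.
\<close>

lemma tensor_assoc:
  assumes "invertible_module R E" "invertible_module R F" "invertible_module R H"
  shows "mod_iso R (tensor R (tensor R E F) H) (tensor R E (tensor R F H))"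
proof -
  note E = invertible_imp_module[OF assms(1)] and F = invertible_imp_module[OF assms(2)]
    and H = invertible_imp_module[OF assms(3)]
  let ?EF = "tensor R E F" and ?FH = "tensor R F H"
  let ?W = "tensor R E ?FH"
  note EF = module_tensor[OF E F] and FH = module_tensor[OF F H]
  note W = module_tensor[OF E FH]
  interpret W: module R ?W by fact
  interpret EF: module R ?EF by fact
  note pEF = pure_tensor_facts[OF E F] and pFH = pure_tensor_facts[OF F H]
    and pW = pure_tensor_facts[OF E FH]
  let ?b = "\<lambda>x y z. pure_tensor R E ?FH x (pure_tensor R F H y z)"
  have "\<exists>\<Lambda> \<in> mod_hom R ?EF ?W. \<forall>x\<in>carrier E. \<forall>y\<in>carrier F. \<Lambda> (pure_tensor R E F x y) = ?b x y z"
    if "z \<in> carrier H" for z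
    by (rule tensor_lift[OF E F W, of "\<lambda>x y. ?b x y z"]) (use that in \<open>simp_all add: pW pFH, blast\<close>)
  then obtain \<Lambda> where \<Lambda>: "\<And>z. z \<in> carrier H \<Longrightarrow> \<Lambda> z \<in> mod_hom R ?EF ?W"
      and \<Lambda>p: "\<And>x y z. z \<in> carrier H \<Longrightarrow> x \<in> carrier E \<Longrightarrow> y \<in> carrier F \<Longrightarrow>
        \<Lambda> z (pure_tensor R E F x y) = ?b x y z"
    by metis
  have add: "\<Lambda> (z \<oplus>\<^bsub>H\<^esub> z') t = \<Lambda> z t \<oplus>\<^bsub>?W\<^esub> \<Lambda> z' t"
    if t: "t \<in> carrier ?EF" and z: "z \<in> carrier H" "z' \<in> carrier H" for t z z'
    using E F t
  proof (induction rule: tensor_induct)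
    case (pure x y)
    then show ?case using z module.axioms(2)[OF H]
      by (simp add: \<Lambda>p pW pFH abelian_group.axioms(1) abelian_monoid.a_closed)
  next
    case (add s t)
    then show ?case using z module.axioms(2)[OF H]
      by (simp add: abelian_group.axioms(1) abelian_monoid.a_closed
          mod_hom_add[OF \<Lambda>] mod_hom_closed[OF \<Lambda>] W.a_ac)
  qed
  have smult: "\<Lambda> (r \<odot>\<^bsub>H\<^esub> z) t = r \<odot>\<^bsub>?W\<^esub> \<Lambda> z t"
    if t: "t \<in> carrier ?EF" and z: "z \<in> carrier H" "r \<in> carrier R" for t z r
    using E F t
  proof (induction rule: tensor_induct)
    case (pure x y)
    then show ?case using z by (simp add: \<Lambda>p pW pFH module.smult_closed[OF H])
  next
    case (add s t)
    then show ?case using z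
      by (simp add: module.smult_closed[OF H] mod_hom_add[OF \<Lambda>] mod_hom_closed[OF \<Lambda>] W.smult_r_distr)
  qed
  obtain \<Phi> where \<Phi>: "\<Phi> \<in> mod_hom R (tensor R ?EF H) ?W"
      "\<And>t z. t \<in> carrier ?EF \<Longrightarrow> z \<in> carrier H \<Longrightarrow> \<Phi> (pure_tensor R ?EF H t z) = \<Lambda> z t"
    by (rule tensor_lift[OF EF H W, of "\<lambda>t z. \<Lambda> z t"])
      (simp_all add: add smult mod_hom_add[OF \<Lambda>] mod_hom_closed[OF \<Lambda>] mod_hom_smult[OF \<Lambda>])
  interpret EFH: module R "tensor R ?EF H" by (rule module_tensor[OF EF H])
  show ?thesis
  proof (rule onto_imp_iso[OF invertible_tensor[OF invertible_tensor[OF assms(1,2)] assms(3)]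
        invertible_tensor[OF assms(1) invertible_tensor[OF assms(2,3)]] \<Phi>(1)])
    show "carrier ?W \<subseteq> \<Phi> ` carrier (tensor R ?EF H)"
    proof (rule hom_onto_tensor[OF EFH.module_axioms E FH \<Phi>(1)])
      fix x s assume x: "x \<in> carrier E" and "s \<in> carrier ?FH"
      from F H this(2) show "pure_tensor R E ?FH x s \<in> \<Phi> ` carrier (tensor R ?EF H)"
      proof (induction rule: tensor_induct)
        case (pure y z)
        then have "?b x y z = \<Phi> (pure_tensor R ?EF H (pure_tensor R E F x y) z)"
          using x by (simp add: \<Phi>(2) \<Lambda>p pEF)
        then show ?case
          using pure x pure_tensor_closed[OF EF H] pEF(1) by auto
      next
        case (add s t)
        then obtain a b where "a \<in> carrier (tensor R ?EF H)" "b \<in> carrier (tensor R ?EF H)"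
            "pure_tensor R E ?FH x s = \<Phi> a" "pure_tensor R E ?FH x t = \<Phi> b"
          by blast
        then show ?case
          using add(1,2) x pW(3)[of x s t] mod_hom_add[OF \<Phi>(1), of a b, symmetric] by simp
      qed
    qed
  qed
qed


section \<open>The inverse of an invertible module\<close>

text \<open>
  Functionals are extended by \<open>undefined\<close> outside the module, so that a functional is determined by
  its values on the module and the group laws hold as equations between functions.
\<close>

definition dual_module :: "'a ring \<Rightarrow> ('a, 'e) module \<Rightarrow> ('a, 'e \<Rightarrow> 'a) module" where
  "dual_module R E =
    \<lparr>carrier = exchange_functionals R E \<inter> extensional (carrier E), mult = undefined, one = undefined,
     zero = (\<lambda>x\<in>carrier E. \<zero>\<^bsub>R\<^esub>), add = (\<lambda>f g. \<lambda>x\<in>carrier E. f x \<oplus>\<^bsub>R\<^esub> g x),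
     smult = (\<lambda>r f. \<lambda>x\<in>carrier E. r \<otimes>\<^bsub>R\<^esub> f x)\<rparr>"

lemma dual_module_simps [simp]:
  "zero (dual_module R E) = (\<lambda>x\<in>carrier E. \<zero>\<^bsub>R\<^esub>)"
  "add (dual_module R E) = (\<lambda>f g. \<lambda>x\<in>carrier E. f x \<oplus>\<^bsub>R\<^esub> g x)"
  "smult (dual_module R E) = (\<lambda>r f. \<lambda>x\<in>carrier E. r \<otimes>\<^bsub>R\<^esub> f x)"
  by (simp_all add: dual_module_def)

lemma dual_carrier: "f \<in> carrier (dual_module R E) \<longleftrightarrow>
    f \<in> exchange_functionals R E \<and> f \<in> extensional (carrier E)"
  by (simp add: dual_module_def)

lemma dual_restrict:
  assumes "module R E" "f \<in> exchange_functionals R E"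
  shows "restrict f (carrier E) \<in> carrier (dual_module R E)"
  using exchange_cong[OF assms, of "restrict f (carrier E)"] by (simp add: dual_carrier)

lemma module_dual:
  assumes "module R E"
  shows "module R (dual_module R E)"
proof -
  interpret E: module R E by fact
  let ?D = "dual_module R E"
  have c: "f x \<in> carrier R" if "f \<in> carrier ?D" "x \<in> carrier E" for f x
    using that exchange_closed[of f R E x] by (simp add: dual_carrier)
  have eqI: "f = g" if "f \<in> carrier ?D" "g \<in> carrier ?D" "\<And>x. x \<in> carrier E \<Longrightarrow> f x = g x" for f g
    using that by (intro extensionalityI[of f "carrier E" g]) (auto simp: dual_carrier)
  have zero: "(\<lambda>x\<in>carrier E. \<zero>\<^bsub>R\<^esub>) \<in> carrier ?D"
    using dual_restrict[OF assms exchange_zero[OF assms]] .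
  have add: "(\<lambda>x\<in>carrier E. f x \<oplus>\<^bsub>R\<^esub> g x) \<in> carrier ?D" if "f \<in> carrier ?D" "g \<in> carrier ?D" for f g
    using dual_restrict[OF assms exchange_sum[OF assms]] that by (simp add: dual_carrier)
  have smult: "(\<lambda>x\<in>carrier E. r \<otimes>\<^bsub>R\<^esub> f x) \<in> carrier ?D" if "f \<in> carrier ?D" "r \<in> carrier R" for f r
    using dual_restrict[OF assms exchange_scale[OF assms]] that by (simp add: dual_carrier)
  show ?thesis
  proof (rule moduleI)
    show "abelian_group ?D"
    proof (rule abelian_groupI)
      fix f assume f: "f \<in> carrier ?D"
      have "(\<lambda>x\<in>carrier E. (\<lambda>x\<in>carrier E. \<ominus>\<^bsub>R\<^esub> \<one>\<^bsub>R\<^esub> \<otimes>\<^bsub>R\<^esub> f x) x \<oplus>\<^bsub>R\<^esub> f x) = (\<lambda>x\<in>carrier E. \<zero>\<^bsub>R\<^esub>)"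
        by (rule restrict_ext) (simp add: c[OF f] E.R.l_minus E.R.l_neg)
      then show "\<exists>g\<in>carrier ?D. g \<oplus>\<^bsub>?D\<^esub> f = \<zero>\<^bsub>?D\<^esub>"
        using smult[OF f, of "\<ominus>\<^bsub>R\<^esub> \<one>\<^bsub>R\<^esub>"] by (intro bexI) auto
    next
      fix f assume f: "f \<in> carrier ?D"
      show "\<zero>\<^bsub>?D\<^esub> \<oplus>\<^bsub>?D\<^esub> f = f"
        by (rule eqI) (use f add[OF zero f] c[OF f] in simp_all)
    next
      fix f g h assume "f \<in> carrier ?D" "g \<in> carrier ?D" "h \<in> carrier ?D"
      then show "f \<oplus>\<^bsub>?D\<^esub> g \<oplus>\<^bsub>?D\<^esub> h = f \<oplus>\<^bsub>?D\<^esub> (g \<oplus>\<^bsub>?D\<^esub> h)"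
        by (simp, intro restrict_ext) (simp add: c E.R.a_assoc)
    next
      fix f g assume "f \<in> carrier ?D" "g \<in> carrier ?D"
      then show "f \<oplus>\<^bsub>?D\<^esub> g = g \<oplus>\<^bsub>?D\<^esub> f"
        by (simp, intro restrict_ext) (simp add: c E.R.a_comm)
    qed (simp_all add: zero add)
  next
    fix a b f assume "a \<in> carrier R" "b \<in> carrier R" "f \<in> carrier ?D"
    then show "(a \<oplus>\<^bsub>R\<^esub> b) \<odot>\<^bsub>?D\<^esub> f = a \<odot>\<^bsub>?D\<^esub> f \<oplus>\<^bsub>?D\<^esub> b \<odot>\<^bsub>?D\<^esub> f"
      by (simp, intro restrict_ext) (simp add: c E.R.l_distr)
  next
    fix a f g assume "a \<in> carrier R" "f \<in> carrier ?D" "g \<in> carrier ?D"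
    then show "a \<odot>\<^bsub>?D\<^esub> (f \<oplus>\<^bsub>?D\<^esub> g) = a \<odot>\<^bsub>?D\<^esub> f \<oplus>\<^bsub>?D\<^esub> a \<odot>\<^bsub>?D\<^esub> g"
      by (simp, intro restrict_ext) (simp add: c E.R.r_distr)
  next
    fix a b f assume "a \<in> carrier R" "b \<in> carrier R" "f \<in> carrier ?D"
    then show "(a \<otimes>\<^bsub>R\<^esub> b) \<odot>\<^bsub>?D\<^esub> f = a \<odot>\<^bsub>?D\<^esub> (b \<odot>\<^bsub>?D\<^esub> f)"
      by (simp, intro restrict_ext) (simp add: c E.R.m_assoc)
  next
    fix f assume f: "f \<in> carrier ?D"
    show "\<one>\<^bsub>R\<^esub> \<odot>\<^bsub>?D\<^esub> f = f"
      by (rule eqI) (use f smult[OF f, of "\<one>\<^bsub>R\<^esub>"] c[OF f] in simp_all)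
  qed (simp_all add: smult E.R.is_cring)
qed

text \<open>
  Evaluation at \<open>x\<close> is an exchange functional on the dual module:
  \<open>f(x) g(y) = g(f(x) y) = g(f(y) x) = f(y) g(x)\<close>.
\<close>

lemma invertible_dual:
  assumes "invertible_module R E"
  shows "invertible_module R (dual_module R E)"
proof -
  interpret E: module R E using assms(1) by (rule invertible_imp_module)
  let ?D = "dual_module R E"
  have ev: "(\<lambda>f. f x) \<in> exchange_functionals R ?D" if x: "x \<in> carrier E" for x
  proof (rule exchangeI)
    fix f g assume f: "f \<in> carrier ?D" and g: "g \<in> carrier ?D"
    have fe: "f \<in> exchange_functionals R E" and ge: "g \<in> exchange_functionals R E"
      using f g by (simp_all add: dual_carrier)
    have "f x \<otimes>\<^bsub>R\<^esub> g y = g x \<otimes>\<^bsub>R\<^esub> f y" if y: "y \<in> carrier E" for y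
    proof -
      have "f x \<otimes>\<^bsub>R\<^esub> g y = g (f x \<odot>\<^bsub>E\<^esub> y)"
        using x y by (simp add: exchange_smult[OF ge] exchange_closed[OF fe])
      also have "\<dots> = g (f y \<odot>\<^bsub>E\<^esub> x)"
        using exchange[OF fe x y] by simp
      also have "\<dots> = f y \<otimes>\<^bsub>R\<^esub> g x"
        using x y by (simp add: exchange_smult[OF ge] exchange_closed[OF fe])
      finally show ?thesis
        using x y by (simp add: E.R.m_comm exchange_closed[OF fe] exchange_closed[OF ge])
    qed
    then show "f x \<odot>\<^bsub>?D\<^esub> g = g x \<odot>\<^bsub>?D\<^esub> f"
      by (simp, intro restrict_ext)
  next
    fix f assume "f \<in> carrier ?D"
    then show "f x \<in> carrier R"
      using x exchange_closed[of f R E x] by (simp add: dual_carrier)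
  qed (use x in simp_all)
  show ?thesis
  proof (rule invertibleI[OF module_dual[OF E.module_axioms]])
    fix I assume "ideal I R" and I: "\<And>f x. f \<in> exchange_functionals R ?D \<Longrightarrow> x \<in> carrier ?D \<Longrightarrow> f x \<in> I"
    interpret I: ideal I R by fact
    from assms(1) show "\<one>\<^bsub>R\<^esub> \<in> I"
    proof (induction rule: invertible_induct)
      case (functional f x)
      then show ?case
        using I[OF ev[OF functional(2)] dual_restrict[OF E.module_axioms functional(1)]] by simp
    qed (simp_all add: I.I_l_closed)
  qed
qed

lemma tensor_dual:
  assumes "invertible_module R E"
  shows "mod_iso R (tensor R (dual_module R E) E) (self_module R)"
proof -
  interpret E: module R E using assms by (rule invertible_imp_module)
  let ?D = "dual_module R E"
  note D = module_dual[OF E.module_axioms]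
  note SM = module_self[OF E.R.is_cring]
  obtain \<Phi> where \<Phi>: "\<Phi> \<in> mod_hom R (tensor R ?D E) (self_module R)"
      "\<And>f x. f \<in> carrier ?D \<Longrightarrow> x \<in> carrier E \<Longrightarrow> \<Phi> (pure_tensor R ?D E f x) = f x"
  proof (rule tensor_lift[OF D E.module_axioms SM, of "\<lambda>f x. f x"])
    fix f x y r assume "f \<in> carrier ?D" and x: "x \<in> carrier E"
    then have f: "f \<in> exchange_functionals R E" by (simp add: dual_carrier)
    show "f x \<in> carrier (self_module R)"
      using x exchange_closed[OF f] by simp
    show "f (x \<oplus>\<^bsub>E\<^esub> y) = f x \<oplus>\<^bsub>self_module R\<^esub> f y" if "y \<in> carrier E"
      using x that exchange_add[OF f] by simp
    show "f (r \<odot>\<^bsub>E\<^esub> x) = r \<odot>\<^bsub>self_module R\<^esub> f x" if "r \<in> carrier R"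
      using x that exchange_smult[OF f] by simp
  qed simp_all
  interpret T: module R "tensor R ?D E" by (rule module_tensor[OF D E.module_axioms])
  have one: "\<one>\<^bsub>R\<^esub> \<in> \<Phi> ` carrier (tensor R ?D E)"
    using assms
  proof (induction rule: invertible_induct)
    case (functional f x)
    note f' = dual_restrict[OF E.module_axioms functional(1)]
    have "f x = \<Phi> (pure_tensor R ?D E (restrict f (carrier E)) x)"
      using \<Phi>(2)[OF f' functional(2)] functional(2) by simp
    then show ?case
      using pure_tensor_closed[OF D E.module_axioms f' functional(2)] by blast
  next
    case (add r s)
    then obtain a b where ab: "a \<in> carrier (tensor R ?D E)" "b \<in> carrier (tensor R ?D E)" "r = \<Phi> a" "s = \<Phi> b"
      by blast
    then show ?case
      using mod_hom_add[OF \<Phi>(1), of a b] by (intro image_eqI[of _ _ "a \<oplus>\<^bsub>tensor R ?D E\<^esub> b"]) simp_all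
  next
    case (mult r s)
    then obtain a where ab: "a \<in> carrier (tensor R ?D E)" "s = \<Phi> a"
      by blast
    then show ?case
      using mod_hom_smult[OF \<Phi>(1), of r a] mult(1)
      by (intro image_eqI[of _ _ "r \<odot>\<^bsub>tensor R ?D E\<^esub> a"]) simp_all
  qed
  show ?thesis
  proof (rule onto_imp_iso[OF invertible_tensor[OF invertible_dual[OF assms] assms]
        invertible_self[OF E.R.is_cring] \<Phi>(1)], rule)
    fix r assume "r \<in> carrier (self_module R)"
    moreover obtain a where "a \<in> carrier (tensor R ?D E)" "\<Phi> a = \<one>\<^bsub>R\<^esub>"
      using one by (metis imageE)
    ultimately show "r \<in> \<Phi> ` carrier (tensor R ?D E)"
      using mod_hom_smult[OF \<Phi>(1), of r a]
      by (intro image_eqI[of _ _ "r \<odot>\<^bsub>tensor R ?D E\<^esub> a"]) simp_all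
  qed
qed


section \<open>Localization\<close>

text \<open>
  An ideal that is maximal among those avoiding the unit is a maximal ideal, hence prime.
\<close>

lemma ex_prime_ideal:
  assumes "cring R" "ideal I R" "\<one>\<^bsub>R\<^esub> \<notin> I"
  obtains P where "primeideal P R" "I \<subseteq> P"
proof -
  interpret R: cring R by fact
  let ?\<A> = "{J. ideal J R \<and> I \<subseteq> J \<and> \<one>\<^bsub>R\<^esub> \<notin> J}"
  have "\<exists>M\<in>?\<A>. \<forall>X\<in>?\<A>. M \<subseteq> X \<longrightarrow> X = M"
  proof (rule subset_Zorn_nonempty)
    show "?\<A> \<noteq> {}" using assms(2,3) by blast
  next
    fix \<C> assume \<C>: "\<C> \<noteq> {}" "subset.chain ?\<A> \<C>"
    then have ideals: "\<And>J. J \<in> \<C> \<Longrightarrow> ideal J R"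
        and chain: "\<And>J K. J \<in> \<C> \<Longrightarrow> K \<in> \<C> \<Longrightarrow> J \<subseteq> K \<or> K \<subseteq> J"
      unfolding subset.chain_def by blast+
    have "J \<subseteq> carrier R" if "J \<in> \<C>" for J
      using additive_subgroup.a_subset[OF ideal.axioms(1)[OF ideals[OF that]]] .
    then have *: "{r \<in> carrier R. r \<in> \<Union>\<C>} = \<Union>\<C>"
      by blast
    have "ideal {r \<in> carrier R. r \<in> \<Union>\<C>} R"
    proof (rule ideal_Collect[of R "\<lambda>r. r \<in> \<Union>\<C>", OF assms(1)])
      obtain J where "J \<in> \<C>" using \<C>(1) by blast
      with additive_subgroup.zero_closed[OF ideal.axioms(1)[OF ideals[OF this]]]
      show "\<zero>\<^bsub>R\<^esub> \<in> \<Union>\<C>" by blast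
    next
      fix r s assume "r \<in> \<Union>\<C>" "s \<in> \<Union>\<C>"
      then obtain J K where JK: "J \<in> \<C>" "r \<in> J" "K \<in> \<C>" "s \<in> K"
        by blast
      then obtain L where L: "L \<in> \<C>" "r \<in> L" "s \<in> L"
        using chain[OF JK(1,3)] by blast
      from additive_subgroup.a_closed[OF ideal.axioms(1)[OF ideals[OF L(1)]] L(2,3)] L(1)
      show "r \<oplus>\<^bsub>R\<^esub> s \<in> \<Union>\<C>" by blast
    next
      fix r s assume r: "r \<in> carrier R" and "s \<in> \<Union>\<C>"
      then obtain J where J: "J \<in> \<C>" "s \<in> J" by blast
      from ideal.I_l_closed[OF ideals[OF J(1)] J(2) r] J(1) show "r \<otimes>\<^bsub>R\<^esub> s \<in> \<Union>\<C>" by blast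
    qed
    then have "ideal (\<Union>\<C>) R" unfolding * .
    with \<C> show "\<Union>\<C> \<in> ?\<A>"
      unfolding subset.chain_def by blast
  qed
  then obtain M where "M \<in> ?\<A>" and "\<forall>X\<in>?\<A>. M \<subseteq> X \<longrightarrow> X = M"
    by (rule bexE)
  then have M: "ideal M R" "I \<subseteq> M" "\<one>\<^bsub>R\<^esub> \<notin> M"
      and max: "\<And>X. ideal X R \<Longrightarrow> I \<subseteq> X \<Longrightarrow> \<one>\<^bsub>R\<^esub> \<notin> X \<Longrightarrow> M \<subseteq> X \<Longrightarrow> X = M"
    by simp_all
  have "maximalideal M R"
  proof (rule maximalidealI[OF M(1)])
    show "carrier R \<noteq> M" using M(3) by auto
    fix J assume J: "ideal J R" "M \<subseteq> J" "J \<subseteq> carrier R"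
    show "J = M \<or> J = carrier R"
    proof (cases "\<one>\<^bsub>R\<^esub> \<in> J")
      case True
      then show ?thesis using ideal.one_imp_carrier[OF J(1)] by simp
    next
      case False
      then show ?thesis using max[OF J(1) subset_trans[OF M(2) J(2)] False J(2)] by simp
    qed
  qed
  from that[OF R.maximalideal_prime[OF this] M(2)] show thesis .
qed

locale multiplicative_subset = R?: cring R for R :: "'a ring" (structure) and U +
  assumes U_subset: "U \<subseteq> carrier R" and U_one: "\<one> \<in> U"
    and U_mult: "s \<in> U \<Longrightarrow> t \<in> U \<Longrightarrow> s \<otimes> t \<in> U"
begin

lemma U_closed: "s \<in> U \<Longrightarrow> s \<in> carrier R"
  using U_subset by blast

lemma frac_rel_iff:
  assumes "m \<in> carrier E" "s \<in> U" "n \<in> carrier E" "t \<in> U"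
  shows "((m, s), (n, t)) \<in> frac_rel R U E \<longleftrightarrow>
    (\<exists>u\<in>U. u \<odot>\<^bsub>E\<^esub> (t \<odot>\<^bsub>E\<^esub> m) = u \<odot>\<^bsub>E\<^esub> (s \<odot>\<^bsub>E\<^esub> n))"
  using assms unfolding frac_rel_def by blast

lemma equiv_frac_rel:
  assumes "module R E"
  shows "equiv (carrier E \<times> U) (frac_rel R U E)"
proof -
  interpret E: module R E by fact
  show ?thesis
  proof (rule equivI)
    show "frac_rel R U E \<subseteq> (carrier E \<times> U) \<times> (carrier E \<times> U)"
      by (auto simp: frac_rel_def)
    show "refl_on (carrier E \<times> U) (frac_rel R U E)"
      unfolding refl_on_def frac_rel_def using U_one by blast
    show "sym (frac_rel R U E)"
    proof (rule symI)
      fix X Y assume *: "(X, Y) \<in> frac_rel R U E"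
      then obtain m s n t where X: "X = (m, s)" "m \<in> carrier E" "s \<in> U"
          and Y: "Y = (n, t)" "n \<in> carrier E" "t \<in> U"
        unfolding frac_rel_def by blast
      show "(Y, X) \<in> frac_rel R U E"
        using * unfolding X(1) Y(1) frac_rel_iff[OF X(2,3) Y(2,3)] frac_rel_iff[OF Y(2,3) X(2,3)]
        by metis
    qed
    show "trans (frac_rel R U E)"
    proof (rule transI)
      fix X Y Z assume "(X, Y) \<in> frac_rel R U E" "(Y, Z) \<in> frac_rel R U E"
      then obtain m s n t p w u v where X: "X = (m, s)" and Z: "Z = (p, w)"
          and c: "m \<in> carrier E" "n \<in> carrier E" "p \<in> carrier E" "s \<in> U" "t \<in> U" "w \<in> U" "u \<in> U" "v \<in> U"
          and u: "u \<odot>\<^bsub>E\<^esub> (t \<odot>\<^bsub>E\<^esub> m) = u \<odot>\<^bsub>E\<^esub> (s \<odot>\<^bsub>E\<^esub> n)"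
          and v: "v \<odot>\<^bsub>E\<^esub> (w \<odot>\<^bsub>E\<^esub> n) = v \<odot>\<^bsub>E\<^esub> (t \<odot>\<^bsub>E\<^esub> p)"
        unfolding frac_rel_def by blast
      have cR: "s \<in> carrier R" "t \<in> carrier R" "w \<in> carrier R" "u \<in> carrier R" "v \<in> carrier R"
        using c U_closed by blast+
      have "(u \<otimes> v \<otimes> t) \<odot>\<^bsub>E\<^esub> (w \<odot>\<^bsub>E\<^esub> m) = (v \<otimes> w) \<odot>\<^bsub>E\<^esub> (u \<odot>\<^bsub>E\<^esub> (t \<odot>\<^bsub>E\<^esub> m))"
        using c(1-3) cR by (simp add: E.smult_assoc1[symmetric] m_ac)
      also have "\<dots> = (u \<otimes> s) \<odot>\<^bsub>E\<^esub> (v \<odot>\<^bsub>E\<^esub> (w \<odot>\<^bsub>E\<^esub> n))"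
        unfolding u using c(1-3) cR by (simp add: E.smult_assoc1[symmetric] m_ac)
      also have "\<dots> = (u \<otimes> v \<otimes> t) \<odot>\<^bsub>E\<^esub> (s \<odot>\<^bsub>E\<^esub> p)"
        unfolding v using c(1-3) cR by (simp add: E.smult_assoc1[symmetric] m_ac)
      finally show "(X, Z) \<in> frac_rel R U E"
        unfolding X Z frac_rel_iff[OF c(1,4) c(3,6)]
        using U_mult[OF U_mult[OF c(7,8)] c(5)] by blast
    qed
  qed
qed

lemma fraction_eq_iff:
  assumes "module R E" "m \<in> carrier E" "s \<in> U" "n \<in> carrier E" "t \<in> U"
  shows "fraction R U E m s = fraction R U E n t \<longleftrightarrow>
    (\<exists>u\<in>U. u \<odot>\<^bsub>E\<^esub> (t \<odot>\<^bsub>E\<^esub> m) = u \<odot>\<^bsub>E\<^esub> (s \<odot>\<^bsub>E\<^esub> n))"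
  unfolding fraction_def frac_rel_iff[OF assms(2-5), symmetric]
  using assms by (intro eq_equiv_class_iff[OF equiv_frac_rel]) auto

lemma mem_fractionD:
  assumes "p \<in> fraction R U E m s"
  obtains n t u where "p = (n, t)" "n \<in> carrier E" "t \<in> U" "u \<in> U"
    "u \<odot>\<^bsub>E\<^esub> (t \<odot>\<^bsub>E\<^esub> m) = u \<odot>\<^bsub>E\<^esub> (s \<odot>\<^bsub>E\<^esub> n)"
  using assms unfolding fraction_def frac_rel_def by blast

lemma fraction_self:
  assumes "m \<in> carrier E" "s \<in> U"
  shows "(m, s) \<in> fraction R U E m s"
  using assms U_one unfolding fraction_def frac_rel_def by blast

lemma loc_carrier:
  "carrier (loc_module R U E) = {fraction R U E m s | m s. m \<in> carrier E \<and> s \<in> U}"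
  unfolding loc_module_def Let_def quotient_def fraction_def by auto

text \<open>
  The localized ring has the same fractions and operations as the localization of \<open>R\<close> as a module
  over itself, so that facts about fractions are needed for modules only.
\<close>

lemma loc_ring_simps:
  "carrier (loc_ring R U) = carrier (loc_module R U (self_module R))"
  "mult (loc_ring R U) = smult (loc_module R U (self_module R))"
  "add (loc_ring R U) = add (loc_module R U (self_module R))"
  "one (loc_ring R U) = fraction R U (self_module R) \<one> \<one>"
  by (simp_all add: loc_ring_def loc_module_def Let_def)

lemma UN_const2:
  assumes "p0 \<in> X" "q0 \<in> Y" "\<And>p q. p \<in> X \<Longrightarrow> q \<in> Y \<Longrightarrow> f p q = c"
  shows "(\<Union>p\<in>X. \<Union>q\<in>Y. f p q) = c"
  using assms by auto

lemma loc_add: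
  assumes "module R E" "m \<in> carrier E" "s \<in> U" "n \<in> carrier E" "t \<in> U"
  shows "fraction R U E m s \<oplus>\<^bsub>loc_module R U E\<^esub> fraction R U E n t =
    fraction R U E (t \<odot>\<^bsub>E\<^esub> m \<oplus>\<^bsub>E\<^esub> s \<odot>\<^bsub>E\<^esub> n) (s \<otimes> t)"
proof -
  interpret E: module R E by fact
  show ?thesis
    unfolding loc_module_def Let_def module.simps ring.simps case_prod_beta
  proof (rule UN_const2[OF fraction_self[OF assms(2,3)] fraction_self[OF assms(4,5)]])
    fix p q assume "p \<in> fraction R U E m s" "q \<in> fraction R U E n t"
    then obtain m' s' n' t' u v where p: "p = (m', s')" and q: "q = (n', t')"
        and c: "m' \<in> carrier E" "n' \<in> carrier E" "s' \<in> U" "t' \<in> U" "u \<in> U" "v \<in> U"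
        and u: "u \<odot>\<^bsub>E\<^esub> (s' \<odot>\<^bsub>E\<^esub> m) = u \<odot>\<^bsub>E\<^esub> (s \<odot>\<^bsub>E\<^esub> m')"
        and v: "v \<odot>\<^bsub>E\<^esub> (t' \<odot>\<^bsub>E\<^esub> n) = v \<odot>\<^bsub>E\<^esub> (t \<odot>\<^bsub>E\<^esub> n')"
      by (elim mem_fractionD) blast
    note cR = U_closed[OF assms(3)] U_closed[OF assms(5)] U_closed[OF c(3)] U_closed[OF c(4)]
      U_closed[OF c(5)] U_closed[OF c(6)]
    have 1: "(u \<otimes> v) \<odot>\<^bsub>E\<^esub> ((s \<otimes> t) \<odot>\<^bsub>E\<^esub> (t' \<odot>\<^bsub>E\<^esub> m')) = (u \<otimes> v) \<odot>\<^bsub>E\<^esub> ((s' \<otimes> t') \<odot>\<^bsub>E\<^esub> (t \<odot>\<^bsub>E\<^esub> m))"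
    proof -
      have "(u \<otimes> v) \<odot>\<^bsub>E\<^esub> ((s \<otimes> t) \<odot>\<^bsub>E\<^esub> (t' \<odot>\<^bsub>E\<^esub> m')) = (v \<otimes> t \<otimes> t') \<odot>\<^bsub>E\<^esub> (u \<odot>\<^bsub>E\<^esub> (s \<odot>\<^bsub>E\<^esub> m'))"
        using c cR by (simp add: E.smult_assoc1[symmetric] m_ac)
      then show ?thesis
        unfolding u[symmetric] using assms c cR by (simp add: E.smult_assoc1[symmetric] m_ac)
    qed
    have 2: "(u \<otimes> v) \<odot>\<^bsub>E\<^esub> ((s \<otimes> t) \<odot>\<^bsub>E\<^esub> (s' \<odot>\<^bsub>E\<^esub> n')) = (u \<otimes> v) \<odot>\<^bsub>E\<^esub> ((s' \<otimes> t') \<odot>\<^bsub>E\<^esub> (s \<odot>\<^bsub>E\<^esub> n))"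
    proof -
      have "(u \<otimes> v) \<odot>\<^bsub>E\<^esub> ((s \<otimes> t) \<odot>\<^bsub>E\<^esub> (s' \<odot>\<^bsub>E\<^esub> n')) = (u \<otimes> s \<otimes> s') \<odot>\<^bsub>E\<^esub> (v \<odot>\<^bsub>E\<^esub> (t \<odot>\<^bsub>E\<^esub> n'))"
        using c cR by (simp add: E.smult_assoc1[symmetric] m_ac)
      then show ?thesis
        unfolding v[symmetric] using assms c cR by (simp add: E.smult_assoc1[symmetric] m_ac)
    qed
    have "fraction R U E (t' \<odot>\<^bsub>E\<^esub> m' \<oplus>\<^bsub>E\<^esub> s' \<odot>\<^bsub>E\<^esub> n') (s' \<otimes> t') =
        fraction R U E (t \<odot>\<^bsub>E\<^esub> m \<oplus>\<^bsub>E\<^esub> s \<odot>\<^bsub>E\<^esub> n) (s \<otimes> t)"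
    proof (subst fraction_eq_iff[OF assms(1)])
      have "(u \<otimes> v) \<odot>\<^bsub>E\<^esub> ((s \<otimes> t) \<odot>\<^bsub>E\<^esub> (t' \<odot>\<^bsub>E\<^esub> m' \<oplus>\<^bsub>E\<^esub> s' \<odot>\<^bsub>E\<^esub> n')) =
          (u \<otimes> v) \<odot>\<^bsub>E\<^esub> ((s' \<otimes> t') \<odot>\<^bsub>E\<^esub> (t \<odot>\<^bsub>E\<^esub> m \<oplus>\<^bsub>E\<^esub> s \<odot>\<^bsub>E\<^esub> n))"
        using assms(2,4) c(1,2) cR 1 2 by (simp add: E.smult_r_distr)
      then show "\<exists>w\<in>U. w \<odot>\<^bsub>E\<^esub> ((s \<otimes> t) \<odot>\<^bsub>E\<^esub> (t' \<odot>\<^bsub>E\<^esub> m' \<oplus>\<^bsub>E\<^esub> s' \<odot>\<^bsub>E\<^esub> n')) =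
          w \<odot>\<^bsub>E\<^esub> ((s' \<otimes> t') \<odot>\<^bsub>E\<^esub> (t \<odot>\<^bsub>E\<^esub> m \<oplus>\<^bsub>E\<^esub> s \<odot>\<^bsub>E\<^esub> n))"
        using U_mult[OF c(5,6)] by blast
    qed (use assms c cR in \<open>simp_all add: U_mult\<close>)
    then show "fraction R U E (snd q \<odot>\<^bsub>E\<^esub> fst p \<oplus>\<^bsub>E\<^esub> snd p \<odot>\<^bsub>E\<^esub> fst q) (snd p \<otimes> snd q) =
        fraction R U E (t \<odot>\<^bsub>E\<^esub> m \<oplus>\<^bsub>E\<^esub> s \<odot>\<^bsub>E\<^esub> n) (s \<otimes> t)"
      by (simp add: p q)
  qed
qed

lemma loc_smult:
  assumes "module R E" "a \<in> carrier R" "s \<in> U" "n \<in> carrier E" "t \<in> U"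
  shows "fraction R U (self_module R) a s \<odot>\<^bsub>loc_module R U E\<^esub> fraction R U E n t =
    fraction R U E (a \<odot>\<^bsub>E\<^esub> n) (s \<otimes> t)"
proof -
  interpret E: module R E by fact
  have a: "a \<in> carrier (self_module R)" using assms(2) by simp
  show ?thesis
    unfolding loc_module_def Let_def module.simps ring.simps case_prod_beta
  proof (rule UN_const2[OF fraction_self[OF a assms(3)] fraction_self[OF assms(4,5)]])
    fix p q assume "p \<in> fraction R U (self_module R) a s" "q \<in> fraction R U E n t"
    then obtain b s' n' t' u v where p: "p = (b, s')" and q: "q = (n', t')"
        and c: "b \<in> carrier R" "n' \<in> carrier E" "s' \<in> U" "t' \<in> U" "u \<in> U" "v \<in> U"
        and u: "u \<otimes> (s' \<otimes> a) = u \<otimes> (s \<otimes> b)"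
        and v: "v \<odot>\<^bsub>E\<^esub> (t' \<odot>\<^bsub>E\<^esub> n) = v \<odot>\<^bsub>E\<^esub> (t \<odot>\<^bsub>E\<^esub> n')"
      by (elim mem_fractionD) auto
    note cR = U_closed[OF assms(3)] U_closed[OF assms(5)] U_closed[OF c(3)] U_closed[OF c(4)]
      U_closed[OF c(5)] U_closed[OF c(6)]
    have "(u \<otimes> v) \<odot>\<^bsub>E\<^esub> ((s \<otimes> t) \<odot>\<^bsub>E\<^esub> (b \<odot>\<^bsub>E\<^esub> n')) = (u \<otimes> (s \<otimes> b)) \<odot>\<^bsub>E\<^esub> (v \<odot>\<^bsub>E\<^esub> (t \<odot>\<^bsub>E\<^esub> n'))"
      using assms c cR by (simp add: E.smult_assoc1[symmetric] m_ac)
    also have "\<dots> = (u \<otimes> v) \<odot>\<^bsub>E\<^esub> ((s' \<otimes> t') \<odot>\<^bsub>E\<^esub> (a \<odot>\<^bsub>E\<^esub> n))"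
      unfolding u[symmetric] v[symmetric]
      using assms c cR by (simp add: E.smult_assoc1[symmetric] m_ac)
    finally have "fraction R U E (b \<odot>\<^bsub>E\<^esub> n') (s' \<otimes> t') = fraction R U E (a \<odot>\<^bsub>E\<^esub> n) (s \<otimes> t)"
      using assms c cR U_mult[OF c(5,6)] by (subst fraction_eq_iff[OF assms(1)]) (auto simp: U_mult)
    then show "fraction R U E (fst p \<odot>\<^bsub>E\<^esub> fst q) (snd p \<otimes> snd q) =
        fraction R U E (a \<odot>\<^bsub>E\<^esub> n) (s \<otimes> t)"
      by (simp add: p q)
  qed
qed

text \<open>
  After inverting \<open>s = f e\<close>, the relation \<open>s x = f x e\<close> shows that \<open>e\<close> is a basis with coordinate
  \<open>f / s\<close>.  Dropping the unit \<open>s\<close>, the map \<open>x / t \<mapsto> f x / t\<close> is an isomorphism onto the localized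
  ring.
\<close>

lemma loc_iso_of_exchange:
  assumes "module R E" and f: "f \<in> exchange_functionals R E" and e: "e \<in> carrier E" "f e \<in> U"
  shows "mod_iso (loc_ring R U) (loc_module R U E) (self_module (loc_ring R U))"
proof -
  interpret E: module R E by fact
  let ?S = "self_module R"
  note S = module_self[OF R.is_cring]
  note fc = exchange_closed[OF f]
  define \<phi> where "\<phi> X = (\<Union>(m, t)\<in>X. fraction R U ?S (f m) t)" for X
  have \<phi>: "\<phi> (fraction R U E m t) = fraction R U ?S (f m) t" if m: "m \<in> carrier E" "t \<in> U" for m t
  proof -
    have "(case p of (m, t) \<Rightarrow> fraction R U ?S (f m) t) = fraction R U ?S (f m) t"
      if "p \<in> fraction R U E m t" for p
    proof -
      obtain n s u where p: "p = (n, s)" "n \<in> carrier E" "s \<in> U" "u \<in> U"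
          and u: "u \<odot>\<^bsub>E\<^esub> (s \<odot>\<^bsub>E\<^esub> m) = u \<odot>\<^bsub>E\<^esub> (t \<odot>\<^bsub>E\<^esub> n)"
        using \<open>p \<in> fraction R U E m t\<close> by (rule mem_fractionD)
      have "u \<otimes> (t \<otimes> f n) = f (u \<odot>\<^bsub>E\<^esub> (t \<odot>\<^bsub>E\<^esub> n))"
        using p m U_closed by (simp add: exchange_smult[OF f])
      also have "\<dots> = u \<otimes> (s \<otimes> f m)"
        unfolding u[symmetric] using p m U_closed by (simp add: exchange_smult[OF f])
      finally have "fraction R U ?S (f n) s = fraction R U ?S (f m) t"
        using p m fc by (subst fraction_eq_iff[OF S]) auto
      then show ?thesis by (simp add: p(1))
    qed
    then show ?thesis
      unfolding \<phi>_def using fraction_self[OF m] by blast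
  qed
  have hom: "\<phi> \<in> mod_hom (loc_ring R U) (loc_module R U E) (self_module (loc_ring R U))"
  proof (rule mod_homI)
    fix X assume "X \<in> carrier (loc_module R U E)"
    then obtain m s where X: "X = fraction R U E m s" "m \<in> carrier E" "s \<in> U"
      by (auto simp: loc_carrier)
    show "\<phi> X \<in> carrier (self_module (loc_ring R U))"
      using X fc by (auto simp: \<phi> loc_ring_simps loc_carrier)
    { fix Y assume "Y \<in> carrier (loc_module R U E)"
      then obtain n t where Y: "Y = fraction R U E n t" "n \<in> carrier E" "t \<in> U"
        by (auto simp: loc_carrier)
      show "\<phi> (X \<oplus>\<^bsub>loc_module R U E\<^esub> Y) = \<phi> X \<oplus>\<^bsub>self_module (loc_ring R U)\<^esub> \<phi> Y"
        using X Y by (simp add: loc_ring_simps \<phi> loc_add[OF E.module_axioms] loc_add[OF S] U_mult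
            exchange_add[OF f] exchange_smult[OF f] U_closed fc) }
    { fix A assume "A \<in> carrier (loc_ring R U)"
      then obtain a t where A: "A = fraction R U ?S a t" "a \<in> carrier R" "t \<in> U"
        by (auto simp: loc_ring_simps loc_carrier)
      show "\<phi> (A \<odot>\<^bsub>loc_module R U E\<^esub> X) = A \<odot>\<^bsub>self_module (loc_ring R U)\<^esub> \<phi> X"
        using X A by (simp add: loc_ring_simps \<phi> loc_smult[OF E.module_axioms] loc_smult[OF S] U_mult
            exchange_smult[OF f] fc) }
  qed
  have inj: "inj_on \<phi> (carrier (loc_module R U E))"
  proof
    fix X Y assume "X \<in> carrier (loc_module R U E)" "Y \<in> carrier (loc_module R U E)" and eq: "\<phi> X = \<phi> Y"
    then obtain m s n t where X: "X = fraction R U E m s" "m \<in> carrier E" "s \<in> U"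
        and Y: "Y = fraction R U E n t" "n \<in> carrier E" "t \<in> U"
      by (auto simp: loc_carrier)
    obtain u where u: "u \<in> U" "u \<otimes> (t \<otimes> f m) = u \<otimes> (s \<otimes> f n)"
      using eq X Y fc fraction_eq_iff[OF S, of "f m" s "f n" t] by (auto simp: \<phi>)
    have cR: "u \<in> carrier R" "s \<in> carrier R" "t \<in> carrier R"
      using u X Y U_closed by auto
    have "(f e \<otimes> u) \<odot>\<^bsub>E\<^esub> (t \<odot>\<^bsub>E\<^esub> m) = (u \<otimes> t) \<odot>\<^bsub>E\<^esub> (f e \<odot>\<^bsub>E\<^esub> m)"
      using X cR e fc by (simp add: E.smult_assoc1[symmetric] m_ac)
    also have "\<dots> = (u \<otimes> (t \<otimes> f m)) \<odot>\<^bsub>E\<^esub> e"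
      using X cR e fc exchange[OF f e(1) X(2)] by (simp add: E.smult_assoc1[symmetric] m_ac)
    also have "\<dots> = (u \<otimes> s) \<odot>\<^bsub>E\<^esub> (f n \<odot>\<^bsub>E\<^esub> e)"
      unfolding u(2) using Y cR e fc by (simp add: E.smult_assoc1[symmetric] m_ac)
    also have "\<dots> = (f e \<otimes> u) \<odot>\<^bsub>E\<^esub> (s \<odot>\<^bsub>E\<^esub> n)"
      unfolding exchange[OF f Y(2) e(1)] using Y cR e fc by (simp add: E.smult_assoc1[symmetric] m_ac)
    finally show "X = Y"
      using X Y U_mult[OF e(2) u(1)] fraction_eq_iff[OF E.module_axioms] by auto
  qed
  have onto: "carrier (self_module (loc_ring R U)) \<subseteq> \<phi> ` carrier (loc_module R U E)"
  proof
    fix A assume "A \<in> carrier (self_module (loc_ring R U))"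
    then obtain a t where A: "A = fraction R U ?S a t" "a \<in> carrier R" "t \<in> U"
      by (auto simp: loc_ring_simps loc_carrier)
    have "\<phi> (fraction R U E (a \<odot>\<^bsub>E\<^esub> e) (f e \<otimes> t)) = fraction R U ?S (a \<otimes> f e) (f e \<otimes> t)"
      using A e by (simp add: \<phi> U_mult exchange_smult[OF f])
    also have "\<dots> = A"
      unfolding A(1)
    proof (subst fraction_eq_iff[OF S])
      show "\<exists>u\<in>U. u \<odot>\<^bsub>?S\<^esub> (t \<odot>\<^bsub>?S\<^esub> (a \<otimes> f e)) = u \<odot>\<^bsub>?S\<^esub> ((f e \<otimes> t) \<odot>\<^bsub>?S\<^esub> a)"
        using A(2) U_closed[OF A(3)] U_closed[OF e(2)] by (intro bexI[OF _ U_one]) (simp add: m_ac)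
    qed (use A e U_mult U_closed in simp_all)
    finally have "A = \<phi> (fraction R U E (a \<odot>\<^bsub>E\<^esub> e) (f e \<otimes> t))" by (rule sym)
    moreover have "fraction R U E (a \<odot>\<^bsub>E\<^esub> e) (f e \<otimes> t) \<in> carrier (loc_module R U E)"
      unfolding loc_carrier using A e U_mult E.smult_closed by blast
    ultimately show "A \<in> \<phi> ` carrier (loc_module R U E)"
      by (rule image_eqI)
  qed
  have "\<phi> ` carrier (loc_module R U E) = carrier (self_module (loc_ring R U))"
    using onto mod_hom_closed[OF hom] by (intro equalityI image_subsetI)
  then show ?thesis
    unfolding mod_iso_def bij_betw_def using hom inj by (intro bexI[of _ \<phi>] conjI)
qed

end

lemma multiplicative_subset_prime:
  assumes "primeideal P R"
  shows "multiplicative_subset R (carrier R - P)"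
proof -
  interpret P: primeideal P R by fact
  show ?thesis
  proof
    show "\<one>\<^bsub>R\<^esub> \<in> carrier R - P"
      using P.one_imp_carrier P.I_notcarr by auto
    show "s \<otimes>\<^bsub>R\<^esub> t \<in> carrier R - P" if "s \<in> carrier R - P" "t \<in> carrier R - P" for s t
      using that P.I_prime by auto
  qed auto
qed

lemma invertible_rank_one:
  assumes "invertible_module R E"
  shows "rank_one R E"
  unfolding rank_one_def Let_def
proof (intro allI impI)
  fix P assume "primeideal P R"
  then interpret P: primeideal P R .
  interpret E: module R E using assms by (rule invertible_imp_module)
  interpret U: multiplicative_subset R "carrier R - P"
    by (rule multiplicative_subset_prime) (rule P.primeideal)
  have "\<exists>f\<in>exchange_functionals R E. \<exists>e\<in>carrier E. f e \<notin> P"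
  proof (rule ccontr)
    assume "\<not> ?thesis"
    then have *: "f e \<in> P" if "f \<in> exchange_functionals R E" "e \<in> carrier E" for f e
      using that by blast
    from assms have "\<one>\<^bsub>R\<^esub> \<in> P"
    proof (induction rule: invertible_induct)
      case (functional f x)
      then show ?case by (rule * )
    qed (simp_all add: P.I_l_closed)
    then show False using P.one_imp_carrier P.I_notcarr by auto
  qed
  then obtain f e where "f \<in> exchange_functionals R E" "e \<in> carrier E" "f e \<notin> P"
    by blast
  then show "mod_iso (loc_ring R (carrier R - P)) (loc_module R (carrier R - P) E)
      (self_module (loc_ring R (carrier R - P)))"
    using U.loc_iso_of_exchange[OF E.module_axioms, of f e] exchange_closed[of f R E e] by simp
qed


section \<open>Finitely generated projective modules of rank one are the invertible ones\<close>

text \<open>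
  The projection onto the first summand is defined by choice of a decomposition, which is unique
  because the summands meet in zero only.
\<close>

lemma projective_retract:
  fixes E :: "('a, 'e) module"
  assumes "module R E" "projective R E"
  obtains I :: "'e set" and \<iota> \<pi> where "\<iota> \<in> mod_hom R E (free_module R I)"
    "\<pi> \<in> mod_hom R (free_module R I) E" "\<And>x. x \<in> carrier E \<Longrightarrow> \<pi> (\<iota> x) = x"
proof -
  interpret E: module R E by fact
  obtain I :: "'e set" and P Q where P: "submodule P R (free_module R I)"
      and Q: "submodule Q R (free_module R I)"
      and int: "P \<inter> Q = {\<zero>\<^bsub>free_module R I\<^esub>}"
      and sum: "P <+>\<^bsub>free_module R I\<^esub> Q = carrier (free_module R I)"
      and iso: "mod_iso R E ((free_module R I)\<lparr>carrier := P\<rparr>)"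
    using assms(2) unfolding projective_def Let_def by (elim exE conjE)
  let ?F = "free_module R I"
  interpret F: module R ?F by (rule module_free[OF E.R.is_cring])
  note [simp del] = free_module_simps
  note Ps = F.submoduleE[OF P] and Qs = F.submoduleE[OF Q]
  have PF: "p \<in> carrier ?F" if "p \<in> P" for p using that Ps(1) by blast
  have QF: "q \<in> carrier ?F" if "q \<in> Q" for q using that Qs(1) by blast
  have unique: "p = p'" if "p \<in> P" "p' \<in> P" "q \<in> Q" "q' \<in> Q" "p \<oplus>\<^bsub>?F\<^esub> q = p' \<oplus>\<^bsub>?F\<^esub> q'" for p p' q q'
  proof -
    note c = PF[OF that(1)] PF[OF that(2)] QF[OF that(3)] QF[OF that(4)]
    have "p \<ominus>\<^bsub>?F\<^esub> p' = (p \<oplus>\<^bsub>?F\<^esub> q) \<oplus>\<^bsub>?F\<^esub> (\<ominus>\<^bsub>?F\<^esub> q \<oplus>\<^bsub>?F\<^esub> \<ominus>\<^bsub>?F\<^esub> p')"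
      using c by (simp add: F.minus_eq F.a_assoc F.r_neg2)
    also have "\<dots> = (p' \<oplus>\<^bsub>?F\<^esub> q') \<oplus>\<^bsub>?F\<^esub> (\<ominus>\<^bsub>?F\<^esub> p' \<oplus>\<^bsub>?F\<^esub> \<ominus>\<^bsub>?F\<^esub> q)"
      unfolding that(5) using c by (simp add: F.a_comm)
    also have "\<dots> = (q' \<oplus>\<^bsub>?F\<^esub> p') \<oplus>\<^bsub>?F\<^esub> (\<ominus>\<^bsub>?F\<^esub> p' \<oplus>\<^bsub>?F\<^esub> \<ominus>\<^bsub>?F\<^esub> q)"
      using c by (simp add: F.a_comm)
    also have "\<dots> = q' \<ominus>\<^bsub>?F\<^esub> q"
      using c by (simp add: F.minus_eq F.a_assoc F.r_neg2)
    finally have eq: "p \<ominus>\<^bsub>?F\<^esub> p' = q' \<ominus>\<^bsub>?F\<^esub> q" .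
    have "p \<ominus>\<^bsub>?F\<^esub> p' \<in> P"
      using that Ps(3,5) by (simp add: F.minus_eq)
    moreover have "q' \<ominus>\<^bsub>?F\<^esub> q \<in> Q"
      using that Qs(3,5) by (simp add: F.minus_eq)
    ultimately have "p \<ominus>\<^bsub>?F\<^esub> p' = \<zero>\<^bsub>?F\<^esub>"
      using eq int by auto
    moreover have "p = (p \<ominus>\<^bsub>?F\<^esub> p') \<oplus>\<^bsub>?F\<^esub> p'"
      using c by (simp add: F.minus_eq F.a_assoc F.l_neg)
    ultimately show "p = p'" using c by simp
  qed
  define pr where "pr z = (SOME p. p \<in> P \<and> (\<exists>q\<in>Q. z = p \<oplus>\<^bsub>?F\<^esub> q))" for z
  have ex: "\<exists>p. p \<in> P \<and> (\<exists>q\<in>Q. z = p \<oplus>\<^bsub>?F\<^esub> q)" if "z \<in> carrier ?F" for z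
    using that unfolding sum[symmetric] set_add_def' by blast
  have pr: "pr z \<in> P \<and> (\<exists>q\<in>Q. z = pr z \<oplus>\<^bsub>?F\<^esub> q)" if "z \<in> carrier ?F" for z
    unfolding pr_def by (rule someI_ex[OF ex[OF that]])
  have prI: "pr z = p" if "p \<in> P" "q \<in> Q" "z = p \<oplus>\<^bsub>?F\<^esub> q" for z p q
  proof -
    have "z \<in> carrier ?F" using that PF QF by simp
    from pr[OF this] obtain q' where "pr z \<in> P" "q' \<in> Q" "z = pr z \<oplus>\<^bsub>?F\<^esub> q'" by blast
    then show ?thesis using unique[of "pr z" p q' q] that by simp
  qed
  have pr_hom: "pr \<in> mod_hom R ?F (?F\<lparr>carrier := P\<rparr>)"
  proof (rule mod_homI)
    fix z w assume z: "z \<in> carrier ?F" and w: "w \<in> carrier ?F"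
    obtain q q' where q: "q \<in> Q" "z = pr z \<oplus>\<^bsub>?F\<^esub> q" and q': "q' \<in> Q" "w = pr w \<oplus>\<^bsub>?F\<^esub> q'"
      using pr[OF z] pr[OF w] by blast
    note c = PF[OF conjunct1[OF pr[OF z]]] PF[OF conjunct1[OF pr[OF w]]] QF[OF q(1)] QF[OF q'(1)]
    have "z \<oplus>\<^bsub>?F\<^esub> w = (pr z \<oplus>\<^bsub>?F\<^esub> q) \<oplus>\<^bsub>?F\<^esub> (pr w \<oplus>\<^bsub>?F\<^esub> q')"
      using q(2) q'(2) by simp
    also have "\<dots> = (pr z \<oplus>\<^bsub>?F\<^esub> pr w) \<oplus>\<^bsub>?F\<^esub> (q \<oplus>\<^bsub>?F\<^esub> q')"
      using c by (simp add: F.a_ac)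
    finally have "pr (z \<oplus>\<^bsub>?F\<^esub> w) = pr z \<oplus>\<^bsub>?F\<^esub> pr w"
      using pr[OF z] pr[OF w] Ps(5) Qs(5) q(1) q'(1) by (intro prI) auto
    then show "pr (z \<oplus>\<^bsub>?F\<^esub> w) = pr z \<oplus>\<^bsub>?F\<lparr>carrier := P\<rparr>\<^esub> pr w" by simp
  next
    fix r z assume r: "r \<in> carrier R" and z: "z \<in> carrier ?F"
    obtain q where q: "q \<in> Q" "z = pr z \<oplus>\<^bsub>?F\<^esub> q"
      using pr[OF z] by blast
    note c = PF[OF conjunct1[OF pr[OF z]]] QF[OF q(1)]
    have "r \<odot>\<^bsub>?F\<^esub> z = r \<odot>\<^bsub>?F\<^esub> (pr z \<oplus>\<^bsub>?F\<^esub> q)"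
      using q(2) by simp
    also have "\<dots> = r \<odot>\<^bsub>?F\<^esub> pr z \<oplus>\<^bsub>?F\<^esub> r \<odot>\<^bsub>?F\<^esub> q"
      using c r by (simp add: F.smult_r_distr)
    finally have "pr (r \<odot>\<^bsub>?F\<^esub> z) = r \<odot>\<^bsub>?F\<^esub> pr z"
      using pr[OF z] Ps(4) Qs(4) q(1) r by (intro prI) auto
    then show "pr (r \<odot>\<^bsub>?F\<^esub> z) = r \<odot>\<^bsub>?F\<lparr>carrier := P\<rparr>\<^esub> pr z" by simp
  qed (use pr in simp)
  obtain \<phi> where \<phi>: "\<phi> \<in> mod_hom R E (?F\<lparr>carrier := P\<rparr>)" and bij: "bij_betw \<phi> (carrier E) P"
    using iso unfolding mod_iso_def by auto
  let ?\<psi> = "inv_into (carrier E) \<phi>"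
  have "?\<psi> \<in> mod_hom R (?F\<lparr>carrier := P\<rparr>) E"
    using bij by (intro mod_hom_inverse[OF E.module_axioms \<phi>]) simp
  from mod_hom_comp[OF pr_hom this] have \<pi>: "(\<lambda>z. ?\<psi> (pr z)) \<in> mod_hom R ?F E" .
  have \<phi>P: "\<phi> x \<in> P" if "x \<in> carrier E" for x
    using mod_hom_closed[OF \<phi> that] by simp
  show thesis
  proof (rule that)
    show "\<phi> \<in> mod_hom R E ?F"
      by (rule mod_homI) (use \<phi>P PF mod_hom_add[OF \<phi>] mod_hom_smult[OF \<phi>] in simp_all)
    show "(\<lambda>z. ?\<psi> (pr z)) \<in> mod_hom R ?F E" by (rule \<pi>)
    fix x assume x: "x \<in> carrier E"
    have zQ: "\<zero>\<^bsub>?F\<^esub> \<in> Q" using int by blast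
    have "pr (\<phi> x) = \<phi> x"
      using PF[OF \<phi>P[OF x]] by (intro prI[OF \<phi>P[OF x] zQ]) simp
    then show "?\<psi> (pr (\<phi> x)) = x"
      using bij x by (simp add: bij_betw_def)
  qed
qed

text \<open>
  Let \<open>m / t\<close> be the basis vector of the localized module.  Finite generation gives one \<open>s \<in> U\<close>
  with \<open>s E \<subseteq> R m\<close>, and projectivity lifts \<open>x \<mapsto> s x \<in> R m\<close> along \<open>R \<rightarrow> R m\<close> to a functional \<open>f0\<close>
  with \<open>s x = f0 x m\<close>.  Now \<open>s f0 x y = f0 x f0 y m\<close> is symmetric in \<open>x\<close> and \<open>y\<close>, so that \<open>s f0\<close>
  is an exchange functional.  Moreover \<open>(s - f0 m) m = 0\<close>; as \<open>m\<close> is torsion free up to \<open>U\<close>, some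
  \<open>v \<in> U\<close> satisfies \<open>v f0 m = v s\<close>, and then \<open>v s f0\<close> takes a value in \<open>U\<close> at \<open>m\<close>.
\<close>

lemma (in multiplicative_subset) exchange_of_loc_iso:
  assumes "fgp_module R E"
    and iso: "mod_iso (loc_ring R U) (loc_module R U E) (self_module (loc_ring R U))"
  obtains f e where "f \<in> exchange_functionals R E" "e \<in> carrier E" "f e \<in> U"
proof -
  have E: "module R E" and fg: "fin_gen R E" and pj: "projective R E"
    using assms(1) by (simp_all add: fgp_module_def)
  interpret E: module R E by (rule E)
  let ?S = "self_module R" and ?L = "loc_module R U E" and ?R = "loc_ring R U"
  note S = module_self[OF R.is_cring]
  obtain \<phi> where \<phi>: "\<phi> \<in> mod_hom ?R ?L (self_module ?R)"
      and bij: "bij_betw \<phi> (carrier ?L) (carrier (self_module ?R))"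
    using iso unfolding mod_iso_def by blast
  have one: "fraction R U ?S \<one> \<one> \<in> carrier (self_module ?R)"
    using U_one by (auto simp: loc_ring_simps loc_carrier)
  then obtain X where X: "X \<in> carrier ?L" "\<phi> X = fraction R U ?S \<one> \<one>"
    using bij unfolding bij_betw_def by (metis imageE)
  then obtain m t where m: "X = fraction R U E m t" "m \<in> carrier E" "t \<in> U"
    unfolding loc_carrier by blast
  have frR: "fraction R U ?S a s \<in> carrier ?R" if "a \<in> carrier R" "s \<in> U" for a s
    using that by (auto simp: loc_ring_simps loc_carrier)
  have frL: "fraction R U E x s \<in> carrier ?L" if "x \<in> carrier E" "s \<in> U" for x s
    using that by (auto simp: loc_carrier)
  have \<phi>m: "\<phi> (fraction R U E (a \<odot>\<^bsub>E\<^esub> m) (s \<otimes> t)) = fraction R U ?S a s" if "a \<in> carrier R" "s \<in> U" for a s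
  proof -
    have "\<phi> (fraction R U ?S a s \<odot>\<^bsub>?L\<^esub> X) = fraction R U ?S a s \<odot>\<^bsub>self_module ?R\<^esub> fraction R U ?S \<one> \<one>"
      using mod_hom_smult[OF \<phi> frR[OF that] X(1)] X(2) by simp
    also have "\<dots> = fraction R U ?S a s"
      using that U_one U_closed[OF that(2)] by (simp add: loc_ring_simps loc_smult[OF S])
    finally show ?thesis
      using that m by (simp add: loc_smult[OF E])
  qed
  have inj: "x = y" if "x \<in> carrier ?L" "y \<in> carrier ?L" "\<phi> x = \<phi> y" for x y
    using bij that unfolding bij_betw_def inj_on_def by blast
  \<comment> \<open>The inverse image of \<open>1\<close> generates the localized module, and nothing but \<open>0\<close> annihilates it there.\<close>
  have cyclic: "\<exists>s\<in>U. \<exists>r\<in>carrier R. s \<odot>\<^bsub>E\<^esub> x = r \<odot>\<^bsub>E\<^esub> m" if x: "x \<in> carrier E" for x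
  proof -
    have "\<phi> (fraction R U E x \<one>) \<in> carrier ?R"
      using mod_hom_closed[OF \<phi> frL[OF x U_one]] by simp
    then obtain a s where as: "\<phi> (fraction R U E x \<one>) = fraction R U ?S a s" "a \<in> carrier R" "s \<in> U"
      unfolding loc_ring_simps loc_carrier self_module_simps by blast
    have "fraction R U E x \<one> = fraction R U E (a \<odot>\<^bsub>E\<^esub> m) (s \<otimes> t)"
      using inj[OF frL[OF x U_one] frL, of "a \<odot>\<^bsub>E\<^esub> m" "s \<otimes> t"] as m U_mult by (simp add: \<phi>m)
    then obtain u where u: "u \<in> U" "u \<odot>\<^bsub>E\<^esub> ((s \<otimes> t) \<odot>\<^bsub>E\<^esub> x) = u \<odot>\<^bsub>E\<^esub> (\<one> \<odot>\<^bsub>E\<^esub> (a \<odot>\<^bsub>E\<^esub> m))"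
      using fraction_eq_iff[OF E x U_one, of "a \<odot>\<^bsub>E\<^esub> m" "s \<otimes> t"] as m U_mult by auto
    note c = U_closed[OF u(1)] U_closed[OF as(3)] U_closed[OF m(3)]
    have "(u \<otimes> (s \<otimes> t)) \<odot>\<^bsub>E\<^esub> x = (u \<otimes> a) \<odot>\<^bsub>E\<^esub> m"
      using u(2) c as m x by (simp add: E.smult_assoc1)
    then show ?thesis
      using U_mult[OF u(1) U_mult[OF as(3) m(3)]] c as(2) by (intro bexI[of _ "u \<otimes> (s \<otimes> t)"] bexI[of _ "u \<otimes> a"]) auto
  qed
  have torsion: "\<exists>v\<in>U. v \<otimes> r = \<zero>" if r: "r \<in> carrier R" and rm: "r \<odot>\<^bsub>E\<^esub> m = \<zero>\<^bsub>E\<^esub>" for r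
  proof -
    have "fraction R U ?S r \<one> = fraction R U ?S \<zero> \<one>"
      using \<phi>m[OF r U_one] \<phi>m[OF R.zero_closed U_one] rm m by simp
    then obtain v where "v \<in> U" "v \<otimes> (\<one> \<otimes> r) = v \<otimes> (\<one> \<otimes> \<zero>)"
      using fraction_eq_iff[OF S, of r \<one> \<zero> \<one>] r U_one by auto
    then show ?thesis
      using r U_closed by (intro bexI[of _ v]) auto
  qed
  have common: "\<exists>s\<in>U. \<forall>x\<in>A. \<exists>r\<in>carrier R. s \<odot>\<^bsub>E\<^esub> x = r \<odot>\<^bsub>E\<^esub> m" if "finite A" "A \<subseteq> carrier E" for A
    using that
  proof induction
    case empty
    then show ?case using U_one by blast
  next
    case (insert x A)
    then obtain s where s: "s \<in> U" "\<And>y. y \<in> A \<Longrightarrow> \<exists>r\<in>carrier R. s \<odot>\<^bsub>E\<^esub> y = r \<odot>\<^bsub>E\<^esub> m"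
      by blast
    have x: "x \<in> carrier E" using insert by simp
    obtain s' r' where s': "s' \<in> U" "r' \<in> carrier R" "s' \<odot>\<^bsub>E\<^esub> x = r' \<odot>\<^bsub>E\<^esub> m"
      using cyclic[OF x] by blast
    note c = U_closed[OF s(1)] U_closed[OF s'(1)]
    have "(s \<otimes> s') \<odot>\<^bsub>E\<^esub> x = (s \<otimes> r') \<odot>\<^bsub>E\<^esub> m"
      using s' c x m by (simp add: E.smult_assoc1)
    then have "\<exists>r\<in>carrier R. (s \<otimes> s') \<odot>\<^bsub>E\<^esub> x = r \<odot>\<^bsub>E\<^esub> m"
      using c s'(2) by (intro bexI[of _ "s \<otimes> r'"]) simp_all
    moreover have "\<exists>r\<in>carrier R. (s \<otimes> s') \<odot>\<^bsub>E\<^esub> y = r \<odot>\<^bsub>E\<^esub> m" if y: "y \<in> A" for y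
    proof -
      obtain r where r: "r \<in> carrier R" "s \<odot>\<^bsub>E\<^esub> y = r \<odot>\<^bsub>E\<^esub> m" using s(2)[OF y] by blast
      have "y \<in> carrier E" using y insert by auto
      then have "(s' \<otimes> s) \<odot>\<^bsub>E\<^esub> y = (s' \<otimes> r) \<odot>\<^bsub>E\<^esub> m"
        using r c m by (simp add: E.smult_assoc1)
      then show ?thesis
        using r c by (intro bexI[of _ "s' \<otimes> r"]) (simp_all add: m_comm)
    qed
    ultimately show ?case
      using U_mult[OF s(1) s'(1)] by (intro bexI[of _ "s \<otimes> s'"]) simp_all
  qed
  obtain A where A: "finite A" "A \<subseteq> carrier E" "gen_submodule R E A = carrier E"
    using fg unfolding fin_gen_def by blast
  from common[OF A(1,2)] obtain s where s: "s \<in> U"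
      and sA: "\<forall>x\<in>A. \<exists>r\<in>carrier R. s \<odot>\<^bsub>E\<^esub> x = r \<odot>\<^bsub>E\<^esub> m"
    by (rule bexE)
  have sR: "s \<in> carrier R" using s by (rule U_closed)
  let ?N = "{x \<in> carrier E. \<exists>r\<in>carrier R. s \<odot>\<^bsub>E\<^esub> x = r \<odot>\<^bsub>E\<^esub> m}"
  have "submodule ?N R E"
  proof (rule E.submoduleI)
    show "\<zero>\<^bsub>E\<^esub> \<in> ?N"
      using sR m by (auto intro!: bexI[of _ \<zero>])
    show add: "x \<oplus>\<^bsub>E\<^esub> y \<in> ?N" if "x \<in> ?N" "y \<in> ?N" for x y
    proof -
      obtain a b where "a \<in> carrier R" "b \<in> carrier R" "s \<odot>\<^bsub>E\<^esub> x = a \<odot>\<^bsub>E\<^esub> m" "s \<odot>\<^bsub>E\<^esub> y = b \<odot>\<^bsub>E\<^esub> m"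
        using \<open>x \<in> ?N\<close> \<open>y \<in> ?N\<close> by blast
      then show ?thesis
        using that sR m by (auto simp: E.smult_r_distr E.smult_l_distr intro!: bexI[of _ "a \<oplus> b"])
    qed
    show smult: "r \<odot>\<^bsub>E\<^esub> x \<in> ?N" if r: "r \<in> carrier R" and "x \<in> ?N" for r x
    proof -
      obtain a where a: "a \<in> carrier R" "s \<odot>\<^bsub>E\<^esub> x = a \<odot>\<^bsub>E\<^esub> m" and x: "x \<in> carrier E"
        using \<open>x \<in> ?N\<close> by blast
      have "s \<odot>\<^bsub>E\<^esub> (r \<odot>\<^bsub>E\<^esub> x) = r \<odot>\<^bsub>E\<^esub> (s \<odot>\<^bsub>E\<^esub> x)"
        using r sR x by (simp add: E.smult_assoc1[symmetric] m_comm)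
      also have "\<dots> = (r \<otimes> a) \<odot>\<^bsub>E\<^esub> m"
        using r a m by (simp add: E.smult_assoc1)
      finally show ?thesis
        using r a x by (auto intro!: bexI[of _ "r \<otimes> a"])
    qed
    show "\<ominus>\<^bsub>E\<^esub> x \<in> ?N" if "x \<in> ?N" for x
      using smult[of "\<ominus> \<one>", OF _ that] that by (simp add: E.smult_l_minus)
  qed auto
  moreover have "A \<subseteq> ?N" using sA A(2) by blast
  ultimately have sE: "\<exists>r\<in>carrier R. s \<odot>\<^bsub>E\<^esub> x = r \<odot>\<^bsub>E\<^esub> m" if "x \<in> carrier E" for x
    using gen_submodule_least[of ?N R E A] A(3) that by auto
  obtain I :: "'b set" and \<iota> \<pi> where \<iota>: "\<iota> \<in> mod_hom R E (free_module R I)"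
      and \<pi>: "\<pi> \<in> mod_hom R (free_module R I) E" and \<pi>\<iota>: "\<And>x. x \<in> carrier E \<Longrightarrow> \<pi> (\<iota> x) = x"
    using projective_retract[OF E pj] by metis
  let ?F = "free_module R I"
  interpret F: module R ?F by (rule module_free[OF R.is_cring])
  note [simp del] = free_module_simps
  have bas: "basis_vec R i \<in> carrier ?F" if "i \<in> I" for i
    by (rule basis_vec_in_free[OF R.is_cring that])
  have "\<forall>i\<in>I. \<exists>r\<in>carrier R. s \<odot>\<^bsub>E\<^esub> \<pi> (basis_vec R i) = r \<odot>\<^bsub>E\<^esub> m"
    using sE mod_hom_closed[OF \<pi> bas] by blast
  then obtain \<rho> where \<rho>: "\<And>i. i \<in> I \<Longrightarrow> \<rho> i \<in> carrier R"
      "\<And>i. i \<in> I \<Longrightarrow> s \<odot>\<^bsub>E\<^esub> \<pi> (basis_vec R i) = \<rho> i \<odot>\<^bsub>E\<^esub> m"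
    by metis
  obtain h where h: "h \<in> mod_hom R ?F ?S" "\<And>i. i \<in> I \<Longrightarrow> h (basis_vec R i) = \<rho> i"
    by (rule free_module_lift[OF S, of I \<rho>]) (simp_all add: \<rho>(1))
  have hc: "h z \<in> carrier R" if "z \<in> carrier ?F" for z
    using mod_hom_closed[OF h(1) that] by simp
  have \<pi>h: "s \<odot>\<^bsub>E\<^esub> \<pi> z = h z \<odot>\<^bsub>E\<^esub> m" if "z \<in> carrier ?F" for z
    using R.is_cring that
  proof (induction rule: free_module_induct)
    case zero
    have "\<pi> (\<lambda>_. \<zero>) = \<zero>\<^bsub>E\<^esub>" "h (\<lambda>_. \<zero>) = \<zero>"
      using mod_hom_zero[OF F.module_axioms E \<pi>] mod_hom_zero[OF F.module_axioms S h(1)]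
      by (simp_all add: free_module_simps)
    then show ?case using sR m by simp
  next
    case (step z r i)
    have "s \<odot>\<^bsub>E\<^esub> (r \<odot>\<^bsub>E\<^esub> \<pi> (basis_vec R i)) = r \<odot>\<^bsub>E\<^esub> (s \<odot>\<^bsub>E\<^esub> \<pi> (basis_vec R i))"
      using step sR mod_hom_closed[OF \<pi> bas] by (simp add: E.smult_assoc1[symmetric] m_comm)
    also have "\<dots> = (r \<otimes> \<rho> i) \<odot>\<^bsub>E\<^esub> m"
      using step \<rho> m by (simp add: E.smult_assoc1)
    finally show ?case
      using step sR m bas \<rho>(1) hc mod_hom_closed[OF \<pi>]
      by (simp add: mod_hom_add[OF \<pi>] mod_hom_add[OF h(1)] mod_hom_smult[OF \<pi>] mod_hom_smult[OF h(1)]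
          h(2) E.smult_r_distr E.smult_l_distr)
  qed
  define f0 where "f0 x = h (\<iota> x)" for x
  have f0: "f0 \<in> mod_hom R E ?S"
    unfolding f0_def by (rule mod_hom_comp[OF \<iota> h(1)])
  have f0c: "f0 x \<in> carrier R" if "x \<in> carrier E" for x
    using mod_hom_closed[OF f0 that] by simp
  have sf0: "s \<odot>\<^bsub>E\<^esub> x = f0 x \<odot>\<^bsub>E\<^esub> m" if "x \<in> carrier E" for x
    using \<pi>h[OF mod_hom_closed[OF \<iota> that]] \<pi>\<iota>[OF that] by (simp add: f0_def)
  have "(s \<ominus> f0 m) \<odot>\<^bsub>E\<^esub> m = \<zero>\<^bsub>E\<^esub>"
    using sf0[OF m(2)] f0c[OF m(2)] sR m(2)
    by (simp add: R.minus_eq E.smult_l_distr E.smult_l_minus E.r_neg)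
  then obtain v where v: "v \<in> U" "v \<otimes> (s \<ominus> f0 m) = \<zero>"
    using torsion[of "s \<ominus> f0 m"] sR f0c[OF m(2)] by auto
  have vR: "v \<in> carrier R" using v(1) by (rule U_closed)
  have vs: "v \<otimes> f0 m = v \<otimes> s"
  proof -
    have "v \<otimes> s = v \<otimes> ((s \<ominus> f0 m) \<oplus> f0 m)"
      using sR f0c[OF m(2)] by (simp add: R.minus_eq R.a_assoc R.l_neg)
    also have "\<dots> = v \<otimes> f0 m"
      using v vR sR f0c[OF m(2)] by (simp add: R.r_distr)
    finally show ?thesis by simp
  qed
  show thesis
  proof (rule that)
    have "(\<lambda>x. s \<otimes> f0 x) \<in> exchange_functionals R E"
    proof (rule exchangeI)
      fix x y assume x: "x \<in> carrier E" and y: "y \<in> carrier E"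
      have "(s \<otimes> f0 x) \<odot>\<^bsub>E\<^esub> y = f0 x \<odot>\<^bsub>E\<^esub> (s \<odot>\<^bsub>E\<^esub> y)"
        using x y sR f0c by (simp add: E.smult_assoc1[symmetric] m_comm)
      also have "\<dots> = f0 y \<odot>\<^bsub>E\<^esub> (s \<odot>\<^bsub>E\<^esub> x)"
        unfolding sf0[OF x] sf0[OF y] using x y m f0c by (simp add: E.smult_assoc1[symmetric] m_comm)
      also have "\<dots> = (s \<otimes> f0 y) \<odot>\<^bsub>E\<^esub> x"
        using x y sR f0c by (simp add: E.smult_assoc1[symmetric] m_comm)
      finally show "(s \<otimes> f0 x) \<odot>\<^bsub>E\<^esub> y = (s \<otimes> f0 y) \<odot>\<^bsub>E\<^esub> x" .
    next
      fix r x assume "r \<in> carrier R" "x \<in> carrier E"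
      then show "s \<otimes> f0 (r \<odot>\<^bsub>E\<^esub> x) = r \<otimes> (s \<otimes> f0 x)"
        using mod_hom_smult[OF f0, of r x] f0c sR by (simp add: m_lcomm)
    qed (use sR f0c mod_hom_add[OF f0] in \<open>simp_all add: R.r_distr\<close>)
    from exchange_scale[OF E this vR] show "(\<lambda>x. v \<otimes> (s \<otimes> f0 x)) \<in> exchange_functionals R E" .
    show "m \<in> carrier E" by (rule m(2))
    have "v \<otimes> (s \<otimes> f0 m) = s \<otimes> (v \<otimes> f0 m)"
      using vR sR f0c[OF m(2)] by (simp add: m_lcomm)
    then show "v \<otimes> (s \<otimes> f0 m) \<in> U"
      unfolding vs using U_mult s v(1) by simp
  qed
qed

lemma pic_module_imp_invertible:
  assumes "pic_module R E"
  shows "invertible_module R E"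
proof (rule ccontr)
  assume no: "\<not> invertible_module R E"
  have fgp: "fgp_module R E" and rk: "rank_one R E"
    using assms by (simp_all add: pic_module_def)
  have E: "module R E" using fgp by (simp add: fgp_module_def)
  interpret E: module R E by (rule E)
  let ?T = "{f x | f x. f \<in> exchange_functionals R E \<and> x \<in> carrier E}"
  have T: "?T \<subseteq> carrier R"
    by (auto intro: exchange_closed)
  have "\<one>\<^bsub>R\<^esub> \<notin> genideal R ?T"
    using no E unfolding invertible_module_def by simp
  from ex_prime_ideal[OF E.R.is_cring E.R.genideal_ideal[OF T] this]
  obtain P where P: "primeideal P R" "genideal R ?T \<subseteq> P" .
  interpret U: multiplicative_subset R "carrier R - P"
    by (rule multiplicative_subset_prime[OF P(1)])
  obtain f e where "f \<in> exchange_functionals R E" "e \<in> carrier E" "f e \<in> carrier R - P"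
    by (rule U.exchange_of_loc_iso[OF fgp]) (use rk P(1) in \<open>simp_all add: rank_one_def Let_def\<close>)
  moreover have "f e \<in> P" if "f \<in> exchange_functionals R E" "e \<in> carrier E" for f e
    using P(2) E.R.genideal_self[OF T] that by blast
  ultimately show False by blast
qed


text \<open>
  The module \<open>E\<close> is a retract of a finite free module.  For a scalar \<open>r\<close>, consider factorizations of
  multiplication by \<open>r\<close> through the free module on a finite subset of \<open>E\<close>, where the second map sends
  basis vectors to themselves.  An exchange functional \<open>f\<close> gives one for \<open>r = f e\<close> through the set
  \<open>{e}\<close>, sending \<open>x\<close> to \<open>f x\<close> times the basis vector of \<open>e\<close>, and such factorizations can be added and scaled.
\<close>

lemma invertible_retract:
  fixes E :: "('a, 'e) module"
  assumes "invertible_module R E"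
  obtains A :: "'e set" and \<iota> \<pi> where "finite A" "A \<subseteq> carrier E"
    "\<iota> \<in> mod_hom R E (free_module R A)" "\<pi> \<in> mod_hom R (free_module R A) E"
    "\<And>x. x \<in> carrier E \<Longrightarrow> \<pi> (\<iota> x) = x" "\<And>a. a \<in> A \<Longrightarrow> \<pi> (basis_vec R a) = a"
proof -
  interpret E: module R E using assms by (rule invertible_imp_module)
  note cr = E.R.is_cring
  \<comment> \<open>One map serves all finite subsets at once, so that factorizations through different subsets can be added.\<close>
  obtain \<pi> where \<pi>: "\<pi> \<in> mod_hom R (free_module R (carrier E)) E"
      and \<pi>b: "\<And>a. a \<in> carrier E \<Longrightarrow> \<pi> (basis_vec R a) = a"
    by (rule free_module_lift[OF E.module_axioms, of "carrier E" "\<lambda>a. a"]) blast+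
  have mono: "z \<in> carrier (free_module R B)" if "z \<in> carrier (free_module R A)" "A \<subseteq> B" for z and A B :: "'e set"
    using free_module_coord[OF cr that(1)] that by (auto simp: free_module_carrier)
  have hom_mono: "\<iota> \<in> mod_hom R E (free_module R B)"
    if "\<iota> \<in> mod_hom R E (free_module R A)" "A \<subseteq> B" for \<iota> and A B :: "'e set"
  proof (rule mod_homI)
    fix x assume "x \<in> carrier E"
    show "\<iota> x \<in> carrier (free_module R B)"
      by (rule mono[OF mod_hom_closed[OF that(1) \<open>x \<in> carrier E\<close>] that(2)])
  qed (use mod_hom_add[OF that(1)] mod_hom_smult[OF that(1)] in simp_all)
  let ?P = "\<lambda>r. \<exists>A \<iota>. finite A \<and> A \<subseteq> carrier E \<and> \<iota> \<in> mod_hom R E (free_module R A) \<and>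
    (\<forall>x\<in>carrier E. \<pi> (\<iota> x) = r \<odot>\<^bsub>E\<^esub> x)"
  from assms have "?P \<one>\<^bsub>R\<^esub>"
  proof (induction rule: invertible_induct)
    case (functional f e)
    let ?F = "free_module R {e}"
    interpret F: module R ?F by (rule module_free[OF cr])
    have b: "basis_vec R e \<in> carrier ?F"
      by (rule basis_vec_in_free[OF cr]) simp
    note fc = exchange_closed[OF functional(1)]
    have "(\<lambda>x. f x \<odot>\<^bsub>?F\<^esub> basis_vec R e) \<in> mod_hom R E ?F"
    proof (rule mod_homI)
      fix x y assume "x \<in> carrier E" "y \<in> carrier E"
      then show "f (x \<oplus>\<^bsub>E\<^esub> y) \<odot>\<^bsub>?F\<^esub> basis_vec R e =
          f x \<odot>\<^bsub>?F\<^esub> basis_vec R e \<oplus>\<^bsub>?F\<^esub> f y \<odot>\<^bsub>?F\<^esub> basis_vec R e"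
        using exchange_add[OF functional(1)] F.smult_l_distr[OF fc fc b] by simp
    next
      fix r x assume "r \<in> carrier R" "x \<in> carrier E"
      then show "f (r \<odot>\<^bsub>E\<^esub> x) \<odot>\<^bsub>?F\<^esub> basis_vec R e = r \<odot>\<^bsub>?F\<^esub> (f x \<odot>\<^bsub>?F\<^esub> basis_vec R e)"
        using exchange_smult[OF functional(1)] F.smult_assoc1[OF _ fc b] by simp
    qed (rule F.smult_closed[OF fc b])
    moreover have "\<pi> (f x \<odot>\<^bsub>?F\<^esub> basis_vec R e) = f e \<odot>\<^bsub>E\<^esub> x" if x: "x \<in> carrier E" for x
    proof -
      have "\<pi> (f x \<odot>\<^bsub>?F\<^esub> basis_vec R e) = f x \<odot>\<^bsub>E\<^esub> \<pi> (basis_vec R e)"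
        using mod_hom_smult[OF \<pi> fc[OF x] basis_vec_in_free[OF cr functional(2)]] by simp
      then show ?thesis
        using \<pi>b[OF functional(2)] exchange[OF functional(1) x functional(2)] by simp
    qed
    ultimately show ?case
      using functional(2) by (intro exI[of _ "{e}"] exI[of _ "\<lambda>x. f x \<odot>\<^bsub>?F\<^esub> basis_vec R e"]) simp
  next
    case (add r s)
    obtain A \<iota> where A: "finite A" "A \<subseteq> carrier E" "\<iota> \<in> mod_hom R E (free_module R A)"
        "\<And>x. x \<in> carrier E \<Longrightarrow> \<pi> (\<iota> x) = r \<odot>\<^bsub>E\<^esub> x"
      using add(3) by blast
    obtain B \<kappa> where B: "finite B" "B \<subseteq> carrier E" "\<kappa> \<in> mod_hom R E (free_module R B)"
        "\<And>x. x \<in> carrier E \<Longrightarrow> \<pi> (\<kappa> x) = s \<odot>\<^bsub>E\<^esub> x"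
      using add(4) by blast
    let ?F = "free_module R (A \<union> B)"
    interpret F: module R ?F by (rule module_free[OF cr])
    have \<iota>: "\<iota> \<in> mod_hom R E ?F" and \<kappa>: "\<kappa> \<in> mod_hom R E ?F"
      using hom_mono[OF A(3)] hom_mono[OF B(3)] by simp_all
    note c = mod_hom_closed[OF \<iota>] mod_hom_closed[OF \<kappa>]
    have "(\<lambda>x. \<iota> x \<oplus>\<^bsub>?F\<^esub> \<kappa> x) \<in> mod_hom R E ?F"
    proof (rule mod_homI)
      fix x y assume "x \<in> carrier E" "y \<in> carrier E"
      then show "\<iota> (x \<oplus>\<^bsub>E\<^esub> y) \<oplus>\<^bsub>?F\<^esub> \<kappa> (x \<oplus>\<^bsub>E\<^esub> y) = (\<iota> x \<oplus>\<^bsub>?F\<^esub> \<kappa> x) \<oplus>\<^bsub>?F\<^esub> (\<iota> y \<oplus>\<^bsub>?F\<^esub> \<kappa> y)"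
        using c by (simp add: mod_hom_add[OF \<iota>] mod_hom_add[OF \<kappa>] F.a_ac del: free_module_simps)
    next
      fix r x assume "r \<in> carrier R" "x \<in> carrier E"
      then show "\<iota> (r \<odot>\<^bsub>E\<^esub> x) \<oplus>\<^bsub>?F\<^esub> \<kappa> (r \<odot>\<^bsub>E\<^esub> x) = r \<odot>\<^bsub>?F\<^esub> (\<iota> x \<oplus>\<^bsub>?F\<^esub> \<kappa> x)"
        using c by (simp add: mod_hom_smult[OF \<iota>] mod_hom_smult[OF \<kappa>] F.smult_r_distr
            del: free_module_simps)
    qed (use c in \<open>simp del: free_module_simps\<close>)
    moreover have "\<pi> (\<iota> x \<oplus>\<^bsub>?F\<^esub> \<kappa> x) = (r \<oplus>\<^bsub>R\<^esub> s) \<odot>\<^bsub>E\<^esub> x" if x: "x \<in> carrier E" for x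
    proof -
      have "A \<union> B \<subseteq> carrier E" using A(2) B(2) by simp
      then have "\<pi> (\<iota> x \<oplus>\<^bsub>?F\<^esub> \<kappa> x) = \<pi> (\<iota> x) \<oplus>\<^bsub>E\<^esub> \<pi> (\<kappa> x)"
        using mod_hom_add[OF \<pi> mono[OF c(1)[OF x]] mono[OF c(2)[OF x]]] by simp
      then show ?thesis
        using A(4) B(4) x add(1,2) by (simp add: E.smult_l_distr)
    qed
    ultimately show ?case
      using A(1,2) B(1,2) by (intro exI[of _ "A \<union> B"] exI[of _ "\<lambda>x. \<iota> x \<oplus>\<^bsub>?F\<^esub> \<kappa> x"]) simp
  next
    case (mult r s)
    obtain A \<iota> where A: "finite A" "A \<subseteq> carrier E" and \<iota>: "\<iota> \<in> mod_hom R E (free_module R A)"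
        and A4: "\<And>x. x \<in> carrier E \<Longrightarrow> \<pi> (\<iota> x) = s \<odot>\<^bsub>E\<^esub> x"
      using mult(3) by blast
    let ?F = "free_module R A"
    interpret F: module R ?F by (rule module_free[OF cr])
    note c = mod_hom_closed[OF \<iota>]
    have "(\<lambda>x. r \<odot>\<^bsub>?F\<^esub> \<iota> x) \<in> mod_hom R E ?F"
    proof (rule mod_homI)
      fix x y assume "x \<in> carrier E" "y \<in> carrier E"
      then show "r \<odot>\<^bsub>?F\<^esub> \<iota> (x \<oplus>\<^bsub>E\<^esub> y) = r \<odot>\<^bsub>?F\<^esub> \<iota> x \<oplus>\<^bsub>?F\<^esub> r \<odot>\<^bsub>?F\<^esub> \<iota> y"
        using c mult(1) by (simp add: mod_hom_add[OF \<iota>] F.smult_r_distr del: free_module_simps)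
    next
      fix t x assume "t \<in> carrier R" "x \<in> carrier E"
      then show "r \<odot>\<^bsub>?F\<^esub> \<iota> (t \<odot>\<^bsub>E\<^esub> x) = t \<odot>\<^bsub>?F\<^esub> (r \<odot>\<^bsub>?F\<^esub> \<iota> x)"
        using c mult(1) by (simp add: mod_hom_smult[OF \<iota>] F.smult_assoc1[symmetric] E.R.m_comm
            del: free_module_simps)
    qed (use c mult(1) in \<open>simp del: free_module_simps\<close>)
    moreover have "\<pi> (r \<odot>\<^bsub>?F\<^esub> \<iota> x) = (r \<otimes>\<^bsub>R\<^esub> s) \<odot>\<^bsub>E\<^esub> x" if x: "x \<in> carrier E" for x
      using mod_hom_smult[OF \<pi> mult(1) mono[OF c[OF x] A(2)]] A4[OF x] x mult(1,2)
      by (simp add: E.smult_assoc1)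
    ultimately show ?case
      using A by (intro exI[of _ A] exI[of _ "\<lambda>x. r \<odot>\<^bsub>?F\<^esub> \<iota> x"]) simp
  qed
  then obtain A \<iota> where A: "finite A" "A \<subseteq> carrier E" "\<iota> \<in> mod_hom R E (free_module R A)"
      "\<And>x. x \<in> carrier E \<Longrightarrow> \<pi> (\<iota> x) = \<one>\<^bsub>R\<^esub> \<odot>\<^bsub>E\<^esub> x"
    by blast
  show thesis
  proof (rule that[OF A(1-3)])
    show "\<pi> \<in> mod_hom R (free_module R A) E"
    proof (rule mod_homI)
      fix x y assume "x \<in> carrier (free_module R A)" "y \<in> carrier (free_module R A)"
      then show "\<pi> (x \<oplus>\<^bsub>free_module R A\<^esub> y) = \<pi> x \<oplus>\<^bsub>E\<^esub> \<pi> y"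
        using mod_hom_add[OF \<pi> mono mono] A(2) by simp
    next
      fix r x assume "r \<in> carrier R" "x \<in> carrier (free_module R A)"
      then show "\<pi> (r \<odot>\<^bsub>free_module R A\<^esub> x) = r \<odot>\<^bsub>E\<^esub> \<pi> x"
        using mod_hom_smult[OF \<pi> _ mono] A(2) by simp
    qed (use mod_hom_closed[OF \<pi> mono] A(2) in simp)
  qed (use A(2,4) \<pi>b in auto)
qed

lemma invertible_imp_pic_module:
  fixes E :: "('a, 'e) module"
  assumes "invertible_module R E"
  shows "pic_module R E"
proof -
  interpret E: module R E using assms by (rule invertible_imp_module)
  note cr = E.R.is_cring
  obtain A :: "'e set" and \<iota> \<pi> where A: "finite A" "A \<subseteq> carrier E"
    and \<iota>: "\<iota> \<in> mod_hom R E (free_module R A)" and \<pi>: "\<pi> \<in> mod_hom R (free_module R A) E"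
    and \<pi>\<iota>: "\<And>x. x \<in> carrier E \<Longrightarrow> \<pi> (\<iota> x) = x" and \<pi>b: "\<And>a. a \<in> A \<Longrightarrow> \<pi> (basis_vec R a) = a"
    by (rule invertible_retract[OF assms]) blast
  let ?F = "free_module R A"
  interpret F: module R ?F by (rule module_free[OF cr])
  have bas: "basis_vec R i \<in> carrier ?F" if "i \<in> A" for i
    by (rule basis_vec_in_free[OF cr that])
  note [simp del] = free_module_simps
  have "fin_gen R E"
    unfolding fin_gen_def
  proof (intro exI conjI)
    show "gen_submodule R E A = carrier E"
    proof
      show "gen_submodule R E A \<subseteq> carrier E"
        by (rule gen_submodule_least[OF E.carrier_is_submodule A(2)])
      show "carrier E \<subseteq> gen_submodule R E A"
      proof
        fix x assume x: "x \<in> carrier E"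
        note N = E.submoduleE[OF submodule_gen_submodule[OF E.module_axioms A(2)]]
        have "\<pi> z \<in> gen_submodule R E A" if "z \<in> carrier ?F" for z
          using cr that
        proof (induction rule: free_module_induct)
          case zero
          have "\<pi> (\<lambda>_. \<zero>\<^bsub>R\<^esub>) = \<zero>\<^bsub>E\<^esub>"
            using mod_hom_zero[OF F.module_axioms E.module_axioms \<pi>] by (simp add: free_module_simps)
          moreover have "\<zero>\<^bsub>E\<^esub> \<in> gen_submodule R E A"
          proof -
            obtain y where y: "y \<in> gen_submodule R E A" using N(2) by blast
            then have "\<zero>\<^bsub>R\<^esub> \<odot>\<^bsub>E\<^esub> y \<in> gen_submodule R E A" by (intro N(4)) auto
            then show ?thesis using y N(1) by auto
          qed
          ultimately show ?case by simp
        next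
          case (step z r i)
          have "i \<in> gen_submodule R E A"
            using \<open>i \<in> A\<close> gen_submodule_incl[of A R E] by blast
          then show ?case
            using step bas N(4,5)
            by (simp add: mod_hom_add[OF \<pi>] mod_hom_smult[OF \<pi>] \<pi>b)
        qed
        from this[OF mod_hom_closed[OF \<iota> x]] show "x \<in> gen_submodule R E A"
          using \<pi>\<iota>[OF x] by simp
      qed
    qed
  qed (rule A)+
  moreover have "projective R E"
    unfolding projective_def Let_def
  proof (intro exI conjI)
    let ?P = "\<iota> ` carrier E" and ?Q = "{z \<in> carrier ?F. \<pi> z = \<zero>\<^bsub>E\<^esub>}"
    have \<iota>0: "\<iota> \<zero>\<^bsub>E\<^esub> = \<zero>\<^bsub>?F\<^esub>"
      by (rule mod_hom_zero[OF E.module_axioms F.module_axioms \<iota>])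
    have \<pi>0: "\<pi> \<zero>\<^bsub>?F\<^esub> = \<zero>\<^bsub>E\<^esub>"
      by (rule mod_hom_zero[OF F.module_axioms E.module_axioms \<pi>])
    show "submodule ?P R ?F"
    proof (rule F.submoduleI)
      show "?P \<subseteq> carrier ?F" using mod_hom_closed[OF \<iota>] by auto
      show "\<zero>\<^bsub>?F\<^esub> \<in> ?P" using \<iota>0[symmetric] by (rule image_eqI) simp
    next
      fix a assume "a \<in> ?P"
      then obtain x where "x \<in> carrier E" "a = \<iota> x" by blast
      then show "\<ominus>\<^bsub>?F\<^esub> a \<in> ?P"
        by (intro image_eqI[of _ _ "(\<ominus>\<^bsub>R\<^esub> \<one>\<^bsub>R\<^esub>) \<odot>\<^bsub>E\<^esub> x"])
          (simp_all add: mod_hom_smult[OF \<iota>] mod_hom_closed[OF \<iota>] F.smult_l_minus)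
    next
      fix a b assume "a \<in> ?P" "b \<in> ?P"
      then obtain x y where "x \<in> carrier E" "a = \<iota> x" "y \<in> carrier E" "b = \<iota> y" by blast
      then show "a \<oplus>\<^bsub>?F\<^esub> b \<in> ?P"
        by (intro image_eqI[of _ _ "x \<oplus>\<^bsub>E\<^esub> y"]) (simp_all add: mod_hom_add[OF \<iota>])
    next
      fix r a assume "r \<in> carrier R" "a \<in> ?P"
      then obtain x where "x \<in> carrier E" "a = \<iota> x" by blast
      with \<open>r \<in> carrier R\<close> show "r \<odot>\<^bsub>?F\<^esub> a \<in> ?P"
        by (intro image_eqI[of _ _ "r \<odot>\<^bsub>E\<^esub> x"]) (simp_all add: mod_hom_smult[OF \<iota>])
    qed
    show "submodule ?Q R ?F"
      by (rule submodule_kernel[OF F.module_axioms E.module_axioms \<pi>])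
    show "?P \<inter> ?Q = {\<zero>\<^bsub>?F\<^esub>}"
    proof
      show "?P \<inter> ?Q \<subseteq> {\<zero>\<^bsub>?F\<^esub>}" using \<pi>\<iota> \<iota>0 by auto
      show "{\<zero>\<^bsub>?F\<^esub>} \<subseteq> ?P \<inter> ?Q" using \<pi>0 \<iota>0[symmetric] F.zero_closed by auto
    qed
    show "?P <+>\<^bsub>?F\<^esub> ?Q = carrier ?F"
    proof
      show "?P <+>\<^bsub>?F\<^esub> ?Q \<subseteq> carrier ?F"
        using mod_hom_closed[OF \<iota>] by (auto simp: set_add_def')
      show "carrier ?F \<subseteq> ?P <+>\<^bsub>?F\<^esub> ?Q"
      proof
        fix z assume z: "z \<in> carrier ?F"
        let ?p = "\<iota> (\<pi> z)"
        let ?q = "(\<ominus>\<^bsub>R\<^esub> \<one>\<^bsub>R\<^esub>) \<odot>\<^bsub>?F\<^esub> ?p \<oplus>\<^bsub>?F\<^esub> z"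
        note \<pi>z = mod_hom_closed[OF \<pi> z]
        note p = mod_hom_closed[OF \<iota> \<pi>z]
        have "\<pi> ?q = (\<ominus>\<^bsub>R\<^esub> \<one>\<^bsub>R\<^esub>) \<odot>\<^bsub>E\<^esub> \<pi> z \<oplus>\<^bsub>E\<^esub> \<pi> z"
          using p z \<pi>z by (simp add: mod_hom_add[OF \<pi>] mod_hom_smult[OF \<pi>] \<pi>\<iota>)
        also have "\<dots> = \<zero>\<^bsub>E\<^esub>"
          using \<pi>z by (simp add: E.smult_l_minus E.l_neg)
        finally have "?q \<in> ?Q" using p z by simp
        moreover have "z = ?p \<oplus>\<^bsub>?F\<^esub> ?q"
          using p z by (simp add: F.smult_l_minus F.r_neg2)
        moreover have "?p \<in> ?P" using \<pi>z by simp
        ultimately show "z \<in> ?P <+>\<^bsub>?F\<^esub> ?Q"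
          unfolding set_add_def' by blast
      qed
    qed
    have "inj_on \<iota> (carrier E)"
      by (rule inj_on_inverseI[of _ \<pi>]) (rule \<pi>\<iota>)
    then show "mod_iso R E (?F\<lparr>carrier := ?P\<rparr>)"
      unfolding mod_iso_def
      by (intro bexI[of _ \<iota>] mod_homI)
        (simp_all add: mod_hom_add[OF \<iota>] mod_hom_smult[OF \<iota>] bij_betw_def)
  qed
  ultimately show ?thesis
    using invertible_rank_one[OF assms] E.module_axioms by (simp add: pic_module_def fgp_module_def)
qed

lemma pic_module_iff: "pic_module R E \<longleftrightarrow> invertible_module R E"
  using pic_module_imp_invertible invertible_imp_pic_module by blast

lemma ex_transported_module:
  fixes E :: "('a, 'e) module" and h :: "'e \<Rightarrow> 'f"
  assumes "module R E" "inj_on h (carrier E)"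
  shows "\<exists>M :: ('a, 'f) module. module R M \<and> mod_iso R E M"
proof -
  let ?k = "inv_into (carrier E) h"
  define M :: "('a, 'f) module" where "M =
    \<lparr>carrier = h ` carrier E, mult = undefined, one = undefined, zero = h \<zero>\<^bsub>E\<^esub>,
     add = (\<lambda>x y. h (?k x \<oplus>\<^bsub>E\<^esub> ?k y)), smult = (\<lambda>r x. h (r \<odot>\<^bsub>E\<^esub> ?k x))\<rparr>"
  have M: "carrier M = h ` carrier E" "\<zero>\<^bsub>M\<^esub> = h \<zero>\<^bsub>E\<^esub>"
      "\<And>x y. x \<in> carrier E \<Longrightarrow> y \<in> carrier E \<Longrightarrow> h x \<oplus>\<^bsub>M\<^esub> h y = h (x \<oplus>\<^bsub>E\<^esub> y)"
      "\<And>r x. x \<in> carrier E \<Longrightarrow> r \<odot>\<^bsub>M\<^esub> h x = h (r \<odot>\<^bsub>E\<^esub> x)"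
    using assms(2) by (simp_all add: M_def)
  have "module R M"
    by (rule module_surj_image[OF assms(1), of h]) (simp_all add: M)
  moreover have "mod_iso R E M"
    unfolding mod_iso_def using assms(2)
    by (intro bexI[of _ h] mod_homI) (simp_all add: M bij_betw_def)
  ultimately show ?thesis by blast
qed

text \<open>
  The coordinates of a vector in the retraction of \<open>invertible_retract\<close>, listed along an enumeration
  of the finite index set, embed \<open>E\<close> into the type \<open>nat \<Rightarrow> 'a\<close>.
\<close>

lemma ex_standard_copy:
  fixes E :: "('a, 'e) module"
  assumes "invertible_module R E"
  obtains M :: "('a, nat \<Rightarrow> 'a) module" where "invertible_module R M" "mod_iso R M E" "mod_iso R E M"
proof -
  have E: "module R E" using assms by (rule invertible_imp_module)
  obtain A :: "'e set" and \<iota> \<pi> where A: "finite A"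
    and \<iota>: "\<iota> \<in> mod_hom R E (free_module R A)" and \<pi>\<iota>: "\<And>x. x \<in> carrier E \<Longrightarrow> \<pi> (\<iota> x) = x"
    by (rule invertible_retract[OF assms]) blast
  obtain e :: "nat \<Rightarrow> 'e" and n where e: "A = e ` {i. i < n}"
    using finite_imp_nat_seg_image_inj_on[OF A] by blast
  define h where "h x = (\<lambda>k. \<iota> x (e k))" for x
  have "inj_on h (carrier E)"
  proof
    fix x y assume x: "x \<in> carrier E" and y: "y \<in> carrier E" and eq: "h x = h y"
    have "\<iota> x a = \<iota> y a" for a
    proof (cases "a \<in> A")
      case True
      then obtain k where "a = e k" using e by blast
      then show ?thesis using fun_cong[OF eq, of k] by (simp add: h_def)
    next
      case False
      then show ?thesis
        using mod_hom_closed[OF \<iota> x] mod_hom_closed[OF \<iota> y] by (simp add: free_module_carrier)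
    qed
    then have "\<iota> x = \<iota> y" by (rule ext)
    then show "x = y" using \<pi>\<iota> x y by metis
  qed
  from ex_transported_module[OF E this] obtain M :: "('a, nat \<Rightarrow> 'a) module"
    where M: "module R M" "mod_iso R E M" by blast
  from that[OF invertible_iso[OF assms M] mod_iso_sym[OF E M(2)] M(2)] show thesis .
qed

text \<open>
  Every endomorphism \<open>\<phi>\<close> is a scalar: \<open>f e \<phi> x = \<phi> (f x e) = f x \<phi> e = f (\<phi> e) x\<close>, so \<open>f e\<close> times
  \<open>\<phi>\<close> is multiplication by the scalar \<open>f (\<phi> e)\<close>, and \<open>invertible_induct\<close> applies.
\<close>

lemma invertible_pics_module:
  assumes "invertible_module R E"
  shows "pics_module R E"
proof -
  interpret E: module R E using assms by (rule invertible_imp_module)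
  let ?h = "\<lambda>r. \<lambda>x\<in>carrier E. r \<odot>\<^bsub>E\<^esub> x"
  let ?A = "End_alg R E"
  have closed: "?h r \<in> carrier ?A" if "r \<in> carrier R" for r
  proof -
    have "?h r \<in> mod_hom R E E"
    proof (rule mod_homI)
      fix s x assume "s \<in> carrier R" "x \<in> carrier E"
      then show "?h r (s \<odot>\<^bsub>E\<^esub> x) = s \<odot>\<^bsub>E\<^esub> ?h r x"
        using that by (simp add: E.smult_assoc1[symmetric] E.R.m_comm)
    qed (use that in \<open>simp_all add: E.smult_r_distr\<close>)
    then show ?thesis by (simp add: End_alg_def)
  qed
  have "?h \<in> ring_hom R ?A"
  proof (rule ring_hom_memI)
    fix r s assume "r \<in> carrier R" "s \<in> carrier R"
    then show "?h (r \<otimes>\<^bsub>R\<^esub> s) = ?h r \<otimes>\<^bsub>?A\<^esub> ?h s" "?h (r \<oplus>\<^bsub>R\<^esub> s) = ?h r \<oplus>\<^bsub>?A\<^esub> ?h s"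
      unfolding End_alg_def compose_def
      by (simp_all, intro restrict_ext, simp add: E.smult_assoc1)
        (intro restrict_ext, simp add: E.smult_l_distr)
  next
    show "?h \<one>\<^bsub>R\<^esub> = \<one>\<^bsub>?A\<^esub>"
      unfolding End_alg_def by (simp, intro restrict_ext, simp)
  qed (rule closed)
  moreover have "?h \<in> mod_hom R (self_module R) ?A"
  proof (rule mod_homI)
    fix r s assume "r \<in> carrier (self_module R)" "s \<in> carrier (self_module R)"
    then show "?h (r \<oplus>\<^bsub>self_module R\<^esub> s) = ?h r \<oplus>\<^bsub>?A\<^esub> ?h s"
      unfolding End_alg_def by (simp, intro restrict_ext, simp add: E.smult_l_distr)
  next
    fix r s assume "r \<in> carrier R" "s \<in> carrier (self_module R)"
    then show "?h (r \<odot>\<^bsub>self_module R\<^esub> s) = r \<odot>\<^bsub>?A\<^esub> ?h s"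
      unfolding End_alg_def by (simp, intro restrict_ext, simp add: E.smult_assoc1)
  qed (use closed in simp)
  moreover have "?h ` carrier R = carrier ?A"
  proof
    show "?h ` carrier R \<subseteq> carrier ?A" using closed by blast
    show "carrier ?A \<subseteq> ?h ` carrier R"
    proof
      fix \<phi> assume "\<phi> \<in> carrier ?A"
      then have \<phi>: "\<phi> \<in> mod_hom R E E" and ext: "\<phi> \<in> extensional (carrier E)"
        by (simp_all add: End_alg_def)
      note \<phi>c = mod_hom_closed[OF \<phi>]
      from assms have "\<exists>t\<in>carrier R. \<forall>x\<in>carrier E. \<one>\<^bsub>R\<^esub> \<odot>\<^bsub>E\<^esub> \<phi> x = t \<odot>\<^bsub>E\<^esub> x"
      proof (induction rule: invertible_induct)
        case (functional f e)
        note fc = exchange_closed[OF functional(1)]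
        have "f e \<odot>\<^bsub>E\<^esub> \<phi> x = f (\<phi> e) \<odot>\<^bsub>E\<^esub> x" if x: "x \<in> carrier E" for x
        proof -
          have "f e \<odot>\<^bsub>E\<^esub> \<phi> x = \<phi> (f e \<odot>\<^bsub>E\<^esub> x)"
            using mod_hom_smult[OF \<phi> fc[OF functional(2)] x] by simp
          also have "\<dots> = \<phi> (f x \<odot>\<^bsub>E\<^esub> e)"
            using exchange[OF functional(1,2) x] by simp
          also have "\<dots> = f x \<odot>\<^bsub>E\<^esub> \<phi> e"
            by (rule mod_hom_smult[OF \<phi> fc[OF x] functional(2)])
          also have "\<dots> = f (\<phi> e) \<odot>\<^bsub>E\<^esub> x"
            by (rule exchange[OF functional(1) x \<phi>c[OF functional(2)]])
          finally show ?thesis .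
        qed
        then show ?case using fc[OF \<phi>c[OF functional(2)]] by blast
      next
        case (add r s)
        obtain a where a: "a \<in> carrier R" "\<forall>x\<in>carrier E. r \<odot>\<^bsub>E\<^esub> \<phi> x = a \<odot>\<^bsub>E\<^esub> x"
          using add(3) by blast
        obtain b where b: "b \<in> carrier R" "\<forall>x\<in>carrier E. s \<odot>\<^bsub>E\<^esub> \<phi> x = b \<odot>\<^bsub>E\<^esub> x"
          using add(4) by blast
        show ?case
          using a b add(1,2) \<phi>c by (intro bexI[of _ "a \<oplus>\<^bsub>R\<^esub> b"]) (simp_all add: E.smult_l_distr)
      next
        case (mult r s)
        obtain b where b: "b \<in> carrier R" "\<forall>x\<in>carrier E. s \<odot>\<^bsub>E\<^esub> \<phi> x = b \<odot>\<^bsub>E\<^esub> x"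
          using mult(3) by blast
        show ?case
          using b mult(1,2) \<phi>c by (intro bexI[of _ "r \<otimes>\<^bsub>R\<^esub> b"]) (simp_all add: E.smult_assoc1)
      qed
      then obtain t where t: "t \<in> carrier R" "\<And>x. x \<in> carrier E \<Longrightarrow> \<phi> x = t \<odot>\<^bsub>E\<^esub> x"
        using \<phi>c by auto
      have "\<phi> = ?h t"
        by (rule extensionalityI[OF ext]) (simp_all add: t(2))
      then show "\<phi> \<in> ?h ` carrier R" using t(1) by blast
    qed
  qed
  ultimately show ?thesis
    using invertible_imp_pic_module[OF assms] unfolding pics_module_def pic_module_def
    by (intro conjI bexI[of _ ?h] IntI) simp_all
qed


section \<open>The Picard group\<close>

lemma mem_iso_class: "M \<in> iso_class R E \<longleftrightarrow> module R M \<and> mod_iso R M E"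
  by (simp add: iso_class_def)

lemma iso_class_eqI:
  assumes "module R E" "mod_iso R E F"
  shows "iso_class R E = iso_class R F"
  unfolding iso_class_def
  by (auto intro: mod_iso_trans[OF _ assms(2)] mod_iso_trans[OF _ mod_iso_sym[OF assms]])

lemma iso_class_invertible:
  assumes "M \<in> iso_class R E" "invertible_module R E"
  shows "invertible_module R M"
  using assms invertible_iso invertible_imp_module mod_iso_sym unfolding mem_iso_class by blast

lemma iso_class_nonempty:
  assumes "invertible_module R E"
  obtains M where "M \<in> iso_class R E" "invertible_module R M"
  using ex_standard_copy[OF assms] invertible_imp_module unfolding mem_iso_class by metis

lemma class_mult_eq:
  assumes "invertible_module R E" "invertible_module R F"
  shows "class_mult R (iso_class R E) (iso_class R F) = iso_class R (tensor R E F)"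
proof -
  have "iso_class R (tensor R M N) = iso_class R (tensor R E F)"
    if "M \<in> iso_class R E" "N \<in> iso_class R F" for M N
  proof -
    note M = iso_class_invertible[OF that(1) assms(1)] and N = iso_class_invertible[OF that(2) assms(2)]
    show ?thesis
      using that assms M N
      by (intro iso_class_eqI module_tensor tensor_cong) (simp_all add: mem_iso_class invertible_imp_module)
  qed
  moreover obtain M N where "M \<in> iso_class R E" "N \<in> iso_class R F"
    using iso_class_nonempty assms by metis
  ultimately show ?thesis
    unfolding class_mult_def by blast
qed

lemma Pic_carrier_iff:
  "X \<in> carrier (Pic R) \<longleftrightarrow>
    (\<exists>E :: ('a, nat \<Rightarrow> 'a) module. invertible_module R E \<and> X = iso_class (R :: 'a ring) E)"
  unfolding Pic_def by (auto simp: pic_module_iff)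

lemma Pic_simps [simp]: "mult (Pic R) = class_mult R" "one (Pic R) = iso_class R (self_module R)"
  by (simp_all add: Pic_def)

lemma iso_class_in_Pic:
  assumes "invertible_module R E"
  shows "iso_class R E \<in> carrier (Pic R)"
proof (rule ex_standard_copy[OF assms])
  fix M :: "('a, nat \<Rightarrow> 'a) module" assume M: "invertible_module R M" "mod_iso R E M"
  with iso_class_eqI[OF invertible_imp_module[OF assms] M(2)] show ?thesis
    unfolding Pic_carrier_iff by blast
qed

lemma group_Pic:
  assumes "cring R"
  shows "group (Pic R)"
proof (rule groupI)
  note self = invertible_self[OF assms]
  show "\<one>\<^bsub>Pic R\<^esub> \<in> carrier (Pic R)"
    using iso_class_in_Pic[OF self] by simp
  fix X assume "X \<in> carrier (Pic R)"
  then obtain E :: "('a, nat \<Rightarrow> 'a) module" where E: "invertible_module R E" "X = iso_class R E"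
    unfolding Pic_carrier_iff by blast
  note mE = invertible_imp_module[OF E(1)]
  show "\<one>\<^bsub>Pic R\<^esub> \<otimes>\<^bsub>Pic R\<^esub> X = X"
    using iso_class_eqI[OF module_tensor[OF invertible_imp_module[OF self] mE] tensor_self[OF E(1)]]
    by (simp add: E(2) class_mult_eq[OF self E(1)])
  note D = invertible_dual[OF E(1)]
  have "class_mult R (iso_class R (dual_module R E)) (iso_class R E) = iso_class R (self_module R)"
    using iso_class_eqI[OF module_tensor[OF invertible_imp_module[OF D] mE] tensor_dual[OF E(1)]]
    by (simp add: class_mult_eq[OF D E(1)])
  then show "\<exists>Y\<in>carrier (Pic R). Y \<otimes>\<^bsub>Pic R\<^esub> X = \<one>\<^bsub>Pic R\<^esub>"
    using iso_class_in_Pic[OF D] E(2) by (intro bexI[of _ "iso_class R (dual_module R E)"]) simp_all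
  fix Y assume "Y \<in> carrier (Pic R)"
  then obtain F :: "('a, nat \<Rightarrow> 'a) module" where F: "invertible_module R F" "Y = iso_class R F"
    unfolding Pic_carrier_iff by blast
  note EF = invertible_tensor[OF E(1) F(1)]
  show "X \<otimes>\<^bsub>Pic R\<^esub> Y \<in> carrier (Pic R)"
    using iso_class_in_Pic[OF EF] by (simp add: E(2) F(2) class_mult_eq[OF E(1) F(1)])
  fix Z assume "Z \<in> carrier (Pic R)"
  then obtain H :: "('a, nat \<Rightarrow> 'a) module" where H: "invertible_module R H" "Z = iso_class R H"
    unfolding Pic_carrier_iff by blast
  note FH = invertible_tensor[OF F(1) H(1)]
  show "X \<otimes>\<^bsub>Pic R\<^esub> Y \<otimes>\<^bsub>Pic R\<^esub> Z = X \<otimes>\<^bsub>Pic R\<^esub> (Y \<otimes>\<^bsub>Pic R\<^esub> Z)"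
    using iso_class_eqI[OF invertible_imp_module[OF invertible_tensor[OF EF H(1)]]
        tensor_assoc[OF E(1) F(1) H(1)]]
    by (simp add: E(2) F(2) H(2) class_mult_eq[OF E(1) F(1)] class_mult_eq[OF F(1) H(1)]
        class_mult_eq[OF EF H(1)] class_mult_eq[OF E(1) FH])
qed


section \<open>Base change\<close>

locale subring_extension = R?: cring R for R :: "'a ring" (structure) +
  fixes S :: "'a ring" and A :: "'a set"
  assumes S_eq: "S = R\<lparr>carrier := A\<rparr>" and S_cring: "cring S" and A_subset: "A \<subseteq> carrier R"
begin

lemma S_simps [simp]:
  "carrier S = A" "mult S = mult R" "add S = add R" "one S = \<one>" "zero S = \<zero>"
  by (simp_all add: S_eq)

lemma A_closed: "s \<in> A \<Longrightarrow> s \<in> carrier R"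
  using A_subset by blast

lemma module_restrict: "module R M \<Longrightarrow> module S M"
  using restrict_scalars[of R M A] S_cring A_subset by (simp add: S_eq)

lemma module_R_over_S: "module S (self_module R)"
  by (intro module_restrict module_self R.is_cring)

lemma base_change_simps [simp]:
  "carrier (base_change S R E) = carrier (tensor S (self_module R) E)"
  "add (base_change S R E) = add (tensor S (self_module R) E)"
  "zero (base_change S R E) = zero (tensor S (self_module R) E)"
  by (simp_all add: base_change_def Let_def)

abbreviation pt :: "('a, 'e) module \<Rightarrow> 'a \<Rightarrow> 'e \<Rightarrow> ('a \<times> 'e \<Rightarrow> 'a) set" where
  "pt E \<equiv> pure_tensor S (self_module R) E"

lemmas pt_facts = pure_tensor_facts[OF module_R_over_S, simplified]

text \<open>
  This makes the definite description in the definition of \<open>base_change\<close> meaningful.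
\<close>

lemma scaling_exists_unique:
  assumes E: "module S E" and r: "r \<in> carrier R"
  shows "\<exists>!h. h \<in> mod_hom S (tensor S (self_module R) E) (tensor S (self_module R) E) \<and>
    h \<in> extensional (carrier (tensor S (self_module R) E)) \<and>
    (\<forall>a\<in>carrier R. \<forall>x\<in>carrier E. h (pt E a x) = pt E (r \<otimes> a) x)"
proof -
  let ?T = "tensor S (self_module R) E"
  note SR = module_R_over_S
  interpret T: module S ?T by (rule module_tensor[OF SR E])
  note p = pt_facts[OF E]
  obtain h where h: "h \<in> mod_hom S ?T ?T"
      and hp: "\<And>a x. a \<in> carrier (self_module R) \<Longrightarrow> x \<in> carrier E \<Longrightarrow> h (pt E a x) = pt E (r \<otimes> a) x"
  proof (rule tensor_lift[OF SR E T.module_axioms, of "\<lambda>a x. pt E (r \<otimes> a) x"])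
    fix s a x assume "s \<in> carrier S" "a \<in> carrier (self_module R)" "x \<in> carrier E"
    then show "pt E (r \<otimes> (s \<odot>\<^bsub>self_module R\<^esub> a)) x = s \<odot>\<^bsub>?T\<^esub> pt E (r \<otimes> a) x"
      using r A_closed p(4)[of s "r \<otimes> a" x] by (simp add: m_lcomm)
  next
    fix a x assume "a \<in> carrier (self_module R)" "x \<in> carrier E"
    then show "pt E (r \<otimes> a) x \<in> carrier ?T"
      using r p(1) by simp
  next
    fix a a' x assume "a \<in> carrier (self_module R)" "a' \<in> carrier (self_module R)" "x \<in> carrier E"
    then show "pt E (r \<otimes> (a \<oplus>\<^bsub>self_module R\<^esub> a')) x = pt E (r \<otimes> a) x \<oplus>\<^bsub>?T\<^esub> pt E (r \<otimes> a') x"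
      using r p(2) by (simp add: R.r_distr)
  next
    fix a x x' assume "a \<in> carrier (self_module R)" "x \<in> carrier E" "x' \<in> carrier E"
    then show "pt E (r \<otimes> a) (x \<oplus>\<^bsub>E\<^esub> x') = pt E (r \<otimes> a) x \<oplus>\<^bsub>?T\<^esub> pt E (r \<otimes> a) x'"
      using r p(3) by simp
  next
    fix s a x assume "s \<in> carrier S" "a \<in> carrier (self_module R)" "x \<in> carrier E"
    then show "pt E (r \<otimes> a) (s \<odot>\<^bsub>E\<^esub> x) = s \<odot>\<^bsub>?T\<^esub> pt E (r \<otimes> a) x"
      using r p(5) by simp
  qed blast
  show ?thesis
  proof (intro ex1I[of _ "restrict h (carrier ?T)"] conjI ballI)
    show "restrict h (carrier ?T) \<in> mod_hom S ?T ?T"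
      by (rule mod_homI) (simp_all add: mod_hom_closed[OF h] mod_hom_add[OF h] mod_hom_smult[OF h, simplified])
    show "restrict h (carrier ?T) (pt E a x) = pt E (r \<otimes> a) x" if "a \<in> carrier R" "x \<in> carrier E" for a x
      using that p(1) hp by simp
  next
    fix k
    assume k: "k \<in> mod_hom S ?T ?T \<and> k \<in> extensional (carrier ?T) \<and>
      (\<forall>a\<in>carrier R. \<forall>x\<in>carrier E. k (pt E a x) = pt E (r \<otimes> a) x)"
    then have k1: "k \<in> mod_hom S ?T ?T" by blast
    have "k t = h t" if "t \<in> carrier ?T" for t
      using SR E that
    proof (induction rule: tensor_induct)
      case (pure a x)
      then show ?case using k hp by simp
    next
      case (add s t)
      then show ?case by (simp add: mod_hom_add[OF h] mod_hom_add[OF k1])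
    qed
    then show "k = restrict h (carrier ?T)"
      using k by (intro extensionalityI[of k "carrier ?T"]) simp_all
  qed simp
qed

lemma base_change_smult:
  assumes "module S E" "r \<in> carrier R"
  shows base_change_smult_hom:
      "(\<lambda>t. r \<odot>\<^bsub>base_change S R E\<^esub> t) \<in> mod_hom S (tensor S (self_module R) E) (tensor S (self_module R) E)"
    and base_change_smult_pure: "\<And>a x. a \<in> carrier R \<Longrightarrow> x \<in> carrier E \<Longrightarrow>
      r \<odot>\<^bsub>base_change S R E\<^esub> pt E a x = pt E (r \<otimes> a) x"
  using theI'[OF scaling_exists_unique[OF assms]] by (simp_all add: base_change_def Let_def)

lemma base_change_induct [consumes 2, case_names pure add]:
  assumes "module S E" "t \<in> carrier (base_change S R E)"
    and pure: "\<And>a x. a \<in> carrier R \<Longrightarrow> x \<in> carrier E \<Longrightarrow> P (pt E a x)"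
    and add: "\<And>s t. s \<in> carrier (base_change S R E) \<Longrightarrow> t \<in> carrier (base_change S R E) \<Longrightarrow>
      P s \<Longrightarrow> P t \<Longrightarrow> P (s \<oplus>\<^bsub>base_change S R E\<^esub> t)"
  shows "P t"
proof -
  have "t \<in> carrier (tensor S (self_module R) E)" using assms(2) by simp
  with module_R_over_S assms(1) show ?thesis
    by (induction rule: tensor_induct) (use pure add in simp_all)
qed

lemma module_base_change:
  assumes E: "module S E"
  shows "module R (base_change S R E)"
proof -
  let ?B = "base_change S R E" and ?T = "tensor S (self_module R) E"
  interpret T: module S ?T by (rule module_tensor[OF module_R_over_S E])
  note p = pt_facts[OF E]
  note sm = base_change_smult_pure[OF E]
  have ab: "abelian_group ?B"
  proof (rule abelian_groupI)
    fix x assume "x \<in> carrier ?B"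
    then show "\<exists>y\<in>carrier ?B. y \<oplus>\<^bsub>?B\<^esub> x = \<zero>\<^bsub>?B\<^esub>"
      using T.l_neg by (intro bexI[of _ "\<ominus>\<^bsub>?T\<^esub> x"]) simp_all
  qed (simp_all add: T.a_ac)
  have closed: "r \<odot>\<^bsub>?B\<^esub> t \<in> carrier ?B" if "r \<in> carrier R" "t \<in> carrier ?B" for r t
    using mod_hom_closed[OF base_change_smult_hom[OF E that(1)]] that(2) by simp
  have distr: "r \<odot>\<^bsub>?B\<^esub> (s \<oplus>\<^bsub>?B\<^esub> t) = r \<odot>\<^bsub>?B\<^esub> s \<oplus>\<^bsub>?B\<^esub> r \<odot>\<^bsub>?B\<^esub> t"
    if "r \<in> carrier R" "s \<in> carrier ?B" "t \<in> carrier ?B" for r s t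
    using mod_hom_add[OF base_change_smult_hom[OF E that(1)]] that(2,3) by simp
  interpret B: abelian_group ?B by (rule ab)
  show ?thesis
  proof (rule moduleI)
    fix a b x assume a: "a \<in> carrier R" and b: "b \<in> carrier R" and x: "x \<in> carrier ?B"
    from E x show "(a \<oplus> b) \<odot>\<^bsub>?B\<^esub> x = a \<odot>\<^bsub>?B\<^esub> x \<oplus>\<^bsub>?B\<^esub> b \<odot>\<^bsub>?B\<^esub> x"
    proof (induction rule: base_change_induct)
      case (pure c x)
      then show ?case using a b p(2) by (simp add: sm R.l_distr)
    next
      case (add s t)
      then show ?case using a b
        by (simp add: distr closed B.a_ac del: base_change_simps)
    qed
    from E x show "(a \<otimes> b) \<odot>\<^bsub>?B\<^esub> x = a \<odot>\<^bsub>?B\<^esub> (b \<odot>\<^bsub>?B\<^esub> x)"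
    proof (induction rule: base_change_induct)
      case (pure c x)
      then show ?case using a b by (simp add: sm m_assoc)
    next
      case (add s t)
      then show ?case using a b
        by (simp add: distr closed del: base_change_simps)
    qed
  next
    fix x assume x: "x \<in> carrier ?B"
    from E x show "\<one> \<odot>\<^bsub>?B\<^esub> x = x"
    proof (induction rule: base_change_induct)
      case (add s t)
      then show ?case by (simp add: distr del: base_change_simps)
    qed (simp add: sm)
  qed (fact R.is_cring ab closed distr)+
qed

lemma pt_base_change:
  assumes E: "module S E"
  shows "\<And>a x. a \<in> carrier R \<Longrightarrow> x \<in> carrier E \<Longrightarrow> pt E a x \<in> carrier (base_change S R E)"
    and "\<And>a x x'. a \<in> carrier R \<Longrightarrow> x \<in> carrier E \<Longrightarrow> x' \<in> carrier E \<Longrightarrow>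
      pt E a (x \<oplus>\<^bsub>E\<^esub> x') = pt E a x \<oplus>\<^bsub>base_change S R E\<^esub> pt E a x'"
    and "\<And>s a x. s \<in> A \<Longrightarrow> a \<in> carrier R \<Longrightarrow> x \<in> carrier E \<Longrightarrow>
      pt E a (s \<odot>\<^bsub>E\<^esub> x) = s \<odot>\<^bsub>base_change S R E\<^esub> pt E a x"
    and "\<And>r a x. r \<in> carrier R \<Longrightarrow> a \<in> carrier R \<Longrightarrow> x \<in> carrier E \<Longrightarrow>
      r \<odot>\<^bsub>base_change S R E\<^esub> pt E a x = pt E (r \<otimes> a) x"
proof -
  note p = pt_facts[OF E]
  show "pt E a x \<in> carrier (base_change S R E)" if "a \<in> carrier R" "x \<in> carrier E" for a x
    using p(1)[OF that] by simp
  show "pt E a (x \<oplus>\<^bsub>E\<^esub> x') = pt E a x \<oplus>\<^bsub>base_change S R E\<^esub> pt E a x'"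
    if "a \<in> carrier R" "x \<in> carrier E" "x' \<in> carrier E" for a x x'
    using p(3)[OF that] by simp
  show smult: "r \<odot>\<^bsub>base_change S R E\<^esub> pt E a x = pt E (r \<otimes> a) x"
    if "r \<in> carrier R" "a \<in> carrier R" "x \<in> carrier E" for r a x
    using base_change_smult_pure[OF E that] .
  show "pt E a (s \<odot>\<^bsub>E\<^esub> x) = s \<odot>\<^bsub>base_change S R E\<^esub> pt E a x"
    if "s \<in> A" "a \<in> carrier R" "x \<in> carrier E" for s a x
    using smult[OF A_closed[OF that(1)] that(2,3)] p(4)[OF that] p(5)[OF that] by simp
qed

text \<open>
  Base change is left adjoint to restriction of scalars.
\<close>

lemma base_change_lift:
  assumes E: "module S E" and H: "module R H" and \<gamma>: "\<gamma> \<in> mod_hom S E H"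
  obtains \<Phi> where "\<Phi> \<in> mod_hom R (base_change S R E) H"
    "\<And>a x. a \<in> carrier R \<Longrightarrow> x \<in> carrier E \<Longrightarrow> \<Phi> (pt E a x) = a \<odot>\<^bsub>H\<^esub> \<gamma> x"
proof -
  let ?B = "base_change S R E" and ?T = "tensor S (self_module R) E"
  interpret H: module R H by (rule H)
  interpret B: module R ?B by (rule module_base_change[OF E])
  note \<gamma>c = mod_hom_closed[OF \<gamma>]
  note p = pt_base_change[OF E]
  obtain \<Phi> where \<Phi>: "\<Phi> \<in> mod_hom S ?T H"
      and \<Phi>p: "\<And>a x. a \<in> carrier (self_module R) \<Longrightarrow> x \<in> carrier E \<Longrightarrow> \<Phi> (pt E a x) = a \<odot>\<^bsub>H\<^esub> \<gamma> x"
  proof (rule tensor_lift[OF module_R_over_S E module_restrict[OF H], of "\<lambda>a x. a \<odot>\<^bsub>H\<^esub> \<gamma> x"])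
    fix s a x assume "s \<in> carrier S" "a \<in> carrier (self_module R)" "x \<in> carrier E"
    then show "a \<odot>\<^bsub>H\<^esub> \<gamma> (s \<odot>\<^bsub>E\<^esub> x) = s \<odot>\<^bsub>H\<^esub> (a \<odot>\<^bsub>H\<^esub> \<gamma> x)"
      using A_closed \<gamma>c mod_hom_smult[OF \<gamma>, of s x] by (simp add: H.smult_assoc1[symmetric] m_comm)
  qed (simp_all add: \<gamma>c A_closed mod_hom_add[OF \<gamma>] H.smult_l_distr H.smult_r_distr H.smult_assoc1)
  have \<Phi>c: "\<Phi> t \<in> carrier H" if "t \<in> carrier ?B" for t
    using mod_hom_closed[OF \<Phi>] that by simp
  have \<Phi>a: "\<Phi> (s \<oplus>\<^bsub>?B\<^esub> t) = \<Phi> s \<oplus>\<^bsub>H\<^esub> \<Phi> t" if "s \<in> carrier ?B" "t \<in> carrier ?B" for s t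
    using mod_hom_add[OF \<Phi>] that by simp
  have "\<Phi> (r \<odot>\<^bsub>?B\<^esub> t) = r \<odot>\<^bsub>H\<^esub> \<Phi> t" if r: "r \<in> carrier R" and t: "t \<in> carrier ?B" for r t
    using E t
  proof (induction rule: base_change_induct)
    case (pure a x)
    then show ?case using r \<gamma>c by (simp add: p(4) \<Phi>p H.smult_assoc1)
  next
    case (add s t)
    then show ?case using r
      by (simp add: B.smult_r_distr \<Phi>a \<Phi>c H.smult_r_distr del: base_change_simps)
  qed
  then have "\<Phi> \<in> mod_hom R ?B H"
    using \<Phi>c \<Phi>a by (intro mod_homI)
  then show thesis
    by (rule that) (simp add: \<Phi>p)
qed

text \<open>
  An exchange functional \<open>f\<close> on \<open>E\<close> extends to \<open>a \<otimes> x \<mapsto> a f x\<close>, which takes the value \<open>f x\<close> at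
  \<open>1 \<otimes> x\<close>.
\<close>

lemma invertible_base_change:
  assumes "invertible_module S E"
  shows "invertible_module R (base_change S R E)"
proof -
  have E: "module S E" using assms by (rule invertible_imp_module)
  interpret E: module S E by (rule E)
  let ?B = "base_change S R E"
  interpret B: module R ?B by (rule module_base_change[OF E])
  note SM = module_self[OF R.is_cring]
  note p = pt_base_change[OF E]
  have one_E: "\<one> \<in> carrier R" by simp
  have ext: "\<exists>h\<in>exchange_functionals R ?B. \<forall>x\<in>carrier E. h (pt E \<one> x) = f x"
    if f: "f \<in> exchange_functionals S E" for f
  proof -
    have fA: "f x \<in> A" if "x \<in> carrier E" for x
      using exchange_closed[OF f that] by simp
    have fc: "f x \<in> carrier R" if "x \<in> carrier E" for x
      using fA[OF that] by (rule A_closed)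
    have f': "f \<in> mod_hom S E (self_module R)"
      by (rule mod_homI) (use fc exchange_add[OF f] exchange_smult[OF f] in simp_all)
    obtain h where h: "h \<in> mod_hom R ?B (self_module R)"
        and hp: "\<And>a x. a \<in> carrier R \<Longrightarrow> x \<in> carrier E \<Longrightarrow> h (pt E a x) = a \<odot>\<^bsub>self_module R\<^esub> f x"
      by (rule base_change_lift[OF E SM f']) blast
    have hc: "h t \<in> carrier R" if "t \<in> carrier ?B" for t
      using mod_hom_closed[OF h that] by simp
    have ha: "h (s \<oplus>\<^bsub>?B\<^esub> t) = h s \<oplus> h t" if "s \<in> carrier ?B" "t \<in> carrier ?B" for s t
      using mod_hom_add[OF h that] by simp
    have "h s \<odot>\<^bsub>?B\<^esub> t = h t \<odot>\<^bsub>?B\<^esub> s" if s: "s \<in> carrier ?B" and t: "t \<in> carrier ?B" for s t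
      using E s
    proof (induction rule: base_change_induct)
      case (pure a x)
      from E t show ?case
      proof (induction rule: base_change_induct)
        case (pure b y)
        note xy = \<open>x \<in> carrier E\<close> \<open>y \<in> carrier E\<close> and ab = \<open>a \<in> carrier R\<close> \<open>b \<in> carrier R\<close>
        have "h (pt E a x) \<odot>\<^bsub>?B\<^esub> pt E b y = f x \<odot>\<^bsub>?B\<^esub> pt E (a \<otimes> b) y"
          using xy ab fc by (simp add: hp p(4) m_ac)
        also have "\<dots> = pt E (a \<otimes> b) (f x \<odot>\<^bsub>E\<^esub> y)"
          using xy ab p(3)[OF fA] by simp
        also have "\<dots> = pt E (a \<otimes> b) (f y \<odot>\<^bsub>E\<^esub> x)"
          using exchange[OF f xy] by simp
        also have "\<dots> = f y \<odot>\<^bsub>?B\<^esub> pt E (a \<otimes> b) x"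
          using xy ab p(3)[OF fA] by simp
        also have "\<dots> = h (pt E b y) \<odot>\<^bsub>?B\<^esub> pt E a x"
          using xy ab fc by (simp add: hp p(4) m_ac)
        finally show ?case .
      next
        case (add s t)
        then show ?case
          using \<open>x \<in> carrier E\<close> \<open>a \<in> carrier R\<close>
          by (simp add: ha hc p(1) B.smult_l_distr B.smult_r_distr del: base_change_simps)
      qed
    next
      case (add u v)
      then show ?case
        using t by (simp add: ha hc B.smult_l_distr B.smult_r_distr del: base_change_simps)
    qed
    moreover have "h (r \<odot>\<^bsub>?B\<^esub> t) = r \<otimes> h t" if "r \<in> carrier R" "t \<in> carrier ?B" for r t
      using mod_hom_smult[OF h that] by simp
    ultimately have "h \<in> exchange_functionals R ?B"
      using hc ha by (intro exchangeI)
    then show ?thesis using hp fc by (intro bexI[of _ h]) simp_all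
  qed
  show ?thesis
  proof (rule invertibleI[OF B.module_axioms])
    fix I assume "ideal I R" and I: "\<And>f x. f \<in> exchange_functionals R ?B \<Longrightarrow> x \<in> carrier ?B \<Longrightarrow> f x \<in> I"
    interpret I: ideal I R by fact
    from assms have "\<one>\<^bsub>S\<^esub> \<in> I"
    proof (induction rule: invertible_induct)
      case (functional f x)
      obtain h where h: "h \<in> exchange_functionals R ?B" "h (pt E \<one> x) = f x"
        using ext[OF functional(1)] functional(2) by blast
      show ?case using I[OF h(1) p(1)[OF one_E functional(2)]] h(2) by simp
    qed (simp_all add: I.I_l_closed A_closed)
    then show "\<one> \<in> I" by simp
  qed
qed

lemma hom_onto_base_change:
  assumes "module R M" "module S E" and \<Phi>: "\<Phi> \<in> mod_hom R M (base_change S R E)"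
    and pure: "\<And>a x. a \<in> carrier R \<Longrightarrow> x \<in> carrier E \<Longrightarrow> pt E a x \<in> \<Phi> ` carrier M"
  shows "carrier (base_change S R E) \<subseteq> \<Phi> ` carrier M"
proof
  interpret M: module R M by fact
  fix t assume "t \<in> carrier (base_change S R E)"
  with assms(2) show "t \<in> \<Phi> ` carrier M"
  proof (induction rule: base_change_induct)
    case (add s t)
    then obtain a b where ab: "a \<in> carrier M" "s = \<Phi> a" "b \<in> carrier M" "t = \<Phi> b"
      by blast
    show ?case
      by (rule image_eqI[of _ _ "a \<oplus>\<^bsub>M\<^esub> b"]) (use ab mod_hom_add[OF \<Phi>, of a b] in simp_all)
  qed (rule pure)
qed

lemma base_change_cong:
  assumes "invertible_module S E" "module S E'" "mod_iso S E E'"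
  shows "mod_iso R (base_change S R E) (base_change S R E')"
proof -
  have E: "module S E" using assms(1) by (rule invertible_imp_module)
  note inv' = invertible_iso[OF assms]
  obtain \<phi> where \<phi>: "\<phi> \<in> mod_hom S E E'" "bij_betw \<phi> (carrier E) (carrier E')"
    using assms(3) unfolding mod_iso_def by blast
  let ?B' = "base_change S R E'"
  note B' = module_base_change[OF assms(2)]
  note p = pt_base_change[OF E] and p' = pt_base_change[OF assms(2)]
  have \<gamma>: "(\<lambda>x. pt E' \<one> (\<phi> x)) \<in> mod_hom S E ?B'"
    by (rule mod_homI)
      (use mod_hom_closed[OF \<phi>(1)] mod_hom_add[OF \<phi>(1)] mod_hom_smult[OF \<phi>(1)] in
        \<open>simp_all add: p' del: base_change_simps\<close>)
  obtain \<Phi> where \<Phi>: "\<Phi> \<in> mod_hom R (base_change S R E) ?B'"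
      and \<Phi>p: "\<And>a x. a \<in> carrier R \<Longrightarrow> x \<in> carrier E \<Longrightarrow> \<Phi> (pt E a x) = a \<odot>\<^bsub>?B'\<^esub> pt E' \<one> (\<phi> x)"
    by (rule base_change_lift[OF E B' \<gamma>]) blast
  show ?thesis
  proof (rule onto_imp_iso[OF invertible_base_change[OF assms(1)] invertible_base_change[OF inv'] \<Phi>])
    show "carrier ?B' \<subseteq> \<Phi> ` carrier (base_change S R E)"
    proof (rule hom_onto_base_change[OF module_base_change[OF E] assms(2) \<Phi>])
      fix a y assume a: "a \<in> carrier R" and "y \<in> carrier E'"
      then obtain x where x: "x \<in> carrier E" "y = \<phi> x"
        using \<phi>(2) unfolding bij_betw_def by blast
      have "pt E' a y = \<Phi> (pt E a x)"
        using a x mod_hom_closed[OF \<phi>(1)] by (simp add: \<Phi>p p'(4) del: base_change_simps)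
      then show "pt E' a y \<in> \<Phi> ` carrier (base_change S R E)"
        using p(1)[OF a x(1)] by (rule image_eqI)
    qed
  qed
qed

text \<open>
  The map is \<open>a \<otimes> (x \<otimes> y) \<mapsto> a ((1 \<otimes> x) \<otimes> (1 \<otimes> y))\<close>.
\<close>

lemma base_change_tensor:
  assumes "invertible_module S E" "invertible_module S F"
  shows "mod_iso R (base_change S R (tensor S E F)) (tensor R (base_change S R E) (base_change S R F))"
proof -
  have E: "module S E" and F: "module S F" using assms by (simp_all add: invertible_imp_module)
  let ?BE = "base_change S R E" and ?BF = "base_change S R F"
  let ?W = "tensor R ?BE ?BF" and ?EF = "tensor S E F"
  note BE = module_base_change[OF E] and BF = module_base_change[OF F]
  note W = module_tensor[OF BE BF] and EF = module_tensor[OF E F]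
  interpret W: module R ?W by (rule W)
  note pE = pt_base_change[OF E] and pF = pt_base_change[OF F] and pEF = pt_base_change[OF EF]
  note pW = pure_tensor_facts[OF BE BF] and pS = pure_tensor_facts[OF E F]
  let ?b = "\<lambda>x y. pure_tensor R ?BE ?BF (pt E \<one> x) (pt F \<one> y)"
  obtain \<gamma> where \<gamma>: "\<gamma> \<in> mod_hom S ?EF ?W"
      and \<gamma>p: "\<And>x y. x \<in> carrier E \<Longrightarrow> y \<in> carrier F \<Longrightarrow> \<gamma> (pure_tensor S E F x y) = ?b x y"
    by (rule tensor_lift[OF E F module_restrict[OF W], of ?b])
      (simp_all add: pE(1-3) pF(1-3) pW A_closed del: base_change_simps)
  obtain \<Phi> where \<Phi>: "\<Phi> \<in> mod_hom R (base_change S R ?EF) ?W"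
      and \<Phi>p: "\<And>a t. a \<in> carrier R \<Longrightarrow> t \<in> carrier ?EF \<Longrightarrow> \<Phi> (pt ?EF a t) = a \<odot>\<^bsub>?W\<^esub> \<gamma> t"
    by (rule base_change_lift[OF EF W \<gamma>]) blast
  let ?I = "\<Phi> ` carrier (base_change S R ?EF)"
  interpret BEF: module R "base_change S R ?EF" by (rule module_base_change[OF EF])
  have I_add: "v \<oplus>\<^bsub>?W\<^esub> w \<in> ?I" if "v \<in> ?I" "w \<in> ?I" for v w
  proof -
    from that(1) obtain a where a: "v = \<Phi> a" "a \<in> carrier (base_change S R ?EF)"
      by (rule imageE)
    from that(2) obtain b where b: "w = \<Phi> b" "b \<in> carrier (base_change S R ?EF)"
      by (rule imageE)
    show ?thesis
      by (rule image_eqI[of _ _ "a \<oplus>\<^bsub>base_change S R ?EF\<^esub> b"])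
        (use a b mod_hom_add[OF \<Phi>, of a b] BEF.a_closed in \<open>simp_all del: base_change_simps\<close>)
  qed
  show ?thesis
  proof (rule onto_imp_iso[OF invertible_base_change[OF invertible_tensor[OF assms]]
        invertible_tensor[OF invertible_base_change[OF assms(1)] invertible_base_change[OF assms(2)]] \<Phi>])
    show "carrier ?W \<subseteq> ?I"
    proof (rule hom_onto_tensor[OF BEF.module_axioms BE BF \<Phi>])
      fix v w assume v: "v \<in> carrier ?BE" and w: "w \<in> carrier ?BF"
      from E v show "pure_tensor R ?BE ?BF v w \<in> ?I"
      proof (induction rule: base_change_induct)
        case (pure a x)
        from F w show ?case
        proof (induction rule: base_change_induct)
          case (pure b y)
          note xy = \<open>x \<in> carrier E\<close> \<open>y \<in> carrier F\<close> and ab = \<open>a \<in> carrier R\<close> \<open>b \<in> carrier R\<close>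
          have "pure_tensor R ?BE ?BF (pt E a x) (pt F b y) =
              pure_tensor R ?BE ?BF (a \<odot>\<^bsub>?BE\<^esub> pt E \<one> x) (b \<odot>\<^bsub>?BF\<^esub> pt F \<one> y)"
            using xy ab by (simp add: pE(4) pF(4) del: base_change_simps)
          also have "\<dots> = a \<odot>\<^bsub>?W\<^esub> pure_tensor R ?BE ?BF (pt E \<one> x) (b \<odot>\<^bsub>?BF\<^esub> pt F \<one> y)"
            using xy ab pE(1) pF(1) module.smult_closed[OF BF] by (intro pW(4)) simp_all
          also have "\<dots> = a \<odot>\<^bsub>?W\<^esub> (b \<odot>\<^bsub>?W\<^esub> ?b x y)"
            using xy ab pE(1) pF(1) by (subst pW(5)) simp_all
          also have "\<dots> = (a \<otimes> b) \<odot>\<^bsub>?W\<^esub> ?b x y"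
            using xy ab pE(1) pF(1) pW(1) by (simp add: W.smult_assoc1 del: base_change_simps)
          also have "\<dots> = \<Phi> (pt ?EF (a \<otimes> b) (pure_tensor S E F x y))"
            using xy ab pS(1) by (simp add: \<Phi>p \<gamma>p)
          finally show ?case
            using pEF(1)[of "a \<otimes> b" "pure_tensor S E F x y"] pS(1)[OF xy] ab by (intro image_eqI) simp_all
        next
          case (add s t)
          then show ?case
            using I_add pure pE(1) by (simp add: pW(3) del: base_change_simps)
        qed
      next
        case (add s t)
        then show ?case
          using I_add w by (simp add: pW(2) del: base_change_simps)
      qed
    qed
  qed
qed

lemma phi2_iso_class:
  assumes "invertible_module S E"
  shows "phi2 S R (iso_class S E) = iso_class R (base_change S R E)"
proof -
  have E: "module S E" using assms by (rule invertible_imp_module)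
  have "iso_class R (base_change S R M) = iso_class R (base_change S R E)" if M: "M \<in> iso_class S E" for M
  proof -
    have M': "module S M" "mod_iso S M E" using M by (simp_all add: mem_iso_class)
    show ?thesis
      by (rule iso_class_eqI[OF module_base_change[OF M'(1)]
            base_change_cong[OF iso_class_invertible[OF M assms] E M'(2)]])
  qed
  moreover obtain M where "M \<in> iso_class S E"
    using iso_class_nonempty[OF assms] by blast
  ultimately show ?thesis
    unfolding phi2_def by blast
qed

end


section \<open>Modules and partial actions\<close>

text \<open>
  For an idempotent \<open>e\<close> this is the direct summand \<open>e E\<close>.
\<close>

definition corner :: "('a, 'e) module \<Rightarrow> 'a \<Rightarrow> ('a, 'e) module" where
  "corner E e = E\<lparr>carrier := {x \<in> carrier E. e \<odot>\<^bsub>E\<^esub> x = x}\<rparr>"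

lemma corner_simps [simp]:
  "carrier (corner E e) = {x \<in> carrier E. e \<odot>\<^bsub>E\<^esub> x = x}"
  "add (corner E e) = add E" "zero (corner E e) = zero E" "smult (corner E e) = smult E"
  by (simp_all add: corner_def)

lemma module_corner:
  assumes "module R E" "e \<in> carrier R"
  shows "module R (corner E e)"
proof -
  interpret E: module R E by fact
  have "submodule {x \<in> carrier E. e \<odot>\<^bsub>E\<^esub> x = x} R E"
    using assms(2)
    by (intro E.submoduleI) (auto simp: E.smult_r_distr E.smult_r_minus E.smult_assoc1[symmetric] E.R.m_comm,
        simp add: E.smult_assoc1)
  from submodule.submodule_is_module[OF this E.module_axioms] show ?thesis
    by (simp add: corner_def)
qed

lemma PIdl_idem:
  assumes "cring R" "e \<in> carrier R" "e \<otimes>\<^bsub>R\<^esub> e = e"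
  shows "PIdl\<^bsub>R\<^esub> e = {x \<in> carrier R. e \<otimes>\<^bsub>R\<^esub> x = x}"
proof -
  interpret R: cring R by fact
  have "e \<otimes>\<^bsub>R\<^esub> (x \<otimes>\<^bsub>R\<^esub> e) = x \<otimes>\<^bsub>R\<^esub> e" if "x \<in> carrier R" for x
    using that assms(2) by (subst R.m_lcomm) (simp_all add: assms(3))
  moreover have "\<exists>y\<in>carrier R. x = y \<otimes>\<^bsub>R\<^esub> e" if "x \<in> carrier R" "e \<otimes>\<^bsub>R\<^esub> x = x" for x
    using that assms(2) by (intro bexI[of _ x]) (simp_all add: R.m_comm)
  ultimately show ?thesis
    using assms(2) by (auto simp: cgenideal_def)
qed

lemma D_module_eq_corner:
  assumes "cring R" "e \<in> carrier R" "e \<otimes>\<^bsub>R\<^esub> e = e"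
  shows "D_module R e = corner (self_module R) e"
  by (simp add: D_module_def corner_def PIdl_idem[OF assms])

text \<open>
  The maps \<open>d \<otimes> x \<mapsto> d x\<close> and \<open>x \<mapsto> e \<otimes> x\<close> are inverse to each other.
\<close>

lemma tensor_D_module:
  assumes E: "module R E" and e: "e \<in> carrier R" "e \<otimes>\<^bsub>R\<^esub> e = e"
  shows "mod_iso R (tensor R (D_module R e) E) (corner E e)"
proof -
  interpret E: module R E by (rule E)
  let ?D = "D_module R e" and ?C = "corner E e"
  have D_eq: "?D = corner (self_module R) e"
    by (rule D_module_eq_corner[OF E.R.is_cring e])
  have D: "module R ?D"
    unfolding D_eq by (rule module_corner[OF module_self[OF E.R.is_cring] e(1)])
  have Dc: "d \<in> carrier ?D \<longleftrightarrow> d \<in> carrier R \<and> e \<otimes>\<^bsub>R\<^esub> d = d" for d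
    by (simp add: D_eq)
  have Dop: "add ?D = add R" "smult ?D = mult R"
    by (simp_all add: D_eq)
  note C = module_corner[OF E e(1)]
  let ?T = "tensor R ?D E"
  interpret T: module R ?T by (rule module_tensor[OF D E])
  note p = pure_tensor_facts[OF D E]
  have eD: "e \<in> carrier ?D" using e by (simp add: Dc)
  obtain \<Phi> where \<Phi>: "\<Phi> \<in> mod_hom R ?T ?C"
      and \<Phi>p: "\<And>d x. d \<in> carrier ?D \<Longrightarrow> x \<in> carrier E \<Longrightarrow> \<Phi> (pure_tensor R ?D E d x) = d \<odot>\<^bsub>E\<^esub> x"
  proof (rule tensor_lift[OF D E C, of "\<lambda>d x. d \<odot>\<^bsub>E\<^esub> x"])
    fix r d x assume "r \<in> carrier R" "d \<in> carrier ?D" "x \<in> carrier E"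
    then show "d \<odot>\<^bsub>E\<^esub> (r \<odot>\<^bsub>E\<^esub> x) = r \<odot>\<^bsub>?C\<^esub> (d \<odot>\<^bsub>E\<^esub> x)"
      by (simp add: Dc E.smult_assoc1[symmetric] E.R.m_comm)
  next
    fix d x assume "d \<in> carrier ?D" "x \<in> carrier E"
    then show "d \<odot>\<^bsub>E\<^esub> x \<in> carrier ?C"
      using e by (simp add: Dc E.smult_assoc1[symmetric])
  qed (simp_all add: Dc Dop E.smult_l_distr E.smult_r_distr E.smult_assoc1)
  have "bij_betw \<Phi> (carrier ?T) (carrier ?C)"
  proof (rule bij_betw_byWitness[where f' = "\<lambda>x. pure_tensor R ?D E e x"])
    show "\<forall>t\<in>carrier ?T. pure_tensor R ?D E e (\<Phi> t) = t"
    proof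
      fix t assume "t \<in> carrier ?T"
      with D E show "pure_tensor R ?D E e (\<Phi> t) = t"
      proof (induction rule: tensor_induct)
        case (pure d x)
        have d: "d \<in> carrier R" "e \<otimes>\<^bsub>R\<^esub> d = d" using pure(1) by (simp_all add: Dc)
        have "pure_tensor R ?D E e (d \<odot>\<^bsub>E\<^esub> x) = pure_tensor R ?D E (d \<odot>\<^bsub>?D\<^esub> e) x"
          using p(4)[OF d(1) eD pure(2)] p(5)[OF d(1) eD pure(2)] by simp
        also have "d \<odot>\<^bsub>?D\<^esub> e = d" using d e by (simp add: Dop E.R.m_comm)
        finally show ?case using \<Phi>p[OF pure] by simp
      next
        case (add s t)
        have "\<Phi> s \<in> carrier E" "\<Phi> t \<in> carrier E"
          using mod_hom_closed[OF \<Phi> add(1)] mod_hom_closed[OF \<Phi> add(2)] by simp_all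
        then show ?case
          using add p(3)[OF eD] mod_hom_add[OF \<Phi> add(1,2)] by simp
      qed
    qed
    show "\<forall>x\<in>carrier ?C. \<Phi> (pure_tensor R ?D E e x) = x"
      using \<Phi>p[OF eD] by simp
    show "\<Phi> ` carrier ?T \<subseteq> carrier ?C"
      using mod_hom_closed[OF \<Phi>] by blast
    show "(\<lambda>x. pure_tensor R ?D E e x) ` carrier ?C \<subseteq> carrier ?T"
      using p(1)[OF eD] by auto
  qed
  then show ?thesis
    unfolding mod_iso_def using \<Phi> by blast
qed


context unital_partial_action
begin

text \<open>
  The map \<open>\<alpha>\<^sub>g\<close>, extended from its domain to \<open>R\<close> by first multiplying with the idempotent of the
  domain.  It is additive and multiplicative on all of \<open>R\<close>, but maps \<open>1\<close> to \<open>u g\<close>.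
\<close>

definition act :: "'g \<Rightarrow> 'a \<Rightarrow> 'a" where
  "act g r = \<alpha> g (r \<otimes>\<^bsub>R\<^esub> u (inv\<^bsub>G\<^esub> g))"

lemma D_closed: "g \<in> carrier G \<Longrightarrow> r \<in> carrier R \<Longrightarrow> r \<otimes>\<^bsub>R\<^esub> u g \<in> PIdl\<^bsub>R\<^esub> (u g)"
  by (auto simp: cgenideal_def)

lemma act_facts:
  assumes g: "g \<in> carrier G"
  shows act_closed: "\<And>r. r \<in> carrier R \<Longrightarrow> act g r \<in> carrier R"
    and u_act: "\<And>r. r \<in> carrier R \<Longrightarrow> u g \<otimes>\<^bsub>R\<^esub> act g r = act g r"
    and act_add: "\<And>r s. r \<in> carrier R \<Longrightarrow> s \<in> carrier R \<Longrightarrow> act g (r \<oplus>\<^bsub>R\<^esub> s) = act g r \<oplus>\<^bsub>R\<^esub> act g s"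
    and act_mult: "\<And>r s. r \<in> carrier R \<Longrightarrow> s \<in> carrier R \<Longrightarrow> act g (r \<otimes>\<^bsub>R\<^esub> s) = act g r \<otimes>\<^bsub>R\<^esub> act g s"
    and act_one: "act g \<one>\<^bsub>R\<^esub> = u g"
    and act_inv_act: "\<And>r. r \<in> carrier R \<Longrightarrow> act (inv\<^bsub>G\<^esub> g) (act g r) = u (inv\<^bsub>G\<^esub> g) \<otimes>\<^bsub>R\<^esub> r"
proof -
  let ?h = "inv\<^bsub>G\<^esub> g"
  have h: "?h \<in> carrier G" using g by simp
  note uc = u_closed[OF g] u_closed[OF h] and ui = u_idem[OF g] u_idem[OF h]
  note Dg = PIdl_idem[OF R.is_cring uc(1) ui(1)]
  have hom: "\<alpha> g \<in> ring_hom (D_ring R (u ?h)) (D_ring R (u g))"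
    using \<alpha>_iso[OF g] by (simp add: ring_iso_def)
  have mem: "r \<otimes>\<^bsub>R\<^esub> u ?h \<in> carrier (D_ring R (u ?h))" if "r \<in> carrier R" for r
    using D_closed[OF h that] by (simp add: D_ring_def)
  have cl: "act g r \<in> PIdl\<^bsub>R\<^esub> (u g)" if "r \<in> carrier R" for r
    using ring_hom_closed[OF hom mem[OF that]] by (simp add: act_def D_ring_def)
  show c: "act g r \<in> carrier R" and uact: "u g \<otimes>\<^bsub>R\<^esub> act g r = act g r" if "r \<in> carrier R" for r
    using cl[OF that] unfolding Dg by simp_all
  show "act g (r \<oplus>\<^bsub>R\<^esub> s) = act g r \<oplus>\<^bsub>R\<^esub> act g s" if "r \<in> carrier R" "s \<in> carrier R" for r s
    using ring_hom_add[OF hom mem[OF that(1)] mem[OF that(2)]] that uc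
    by (simp add: act_def D_ring_def R.l_distr)
  show "act g (r \<otimes>\<^bsub>R\<^esub> s) = act g r \<otimes>\<^bsub>R\<^esub> act g s" if "r \<in> carrier R" "s \<in> carrier R" for r s
  proof -
    have "(r \<otimes>\<^bsub>R\<^esub> u ?h) \<otimes>\<^bsub>R\<^esub> (s \<otimes>\<^bsub>R\<^esub> u ?h) = (r \<otimes>\<^bsub>R\<^esub> s) \<otimes>\<^bsub>R\<^esub> (u ?h \<otimes>\<^bsub>R\<^esub> u ?h)"
      using that uc by (simp add: R.m_ac)
    then show ?thesis
      using ring_hom_mult[OF hom mem[OF that(1)] mem[OF that(2)]]
      by (simp add: act_def D_ring_def ui(2))
  qed
  show "act g \<one>\<^bsub>R\<^esub> = u g"
    using ring_hom_one[OF hom] uc by (simp add: act_def D_ring_def)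
  show "act ?h (act g r) = u ?h \<otimes>\<^bsub>R\<^esub> r" if r: "r \<in> carrier R" for r
  proof -
    let ?t = "r \<otimes>\<^bsub>R\<^esub> u ?h"
    have t: "?t \<in> carrier R" using r uc by simp
    have "?t \<otimes>\<^bsub>R\<^esub> \<one>\<^bsub>R\<^esub> \<in> ideal_prod R (PIdl\<^bsub>R\<^esub> (u ?h)) (PIdl\<^bsub>R\<^esub> (u (inv\<^bsub>G\<^esub> (?h \<otimes>\<^bsub>G\<^esub> g))))"
      using D_closed[OF h r] g by (intro ideal_prod.prod) (simp_all add: D_one)
    then have "?t \<in> ideal_prod R (PIdl\<^bsub>R\<^esub> (u ?h)) (PIdl\<^bsub>R\<^esub> (u (inv\<^bsub>G\<^esub> (?h \<otimes>\<^bsub>G\<^esub> g))))"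
      using t by simp
    from \<alpha>_mult[OF h g this] have "\<alpha> ?h (\<alpha> g ?t) = ?t"
      using g t \<alpha>_one by simp
    moreover have "act g r \<otimes>\<^bsub>R\<^esub> u g = act g r"
      using uact[OF r] c[OF r] uc by (simp add: R.m_comm)
    ultimately show ?thesis
      using g r uc by (simp add: act_def R.m_comm)
  qed
qed

lemma act_act_inv:
  assumes "g \<in> carrier G" "r \<in> carrier R"
  shows "act g (act (inv\<^bsub>G\<^esub> g) r) = u g \<otimes>\<^bsub>R\<^esub> r"
  using act_inv_act[of "inv\<^bsub>G\<^esub> g" r] assms by simp

abbreviation component :: "'g \<Rightarrow> ('a, 'e) module \<Rightarrow> 'e set" where
  "component g E \<equiv> {x \<in> carrier E. u g \<odot>\<^bsub>E\<^esub> x = x}"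

definition semilinear :: "'g \<Rightarrow> ('a, 'e) module \<Rightarrow> ('a, 'f) module \<Rightarrow> ('e \<Rightarrow> 'f) \<Rightarrow> bool" where
  "semilinear g E F \<theta> \<longleftrightarrow>
    (\<forall>x\<in>component (inv\<^bsub>G\<^esub> g) E. \<theta> x \<in> component g F) \<and>
    (\<forall>x\<in>component (inv\<^bsub>G\<^esub> g) E. \<forall>y\<in>component (inv\<^bsub>G\<^esub> g) E. \<theta> (x \<oplus>\<^bsub>E\<^esub> y) = \<theta> x \<oplus>\<^bsub>F\<^esub> \<theta> y) \<and>
    (\<forall>r\<in>carrier R. \<forall>x\<in>component (inv\<^bsub>G\<^esub> g) E. \<theta> (r \<odot>\<^bsub>E\<^esub> x) = act g r \<odot>\<^bsub>F\<^esub> \<theta> x)"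

lemma semilinearI:
  assumes "\<And>x. x \<in> component (inv\<^bsub>G\<^esub> g) E \<Longrightarrow> \<theta> x \<in> component g F"
    and "\<And>x y. x \<in> component (inv\<^bsub>G\<^esub> g) E \<Longrightarrow> y \<in> component (inv\<^bsub>G\<^esub> g) E \<Longrightarrow> \<theta> (x \<oplus>\<^bsub>E\<^esub> y) = \<theta> x \<oplus>\<^bsub>F\<^esub> \<theta> y"
    and "\<And>r x. r \<in> carrier R \<Longrightarrow> x \<in> component (inv\<^bsub>G\<^esub> g) E \<Longrightarrow> \<theta> (r \<odot>\<^bsub>E\<^esub> x) = act g r \<odot>\<^bsub>F\<^esub> \<theta> x"
  shows "semilinear g E F \<theta>"
  using assms unfolding semilinear_def by blast

lemma semilinearD:
  assumes "semilinear g E F \<theta>"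
  shows "\<And>x. x \<in> component (inv\<^bsub>G\<^esub> g) E \<Longrightarrow> \<theta> x \<in> carrier F"
    and "\<And>x. x \<in> component (inv\<^bsub>G\<^esub> g) E \<Longrightarrow> u g \<odot>\<^bsub>F\<^esub> \<theta> x = \<theta> x"
    and "\<And>x y. x \<in> component (inv\<^bsub>G\<^esub> g) E \<Longrightarrow> y \<in> component (inv\<^bsub>G\<^esub> g) E \<Longrightarrow> \<theta> (x \<oplus>\<^bsub>E\<^esub> y) = \<theta> x \<oplus>\<^bsub>F\<^esub> \<theta> y"
    and "\<And>r x. r \<in> carrier R \<Longrightarrow> x \<in> component (inv\<^bsub>G\<^esub> g) E \<Longrightarrow> \<theta> (r \<odot>\<^bsub>E\<^esub> x) = act g r \<odot>\<^bsub>F\<^esub> \<theta> x"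
  using assms unfolding semilinear_def by simp_all

text \<open>
  This rephrases, without tensor products, the isomorphism that is required at \<open>g\<close> of a module whose
  class is invariant; see \<open>twist_tensor_iff_transportable\<close>.
\<close>

definition transportable :: "'g \<Rightarrow> ('a, 'e) module \<Rightarrow> bool" where
  "transportable g E \<longleftrightarrow>
    (\<exists>\<theta>. semilinear g E E \<theta> \<and> bij_betw \<theta> (component (inv\<^bsub>G\<^esub> g) E) (component g E))"

lemma component_closed:
  assumes "module R E" "g \<in> carrier G"
  shows component_add: "\<And>x y. x \<in> component g E \<Longrightarrow> y \<in> component g E \<Longrightarrow> x \<oplus>\<^bsub>E\<^esub> y \<in> component g E"
    and component_smult: "\<And>r x. r \<in> carrier R \<Longrightarrow> x \<in> component g E \<Longrightarrow> r \<odot>\<^bsub>E\<^esub> x \<in> component g E"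
    and component_proj: "\<And>x. x \<in> carrier E \<Longrightarrow> u g \<odot>\<^bsub>E\<^esub> x \<in> component g E"
proof -
  interpret E: module R E by fact
  interpret C: module R "corner E (u g)" by (rule module_corner[OF assms(1) u_closed[OF assms(2)]])
  show "x \<oplus>\<^bsub>E\<^esub> y \<in> component g E" if "x \<in> component g E" "y \<in> component g E" for x y
    using C.a_closed[of x y] that by simp
  show "r \<odot>\<^bsub>E\<^esub> x \<in> component g E" if "r \<in> carrier R" "x \<in> component g E" for r x
    using C.smult_closed[of r x] that by simp
  show "u g \<odot>\<^bsub>E\<^esub> x \<in> component g E" if "x \<in> carrier E" for x
    using that u_closed[OF assms(2)] by (simp add: E.smult_assoc1[symmetric] u_idem[OF assms(2)])
qed

lemma semilinear_inverse:
  assumes E: "module R E" and F: "module R F" and g: "g \<in> carrier G" and \<theta>: "semilinear g E F \<theta>"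
    and bij: "bij_betw \<theta> (component (inv\<^bsub>G\<^esub> g) E) (component g F)"
  shows "semilinear (inv\<^bsub>G\<^esub> g) F E (inv_into (component (inv\<^bsub>G\<^esub> g) E) \<theta>)"
proof -
  interpret E: module R E by (rule E)
  interpret F: module R F by (rule F)
  let ?h = "inv\<^bsub>G\<^esub> g"
  let ?k = "inv_into (component ?h E) \<theta>"
  have h: "?h \<in> carrier G" using g by simp
  note \<theta>D = semilinearD[OF \<theta>]
  have im: "y \<in> \<theta> ` component ?h E" if "y \<in> component g F" for y
    using that unfolding bij_betw_imp_surj_on[OF bij] .
  note kc = inv_into_into[OF im] and \<theta>k = f_inv_into_f[OF im]
  have k\<theta>: "?k (\<theta> x) = x" if "x \<in> component ?h E" for x
    using that bij by (simp add: bij_betw_def)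
  show ?thesis
    unfolding semilinear_def G.inv_inv[OF g]
  proof (intro conjI ballI)
    fix x assume x: "x \<in> component g F"
    show "?k x \<in> component ?h E" by (rule kc[OF x])
    { fix y assume y: "y \<in> component g F"
      have "?k (\<theta> (?k x) \<oplus>\<^bsub>F\<^esub> \<theta> (?k y)) = ?k x \<oplus>\<^bsub>E\<^esub> ?k y"
        using \<theta>D(3)[OF kc[OF x] kc[OF y]] k\<theta>[OF component_add[OF E h kc[OF x] kc[OF y]]] by simp
      then show "?k (x \<oplus>\<^bsub>F\<^esub> y) = ?k x \<oplus>\<^bsub>E\<^esub> ?k y"
        by (simp only: \<theta>k[OF x] \<theta>k[OF y]) }
    { fix r assume r: "r \<in> carrier R"
      note r' = act_closed[OF h r]
      have "r \<odot>\<^bsub>F\<^esub> x = r \<odot>\<^bsub>F\<^esub> (u g \<odot>\<^bsub>F\<^esub> x)"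
        using x by simp
      also have "\<dots> = (r \<otimes>\<^bsub>R\<^esub> u g) \<odot>\<^bsub>F\<^esub> x"
        using x r u_closed[OF g] by (intro F.smult_assoc1[symmetric]) simp_all
      also have "r \<otimes>\<^bsub>R\<^esub> u g = act g (act ?h r)"
        using r u_closed[OF g] by (simp add: act_act_inv[OF g r] R.m_comm)
      also have "act g (act ?h r) \<odot>\<^bsub>F\<^esub> x = \<theta> (act ?h r \<odot>\<^bsub>E\<^esub> ?k x)"
        using \<theta>D(4)[OF r' kc[OF x]] \<theta>k[OF x] by simp
      finally show "?k (r \<odot>\<^bsub>F\<^esub> x) = act ?h r \<odot>\<^bsub>E\<^esub> ?k x"
        using k\<theta>[OF component_smult[OF E h r' kc[OF x]]] by simp }
  qed
qed

text \<open>
  The semilinear counterpart of \<open>onto_imp_iso\<close>.  The argument there shows that \<open>act g (f x) = 0\<close> for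
  \<open>x\<close> in the kernel; undoing \<open>act g\<close> loses only the idempotent of its domain, which fixes \<open>x\<close>.
\<close>

lemma semilinear_onto_imp_bij:
  assumes E: "invertible_module R E" and F: "invertible_module R F" and g: "g \<in> carrier G"
    and \<theta>: "semilinear g E F \<theta>" and onto: "component g F \<subseteq> \<theta> ` component (inv\<^bsub>G\<^esub> g) E"
  shows "bij_betw \<theta> (component (inv\<^bsub>G\<^esub> g) E) (component g F)"
proof -
  interpret E: module R E using E by (rule invertible_imp_module)
  interpret F: module R F using F by (rule invertible_imp_module)
  let ?h = "inv\<^bsub>G\<^esub> g"
  have h: "?h \<in> carrier G" using g by simp
  note \<theta>D = semilinearD[OF \<theta>]
  note uc = u_closed[OF g] u_closed[OF h]
  have ker: "x = \<zero>\<^bsub>E\<^esub>" if x: "x \<in> component ?h E" and 0: "\<theta> x = \<zero>\<^bsub>F\<^esub>" for x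
  proof (rule invertible_separating[OF E])
    show xE: "x \<in> carrier E" using x by simp
    fix f assume f: "f \<in> exchange_functionals R E"
    note fc = exchange_closed[OF f]
    have fx: "f x \<in> carrier R" using fc xE by simp
    have "act g (f x) \<odot>\<^bsub>F\<^esub> z = \<zero>\<^bsub>F\<^esub>" if z: "z \<in> carrier F" for z
    proof -
      from component_proj[OF F.module_axioms g z] onto obtain y where y: "y \<in> component ?h E" "u g \<odot>\<^bsub>F\<^esub> z = \<theta> y"
        by auto
      have yE: "y \<in> carrier E" using y by simp
      have "act g (f x) \<odot>\<^bsub>F\<^esub> z = act g (f x) \<odot>\<^bsub>F\<^esub> (u g \<odot>\<^bsub>F\<^esub> z)"
        using z uc u_act[OF g fx] act_closed[OF g fx] by (simp add: F.smult_assoc1[symmetric] R.m_comm)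
      also have "\<dots> = \<theta> (f x \<odot>\<^bsub>E\<^esub> y)"
        using \<theta>D(4)[OF fx y(1)] y(2) by simp
      also have "\<dots> = \<theta> (f y \<odot>\<^bsub>E\<^esub> x)"
        using exchange[OF f xE yE] by simp
      also have "\<dots> = \<zero>\<^bsub>F\<^esub>"
        using \<theta>D(4)[OF fc[OF yE] x] 0 act_closed[OF g fc[OF yE]] by simp
      finally show ?thesis .
    qed
    from invertible_faithful[OF F act_closed[OF g fx] this] have 0: "act g (f x) = \<zero>\<^bsub>R\<^esub>" .
    have "act ?h \<zero>\<^bsub>R\<^esub> = \<zero>\<^bsub>R\<^esub>"
      using act_add[OF h R.zero_closed R.zero_closed] act_closed[OF h R.zero_closed]
      by (simp add: R.add.l_cancel_one')
    with 0 act_inv_act[OF g fx] have "u ?h \<otimes>\<^bsub>R\<^esub> f x = \<zero>\<^bsub>R\<^esub>" by simp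
    then show "f x = \<zero>\<^bsub>R\<^esub>"
      using exchange_smult[OF f uc(2) xE] x by simp
  qed
  have "inj_on \<theta> (component ?h E)"
  proof
    fix x y assume x: "x \<in> component ?h E" and y: "y \<in> component ?h E" and eq: "\<theta> x = \<theta> y"
    let ?m = "\<ominus>\<^bsub>R\<^esub> \<one>\<^bsub>R\<^esub>"
    have m: "?m \<in> carrier R" by simp
    let ?z = "x \<oplus>\<^bsub>E\<^esub> ?m \<odot>\<^bsub>E\<^esub> y"
    note my = component_smult[OF E.module_axioms h m y]
    note z = component_add[OF E.module_axioms h x my]
    have 0: "x \<oplus>\<^bsub>E\<^esub> ?m \<odot>\<^bsub>E\<^esub> x = \<zero>\<^bsub>E\<^esub>"
      using x by (simp add: E.smult_l_minus E.r_neg)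
    have "\<theta> ?z = \<theta> (x \<oplus>\<^bsub>E\<^esub> ?m \<odot>\<^bsub>E\<^esub> x)"
      using \<theta>D(3)[OF x my] \<theta>D(3)[OF x component_smult[OF E.module_axioms h m x]] \<theta>D(4)[OF m x] \<theta>D(4)[OF m y] eq
      by simp
    also have "\<dots> = \<theta> (\<zero>\<^bsub>R\<^esub> \<odot>\<^bsub>E\<^esub> x)"
      unfolding 0 using x by simp
    also have "\<dots> = act g \<zero>\<^bsub>R\<^esub> \<odot>\<^bsub>F\<^esub> \<theta> x"
      by (rule \<theta>D(4)[OF R.zero_closed x])
    also have "act g \<zero>\<^bsub>R\<^esub> = \<zero>\<^bsub>R\<^esub>"
      using act_add[OF g R.zero_closed R.zero_closed] act_closed[OF g R.zero_closed]
      by (simp add: R.add.l_cancel_one')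
    finally have "\<theta> ?z = \<zero>\<^bsub>F\<^esub>"
      using \<theta>D(1)[OF x] by simp
    from ker[OF z this] have "?z = \<zero>\<^bsub>E\<^esub>" .
    moreover have "x = ?z \<oplus>\<^bsub>E\<^esub> y"
      using x y by (simp add: E.smult_l_minus E.a_assoc E.l_neg)
    ultimately show "x = y" using y by simp
  qed
  moreover have "\<theta> ` component ?h E = component g F"
  proof (rule equalityI[OF image_subsetI onto])
    show "\<theta> x \<in> component g F" if "x \<in> component ?h E" for x
      using \<theta>D(1,2)[OF that] by simp
  qed
  ultimately show ?thesis
    by (simp add: bij_betw_def)
qed

lemma transportableI:
  assumes "invertible_module R E" "g \<in> carrier G" "semilinear g E E \<theta>"
    and "\<And>y. y \<in> component g E \<Longrightarrow> y \<in> \<theta> ` component (inv\<^bsub>G\<^esub> g) E"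
  shows "transportable g E"
  unfolding transportable_def
  using semilinear_onto_imp_bij[OF assms(1,1,2,3)] assms(3,4) by blast

lemma transportableE:
  assumes "transportable g E" "module R E" "g \<in> carrier G"
  obtains \<theta> \<theta>' where "semilinear g E E \<theta>" "semilinear (inv\<^bsub>G\<^esub> g) E E \<theta>'"
    "\<And>x. x \<in> component (inv\<^bsub>G\<^esub> g) E \<Longrightarrow> \<theta>' (\<theta> x) = x" "\<And>x. x \<in> component g E \<Longrightarrow> \<theta> (\<theta>' x) = x"
proof -
  obtain \<theta> where \<theta>: "semilinear g E E \<theta>" "bij_betw \<theta> (component (inv\<^bsub>G\<^esub> g) E) (component g E)"
    using assms(1) unfolding transportable_def by blast
  show thesis
  proof (rule that[OF \<theta>(1) semilinear_inverse[OF assms(2,2,3) \<theta>]])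
    show "inv_into (component (inv\<^bsub>G\<^esub> g) E) \<theta> (\<theta> x) = x" if "x \<in> component (inv\<^bsub>G\<^esub> g) E" for x
      using \<theta>(2) that unfolding bij_betw_def by (intro inv_into_f_f) simp_all
    show "\<theta> (inv_into (component (inv\<^bsub>G\<^esub> g) E) \<theta> x) = x" if "x \<in> component g E" for x
      using \<theta>(2) that unfolding bij_betw_def by (intro f_inv_into_f) blast
  qed
qed


lemma transportable_iso:
  assumes E: "invertible_module R E" and F: "module R F" and iso: "mod_iso R E F"
    and g: "g \<in> carrier G" and tr: "transportable g E"
  shows "transportable g F"
proof -
  have mE: "module R E" using E by (rule invertible_imp_module)
  let ?h = "inv\<^bsub>G\<^esub> g"
  have h: "?h \<in> carrier G" using g by simp
  obtain \<phi> where \<phi>: "\<phi> \<in> mod_hom R E F" and bij: "bij_betw \<phi> (carrier E) (carrier F)"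
    using iso unfolding mod_iso_def by blast
  let ?\<psi> = "inv_into (carrier E) \<phi>"
  have \<psi>: "?\<psi> \<in> mod_hom R F E" by (rule mod_hom_inverse[OF mE \<phi> bij])
  have \<phi>\<psi>: "\<phi> (?\<psi> y) = y" if "y \<in> carrier F" for y
    using that bij by (simp add: bij_betw_def f_inv_into_f)
  have \<psi>\<phi>: "?\<psi> (\<phi> x) = x" if "x \<in> carrier E" for x
    using that bij by (simp add: bij_betw_def)
  have \<psi>C: "?\<psi> y \<in> component k E" if "y \<in> component k F" "k \<in> carrier G" for y k
    using that mod_hom_closed[OF \<psi>, of y] mod_hom_smult[OF \<psi> u_closed[OF that(2)], of y] by simp
  have \<phi>C: "\<phi> x \<in> component k F" if "x \<in> component k E" "k \<in> carrier G" for x k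
    using that mod_hom_closed[OF \<phi>, of x] mod_hom_smult[OF \<phi> u_closed[OF that(2)], of x] by simp
  obtain \<theta> \<theta>' where \<theta>: "semilinear g E E \<theta>" and \<theta>': "semilinear ?h E E \<theta>'"
      and inverse: "\<And>x. x \<in> component ?h E \<Longrightarrow> \<theta>' (\<theta> x) = x" "\<And>x. x \<in> component g E \<Longrightarrow> \<theta> (\<theta>' x) = x"
    by (rule transportableE[OF tr mE g]) blast
  note \<theta>D = semilinearD[OF \<theta>] and \<theta>'D = semilinearD[OF \<theta>', unfolded G.inv_inv[OF g]]
  have \<theta>C: "\<theta> x \<in> component g E" if "x \<in> component ?h E" for x
    using \<theta>D(1,2)[OF that] by simp
  have \<theta>'C: "\<theta>' x \<in> component ?h E" if "x \<in> component g E" for x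
    using \<theta>'D(1,2)[OF that] by simp
  show ?thesis
  proof (rule transportableI[OF invertible_iso[OF E F iso] g])
    show "semilinear g F F (\<lambda>y. \<phi> (\<theta> (?\<psi> y)))"
    proof (rule semilinearI)
      fix x assume x: "x \<in> component ?h F"
      note x' = \<psi>C[OF x h]
      show "\<phi> (\<theta> (?\<psi> x)) \<in> component g F"
        by (rule \<phi>C[OF \<theta>C[OF x'] g])
      { fix y assume y: "y \<in> component ?h F"
        note y' = \<psi>C[OF y h]
        have "?\<psi> (x \<oplus>\<^bsub>F\<^esub> y) = ?\<psi> x \<oplus>\<^bsub>E\<^esub> ?\<psi> y"
          using mod_hom_add[OF \<psi>] x y by simp
        then show "\<phi> (\<theta> (?\<psi> (x \<oplus>\<^bsub>F\<^esub> y))) = \<phi> (\<theta> (?\<psi> x)) \<oplus>\<^bsub>F\<^esub> \<phi> (\<theta> (?\<psi> y))"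
          using \<theta>D(3)[OF x' y'] mod_hom_add[OF \<phi> \<theta>D(1)[OF x'] \<theta>D(1)[OF y']] by simp }
      { fix r assume r: "r \<in> carrier R"
        have "?\<psi> (r \<odot>\<^bsub>F\<^esub> x) = r \<odot>\<^bsub>E\<^esub> ?\<psi> x"
          using mod_hom_smult[OF \<psi> r] x by simp
        then show "\<phi> (\<theta> (?\<psi> (r \<odot>\<^bsub>F\<^esub> x))) = act g r \<odot>\<^bsub>F\<^esub> \<phi> (\<theta> (?\<psi> x))"
          using \<theta>D(4)[OF r x'] mod_hom_smult[OF \<phi> act_closed[OF g r] \<theta>D(1)[OF x']] by simp }
    qed
    fix y assume y: "y \<in> component g F"
    note x = \<theta>'C[OF \<psi>C[OF y g]]
    have "?\<psi> (\<phi> (\<theta>' (?\<psi> y))) = \<theta>' (?\<psi> y)"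
      using x by (intro \<psi>\<phi>) simp
    then have "y = \<phi> (\<theta> (?\<psi> (\<phi> (\<theta>' (?\<psi> y)))))"
      using inverse(2)[OF \<psi>C[OF y g]] \<phi>\<psi> y by simp
    then show "y \<in> (\<lambda>y. \<phi> (\<theta> (?\<psi> y))) ` component ?h F"
      using \<phi>C[OF x h] by (rule image_eqI)
  qed
qed

lemma transportable_self:
  assumes g: "g \<in> carrier G"
  shows "transportable g (self_module R)"
proof (rule transportableI[OF invertible_self[OF R.is_cring] g])
  let ?h = "inv\<^bsub>G\<^esub> g"
  have h: "?h \<in> carrier G" using g by simp
  show "semilinear g (self_module R) (self_module R) (act g)"
    by (rule semilinearI) (simp_all add: act_closed[OF g] u_act[OF g] act_add[OF g] act_mult[OF g])
  fix y assume y: "y \<in> component g (self_module R)"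
  then have "y = act g (act ?h y)"
    using act_act_inv[OF g, of y] by simp
  moreover have "act ?h y \<in> component ?h (self_module R)"
    using y act_closed[OF h, of y] u_act[OF h, of y] by simp
  ultimately show "y \<in> act g ` component ?h (self_module R)"
    by (rule image_eqI)
qed

text \<open>
  With the scalars acting through \<open>act g\<close> on the summand on which \<open>u g\<close> is the identity, semilinear
  maps into \<open>M\<close> become homomorphisms, and the universal properties apply to them.
\<close>

definition twisted :: "'g \<Rightarrow> ('a, 'e) module \<Rightarrow> ('a, 'e) module" where
  "twisted g M = M\<lparr>carrier := component g M, smult := \<lambda>r x. act g r \<odot>\<^bsub>M\<^esub> x\<rparr>"

lemma twisted_simps [simp]:
  "carrier (twisted g M) = component g M" "add (twisted g M) = add M" "zero (twisted g M) = zero M"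
  "smult (twisted g M) = (\<lambda>r x. act g r \<odot>\<^bsub>M\<^esub> x)"
  by (simp_all add: twisted_def)

lemma module_twisted:
  assumes "module R M" "g \<in> carrier G"
  shows "module R (twisted g M)"
proof -
  interpret M: module R M by fact
  interpret C: module R "corner M (u g)" by (rule module_corner[OF assms(1) u_closed[OF assms(2)]])
  note ac = act_closed[OF assms(2)]
  show ?thesis
  proof (rule moduleI)
    show "abelian_group (twisted g M)"
    proof (rule abelian_groupI)
      fix x assume x: "x \<in> carrier (twisted g M)"
      then show "\<exists>y\<in>carrier (twisted g M). y \<oplus>\<^bsub>twisted g M\<^esub> x = \<zero>\<^bsub>twisted g M\<^esub>"
        using C.l_neg[of x] C.a_inv_closed[of x] by auto
    qed (use C.a_closed C.zero_closed in \<open>simp_all add: M.a_ac\<close>)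
  next
    fix a x assume "a \<in> carrier R" "x \<in> carrier (twisted g M)"
    then show "a \<odot>\<^bsub>twisted g M\<^esub> x \<in> carrier (twisted g M)"
      using C.smult_closed[OF ac] by simp
  next
    fix x assume "x \<in> carrier (twisted g M)"
    then show "\<one>\<^bsub>R\<^esub> \<odot>\<^bsub>twisted g M\<^esub> x = x"
      by (simp add: act_one[OF assms(2)])
  qed (simp_all add: R.is_cring ac act_add[OF assms(2)] act_mult[OF assms(2)]
      M.smult_l_distr M.smult_r_distr M.smult_assoc1)
qed

lemma semilinear_of_hom:
  assumes "\<Phi> \<in> mod_hom R E (twisted g M)"
  shows "semilinear g E M \<Phi>"
proof (rule semilinearI)
  show "\<Phi> x \<in> component g M" if "x \<in> component (inv\<^bsub>G\<^esub> g) E" for x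
    using mod_hom_closed[OF assms, of x] that by simp
  show "\<Phi> (x \<oplus>\<^bsub>E\<^esub> y) = \<Phi> x \<oplus>\<^bsub>M\<^esub> \<Phi> y"
    if "x \<in> component (inv\<^bsub>G\<^esub> g) E" "y \<in> component (inv\<^bsub>G\<^esub> g) E" for x y
    using mod_hom_add[OF assms, of x y] that by simp
  show "\<Phi> (r \<odot>\<^bsub>E\<^esub> x) = act g r \<odot>\<^bsub>M\<^esub> \<Phi> x"
    if "r \<in> carrier R" "x \<in> component (inv\<^bsub>G\<^esub> g) E" for r x
    using mod_hom_smult[OF assms, of r x] that by simp
qed

text \<open>
  The tensor product of the two semilinear bijections, each precomposed with the projection to the
  summand on which it is defined, is a homomorphism into a twisted module.
\<close>

lemma transportable_tensor:
  assumes E: "invertible_module R E" and F: "invertible_module R F" and g: "g \<in> carrier G"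
    and trE: "transportable g E" and trF: "transportable g F"
  shows "transportable g (tensor R E F)"
proof -
  have mE: "module R E" and mF: "module R F" using E F by (simp_all add: invertible_imp_module)
  interpret E: module R E by (rule mE)
  interpret F: module R F by (rule mF)
  let ?T = "tensor R E F" and ?p = "pure_tensor R E F"
  interpret T: module R ?T by (rule module_tensor[OF mE mF])
  note p = pure_tensor_facts[OF mE mF]
  let ?h = "inv\<^bsub>G\<^esub> g"
  have h: "?h \<in> carrier G" using g by simp
  note uc = u_closed[OF g] u_closed[OF h]
  obtain \<theta> \<theta>' where \<theta>: "semilinear g E E \<theta>" and \<theta>': "semilinear ?h E E \<theta>'"
      and E_inv: "\<And>x. x \<in> component g E \<Longrightarrow> \<theta> (\<theta>' x) = x"
    by (rule transportableE[OF trE mE g]) blast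
  obtain \<eta> \<eta>' where \<eta>: "semilinear g F F \<eta>" and \<eta>': "semilinear ?h F F \<eta>'"
      and F_inv: "\<And>x. x \<in> component g F \<Longrightarrow> \<eta> (\<eta>' x) = x"
    by (rule transportableE[OF trF mF g]) blast
  note \<theta>D = semilinearD[OF \<theta>] and \<theta>'D = semilinearD[OF \<theta>', unfolded G.inv_inv[OF g]]
  note \<eta>D = semilinearD[OF \<eta>] and \<eta>'D = semilinearD[OF \<eta>', unfolded G.inv_inv[OF g]]
  note PE = component_proj[OF mE h] and PF = component_proj[OF mF h]
  let ?\<theta> = "\<lambda>x. \<theta> (u ?h \<odot>\<^bsub>E\<^esub> x)" and ?\<eta> = "\<lambda>y. \<eta> (u ?h \<odot>\<^bsub>F\<^esub> y)"
  have \<theta>c: "?\<theta> x \<in> carrier E" "u g \<odot>\<^bsub>E\<^esub> ?\<theta> x = ?\<theta> x" if "x \<in> carrier E" for x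
    using \<theta>D(1,2)[OF PE[OF that]] by simp_all
  have \<eta>c: "?\<eta> y \<in> carrier F" "u g \<odot>\<^bsub>F\<^esub> ?\<eta> y = ?\<eta> y" if "y \<in> carrier F" for y
    using \<eta>D(1,2)[OF PF[OF that]] by simp_all
  have \<theta>a: "?\<theta> (x \<oplus>\<^bsub>E\<^esub> y) = ?\<theta> x \<oplus>\<^bsub>E\<^esub> ?\<theta> y" if "x \<in> carrier E" "y \<in> carrier E" for x y
    using \<theta>D(3)[OF PE[OF that(1)] PE[OF that(2)]] that uc by (simp add: E.smult_r_distr)
  have \<eta>a: "?\<eta> (x \<oplus>\<^bsub>F\<^esub> y) = ?\<eta> x \<oplus>\<^bsub>F\<^esub> ?\<eta> y" if "x \<in> carrier F" "y \<in> carrier F" for x y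
    using \<eta>D(3)[OF PF[OF that(1)] PF[OF that(2)]] that uc by (simp add: F.smult_r_distr)
  have \<theta>s: "?\<theta> (r \<odot>\<^bsub>E\<^esub> x) = act g r \<odot>\<^bsub>E\<^esub> ?\<theta> x" if "r \<in> carrier R" "x \<in> carrier E" for r x
    using \<theta>D(4)[OF that(1) PE[OF that(2)]] that uc by (simp add: E.smult_assoc1[symmetric] R.m_comm)
  have \<eta>s: "?\<eta> (r \<odot>\<^bsub>F\<^esub> x) = act g r \<odot>\<^bsub>F\<^esub> ?\<eta> x" if "r \<in> carrier R" "x \<in> carrier F" for r x
    using \<eta>D(4)[OF that(1) PF[OF that(2)]] that uc by (simp add: F.smult_assoc1[symmetric] R.m_comm)
  note N = module_twisted[OF T.module_axioms g]
  obtain \<Phi> where \<Phi>: "\<Phi> \<in> mod_hom R ?T (twisted g ?T)"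
      and \<Phi>p: "\<And>x y. x \<in> carrier E \<Longrightarrow> y \<in> carrier F \<Longrightarrow> \<Phi> (?p x y) = ?p (?\<theta> x) (?\<eta> y)"
  proof (rule tensor_lift[OF mE mF N, of "\<lambda>x y. ?p (?\<theta> x) (?\<eta> y)"])
    fix x y assume x: "x \<in> carrier E" and y: "y \<in> carrier F"
    have "u g \<odot>\<^bsub>?T\<^esub> ?p (?\<theta> x) (?\<eta> y) = ?p (?\<theta> x) (?\<eta> y)"
      using p(4)[OF uc(1) \<theta>c(1)[OF x] \<eta>c(1)[OF y]] \<theta>c(2)[OF x] by simp
    then show "?p (?\<theta> x) (?\<eta> y) \<in> carrier (twisted g ?T)"
      using p(1)[OF \<theta>c(1)[OF x] \<eta>c(1)[OF y]] by simp
  next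
    fix r x y assume r: "r \<in> carrier R" and x: "x \<in> carrier E" and y: "y \<in> carrier F"
    show "?p (?\<theta> (r \<odot>\<^bsub>E\<^esub> x)) (?\<eta> y) = r \<odot>\<^bsub>twisted g ?T\<^esub> ?p (?\<theta> x) (?\<eta> y)"
      using p(4)[OF act_closed[OF g r] \<theta>c(1)[OF x] \<eta>c(1)[OF y]] \<theta>s[OF r x] by simp
    show "?p (?\<theta> x) (?\<eta> (r \<odot>\<^bsub>F\<^esub> y)) = r \<odot>\<^bsub>twisted g ?T\<^esub> ?p (?\<theta> x) (?\<eta> y)"
      using p(5)[OF act_closed[OF g r] \<theta>c(1)[OF x] \<eta>c(1)[OF y]] \<eta>s[OF r y] by simp
  next
    fix x x' y assume x: "x \<in> carrier E" "x' \<in> carrier E" and y: "y \<in> carrier F"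
    show "?p (?\<theta> (x \<oplus>\<^bsub>E\<^esub> x')) (?\<eta> y) = ?p (?\<theta> x) (?\<eta> y) \<oplus>\<^bsub>twisted g ?T\<^esub> ?p (?\<theta> x') (?\<eta> y)"
      using p(2)[OF \<theta>c(1)[OF x(1)] \<theta>c(1)[OF x(2)] \<eta>c(1)[OF y]] \<theta>a[OF x] by simp
  next
    fix x y y' assume x: "x \<in> carrier E" and y: "y \<in> carrier F" "y' \<in> carrier F"
    show "?p (?\<theta> x) (?\<eta> (y \<oplus>\<^bsub>F\<^esub> y')) = ?p (?\<theta> x) (?\<eta> y) \<oplus>\<^bsub>twisted g ?T\<^esub> ?p (?\<theta> x) (?\<eta> y')"
      using p(3)[OF \<theta>c(1)[OF x] \<eta>c(1)[OF y(1)] \<eta>c(1)[OF y(2)]] \<eta>a[OF y] by simp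
  qed blast
  show ?thesis
  proof (rule transportableI[OF invertible_tensor[OF E F] g semilinear_of_hom[OF \<Phi>]])
    let ?I = "\<Phi> ` component ?h ?T"
    have "u g \<odot>\<^bsub>?T\<^esub> t \<in> ?I" if t: "t \<in> carrier ?T" for t
      using mE mF t
    proof (induction rule: tensor_induct)
      case (pure x y)
      note x = component_proj[OF mE g pure(1)] and y = component_proj[OF mF g pure(2)]
      let ?x = "\<theta>' (u g \<odot>\<^bsub>E\<^esub> x)" and ?y = "\<eta>' (u g \<odot>\<^bsub>F\<^esub> y)"
      note x' = \<theta>'D(1,2)[OF x] and y' = \<eta>'D(1,2)[OF y]
      have "\<Phi> (?p ?x ?y) = ?p (u g \<odot>\<^bsub>E\<^esub> x) (u g \<odot>\<^bsub>F\<^esub> y)"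
        using \<Phi>p[OF x'(1) y'(1)] x'(2) y'(2) E_inv[OF x] F_inv[OF y] by simp
      also have "\<dots> = u g \<odot>\<^bsub>?T\<^esub> ?p x y"
      proof -
        have "?p (u g \<odot>\<^bsub>E\<^esub> x) (u g \<odot>\<^bsub>F\<^esub> y) = u g \<odot>\<^bsub>?T\<^esub> (u g \<odot>\<^bsub>?T\<^esub> ?p x y)"
          using pure uc by (simp add: p(4,5))
        then show ?thesis
          using pure uc p(1) by (simp add: T.smult_assoc1[symmetric] u_idem[OF g])
      qed
      finally have "u g \<odot>\<^bsub>?T\<^esub> ?p x y = \<Phi> (?p ?x ?y)" by simp
      moreover have "?p ?x ?y \<in> component ?h ?T"
        using p(1)[OF x'(1) y'(1)] p(4)[OF uc(2) x'(1) y'(1)] x'(2) by simp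
      ultimately show ?case by (rule image_eqI)
    next
      case (add s t)
      from add(3) obtain a where a: "u g \<odot>\<^bsub>?T\<^esub> s = \<Phi> a" "a \<in> component ?h ?T" by (rule imageE)
      from add(4) obtain b where b: "u g \<odot>\<^bsub>?T\<^esub> t = \<Phi> b" "b \<in> component ?h ?T" by (rule imageE)
      have "u g \<odot>\<^bsub>?T\<^esub> (s \<oplus>\<^bsub>?T\<^esub> t) = \<Phi> (a \<oplus>\<^bsub>?T\<^esub> b)"
        using add(1,2) uc a b mod_hom_add[OF \<Phi>, of a b] by (simp add: T.smult_r_distr)
      then show ?case
        using component_add[OF T.module_axioms h a(2) b(2)] by (rule image_eqI)
    qed
    then show "t \<in> ?I" if "t \<in> component g ?T" for t
      using that by fastforce
  qed
qed

text \<open>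
  A functional \<open>f\<close> is transported to \<open>act g \<circ> f \<circ> \<theta>\<^sup>-\<^sup>1\<close>, again after projecting to the domain of
  \<open>\<theta>\<^sup>-\<^sup>1\<close>.  The exchange property survives because \<open>act g (f v) w\<close> is \<open>\<theta>\<close> applied to \<open>f v\<close> times
  the preimage of \<open>w\<close>.
\<close>

lemma dual_semilinear:
  assumes E: "module R E" and g: "g \<in> carrier G"
    and \<theta>: "semilinear g E E \<theta>" and \<theta>': "semilinear (inv\<^bsub>G\<^esub> g) E E \<theta>'"
    and inverse: "\<And>x. x \<in> component g E \<Longrightarrow> \<theta> (\<theta>' x) = x"
  shows "semilinear g (dual_module R E) (dual_module R E)
    (\<lambda>f. \<lambda>x\<in>carrier E. act g (f (\<theta>' (u g \<odot>\<^bsub>E\<^esub> x))))"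
proof -
  interpret E: module R E by (rule E)
  let ?h = "inv\<^bsub>G\<^esub> g" and ?D = "dual_module R E"
  let ?\<Theta> = "\<lambda>f. \<lambda>x\<in>carrier E. act g (f (\<theta>' (u g \<odot>\<^bsub>E\<^esub> x)))"
  have h: "?h \<in> carrier G" using g by simp
  note uc = u_closed[OF g] u_closed[OF h]
  note \<theta>D = semilinearD[OF \<theta>] and \<theta>'D = semilinearD[OF \<theta>', unfolded G.inv_inv[OF g]]
  note P = component_proj[OF E g]
  have xc: "\<theta>' (u g \<odot>\<^bsub>E\<^esub> x) \<in> carrier E" if "x \<in> carrier E" for x
    by (rule \<theta>'D(1)[OF P[OF that]])
  have xcomp: "\<theta>' (u g \<odot>\<^bsub>E\<^esub> x) \<in> component ?h E" if "x \<in> carrier E" for x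
    using \<theta>'D(1,2)[OF P[OF that]] by simp
  have exch: "(\<lambda>x. act g (f (\<theta>' (u g \<odot>\<^bsub>E\<^esub> x)))) \<in> exchange_functionals R E"
    if f: "f \<in> exchange_functionals R E" for f
  proof -
    have fc: "f (\<theta>' (u g \<odot>\<^bsub>E\<^esub> x)) \<in> carrier R" if "x \<in> carrier E" for x
      by (rule exchange_closed[OF f xc[OF that]])
    show ?thesis
    proof (rule exchangeI)
      fix x assume x: "x \<in> carrier E"
      show "act g (f (\<theta>' (u g \<odot>\<^bsub>E\<^esub> x))) \<in> carrier R"
        by (rule act_closed[OF g fc[OF x]])
      { fix y assume y: "y \<in> carrier E"
        have "\<theta>' (u g \<odot>\<^bsub>E\<^esub> (x \<oplus>\<^bsub>E\<^esub> y)) = \<theta>' (u g \<odot>\<^bsub>E\<^esub> x) \<oplus>\<^bsub>E\<^esub> \<theta>' (u g \<odot>\<^bsub>E\<^esub> y)"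
          using \<theta>'D(3)[OF P[OF x] P[OF y]] x y uc by (simp add: E.smult_r_distr)
        then show "act g (f (\<theta>' (u g \<odot>\<^bsub>E\<^esub> (x \<oplus>\<^bsub>E\<^esub> y)))) =
            act g (f (\<theta>' (u g \<odot>\<^bsub>E\<^esub> x))) \<oplus>\<^bsub>R\<^esub> act g (f (\<theta>' (u g \<odot>\<^bsub>E\<^esub> y)))"
          using exchange_add[OF f xc[OF x] xc[OF y]] act_add[OF g fc[OF x] fc[OF y]] by simp }
      { fix r assume r: "r \<in> carrier R"
        have "\<theta>' (u g \<odot>\<^bsub>E\<^esub> (r \<odot>\<^bsub>E\<^esub> x)) = act ?h r \<odot>\<^bsub>E\<^esub> \<theta>' (u g \<odot>\<^bsub>E\<^esub> x)"
          using \<theta>'D(4)[OF r P[OF x]] x r uc by (simp add: E.smult_assoc1[symmetric] R.m_comm)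
        then have "act g (f (\<theta>' (u g \<odot>\<^bsub>E\<^esub> (r \<odot>\<^bsub>E\<^esub> x)))) = (u g \<otimes>\<^bsub>R\<^esub> r) \<otimes>\<^bsub>R\<^esub> act g (f (\<theta>' (u g \<odot>\<^bsub>E\<^esub> x)))"
          using exchange_smult[OF f act_closed[OF h r] xc[OF x]]
            act_mult[OF g act_closed[OF h r] fc[OF x]] act_act_inv[OF g r] by simp
        also have "\<dots> = r \<otimes>\<^bsub>R\<^esub> (u g \<otimes>\<^bsub>R\<^esub> act g (f (\<theta>' (u g \<odot>\<^bsub>E\<^esub> x))))"
          using r uc act_closed[OF g fc[OF x]] by (simp add: R.m_ac)
        finally show "act g (f (\<theta>' (u g \<odot>\<^bsub>E\<^esub> (r \<odot>\<^bsub>E\<^esub> x)))) = r \<otimes>\<^bsub>R\<^esub> act g (f (\<theta>' (u g \<odot>\<^bsub>E\<^esub> x)))"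
          using u_act[OF g fc[OF x]] by simp }
      { fix y assume y: "y \<in> carrier E"
        have move: "act g (f (\<theta>' (u g \<odot>\<^bsub>E\<^esub> v))) \<odot>\<^bsub>E\<^esub> w = \<theta> (f (\<theta>' (u g \<odot>\<^bsub>E\<^esub> v)) \<odot>\<^bsub>E\<^esub> \<theta>' (u g \<odot>\<^bsub>E\<^esub> w))"
          if v: "v \<in> carrier E" and w: "w \<in> carrier E" for v w
        proof -
          have "act g (f (\<theta>' (u g \<odot>\<^bsub>E\<^esub> v))) \<odot>\<^bsub>E\<^esub> w = act g (f (\<theta>' (u g \<odot>\<^bsub>E\<^esub> v))) \<odot>\<^bsub>E\<^esub> (u g \<odot>\<^bsub>E\<^esub> w)"
            using w uc u_act[OF g fc[OF v]] act_closed[OF g fc[OF v]]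
            by (simp add: E.smult_assoc1[symmetric] R.m_comm)
          also have "\<dots> = act g (f (\<theta>' (u g \<odot>\<^bsub>E\<^esub> v))) \<odot>\<^bsub>E\<^esub> \<theta> (\<theta>' (u g \<odot>\<^bsub>E\<^esub> w))"
            using inverse[OF P[OF w]] by simp
          also have "\<dots> = \<theta> (f (\<theta>' (u g \<odot>\<^bsub>E\<^esub> v)) \<odot>\<^bsub>E\<^esub> \<theta>' (u g \<odot>\<^bsub>E\<^esub> w))"
            by (rule \<theta>D(4)[OF fc[OF v] xcomp[OF w], symmetric])
          finally show ?thesis .
        qed
        show "act g (f (\<theta>' (u g \<odot>\<^bsub>E\<^esub> x))) \<odot>\<^bsub>E\<^esub> y = act g (f (\<theta>' (u g \<odot>\<^bsub>E\<^esub> y))) \<odot>\<^bsub>E\<^esub> x"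
          using move[OF x y] move[OF y x] exchange[OF f xc[OF x] xc[OF y]] by simp }
    qed
  qed
  show ?thesis
  proof (rule semilinearI)
    fix f assume f: "f \<in> component ?h ?D"
    then have fe: "f \<in> exchange_functionals R E" by (simp add: dual_carrier)
    have fc: "f (\<theta>' (u g \<odot>\<^bsub>E\<^esub> x)) \<in> carrier R" if "x \<in> carrier E" for x
      by (rule exchange_closed[OF fe xc[OF that]])
    have "u g \<odot>\<^bsub>?D\<^esub> ?\<Theta> f = ?\<Theta> f"
      by (simp, intro restrict_ext) (simp add: u_act[OF g fc])
    moreover have "?\<Theta> f \<in> carrier ?D"
      by (rule dual_restrict[OF E exch[OF fe]])
    ultimately show "?\<Theta> f \<in> component g ?D" by (simp only: mem_Collect_eq simp_thms)
    { fix f' assume f': "f' \<in> component ?h ?D"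
      then have fe': "f' \<in> exchange_functionals R E" by (simp add: dual_carrier)
      show "?\<Theta> (f \<oplus>\<^bsub>?D\<^esub> f') = ?\<Theta> f \<oplus>\<^bsub>?D\<^esub> ?\<Theta> f'"
        by (simp, intro restrict_ext)
          (simp add: xc act_add[OF g fc exchange_closed[OF fe' xc]]) }
    { fix r assume r: "r \<in> carrier R"
      show "?\<Theta> (r \<odot>\<^bsub>?D\<^esub> f) = act g r \<odot>\<^bsub>?D\<^esub> ?\<Theta> f"
        by (simp, intro restrict_ext) (simp add: xc act_mult[OF g r fc]) }
  qed
qed

lemma transportable_dual:
  assumes E: "invertible_module R E" and g: "g \<in> carrier G" and tr: "transportable g E"
  shows "transportable g (dual_module R E)"
proof -
  have mE: "module R E" using E by (rule invertible_imp_module)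
  interpret E: module R E by (rule mE)
  let ?h = "inv\<^bsub>G\<^esub> g" and ?D = "dual_module R E"
  have h: "?h \<in> carrier G" using g by simp
  note uc = u_closed[OF g] u_closed[OF h]
  obtain \<theta> \<theta>' where \<theta>: "semilinear g E E \<theta>" and \<theta>': "semilinear ?h E E \<theta>'"
      and inverse: "\<And>x. x \<in> component ?h E \<Longrightarrow> \<theta>' (\<theta> x) = x" "\<And>x. x \<in> component g E \<Longrightarrow> \<theta> (\<theta>' x) = x"
    by (rule transportableE[OF tr mE g]) blast
  note \<theta>'D = semilinearD[OF \<theta>', unfolded G.inv_inv[OF g]]
  let ?\<Theta> = "\<lambda>f. \<lambda>x\<in>carrier E. act g (f (\<theta>' (u g \<odot>\<^bsub>E\<^esub> x)))"
  let ?\<Theta>' = "\<lambda>f. \<lambda>x\<in>carrier E. act ?h (f (\<theta> (u ?h \<odot>\<^bsub>E\<^esub> x)))"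
  have \<Theta>': "semilinear ?h ?D ?D ?\<Theta>'"
    by (rule dual_semilinear[OF mE h \<theta>']) (use \<theta> inverse(1) in \<open>simp_all add: G.inv_inv[OF g]\<close>)
  note \<Theta>'D = semilinearD[OF \<Theta>', unfolded G.inv_inv[OF g]]
  show ?thesis
  proof (rule transportableI[OF invertible_dual[OF E] g dual_semilinear[OF mE g \<theta> \<theta>' inverse(2)]])
    fix f assume f: "f \<in> component g ?D"
    then have fe: "f \<in> exchange_functionals R E" and ext: "f \<in> extensional (carrier E)"
      and uf: "u g \<odot>\<^bsub>?D\<^esub> f = f"
      by (simp_all add: dual_carrier)
    have ufx: "u g \<otimes>\<^bsub>R\<^esub> f x = f x" if "x \<in> carrier E" for x
      using fun_cong[OF uf, of x] that by simp
    have "f x = ?\<Theta> (?\<Theta>' f) x" if x: "x \<in> carrier E" for x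
    proof -
      note P = component_proj[OF mE g x]
      have c: "\<theta>' (u g \<odot>\<^bsub>E\<^esub> x) \<in> carrier E" "u ?h \<odot>\<^bsub>E\<^esub> \<theta>' (u g \<odot>\<^bsub>E\<^esub> x) = \<theta>' (u g \<odot>\<^bsub>E\<^esub> x)"
        using \<theta>'D(1,2)[OF P] by simp_all
      have ux: "u g \<odot>\<^bsub>E\<^esub> x \<in> carrier E" using x uc by simp
      have "?\<Theta> (?\<Theta>' f) x = act g (act ?h (f (u g \<odot>\<^bsub>E\<^esub> x)))"
        using x c inverse(2)[OF P] by simp
      also have "\<dots> = u g \<otimes>\<^bsub>R\<^esub> f (u g \<odot>\<^bsub>E\<^esub> x)"
        by (rule act_act_inv[OF g exchange_closed[OF fe ux]])
      also have "\<dots> = f x"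
        using exchange_smult[OF fe uc(1) x] ufx[OF x] by simp
      finally show ?thesis by simp
    qed
    then have "f = ?\<Theta> (?\<Theta>' f)"
      by (intro extensionalityI[OF ext]) simp_all
    moreover have "?\<Theta>' f \<in> component ?h ?D"
      using \<Theta>'D(1,2)[OF f] by (simp only: mem_Collect_eq simp_thms)
    ultimately show "f \<in> ?\<Theta> ` component ?h ?D"
      by (rule image_eqI)
  qed
qed

lemma subring_extension_invariants:
  "subring_extension R (invariants G R u \<alpha>)
    {r \<in> carrier R. \<forall>g\<in>carrier G. act g r = r \<otimes>\<^bsub>R\<^esub> u g}"
  (is "subring_extension R ?S ?A")
proof -
  have S: "?S = R\<lparr>carrier := ?A\<rparr>"
    by (simp add: invariants_def act_def)
  note uc = u_closed
  have zero: "\<zero>\<^bsub>R\<^esub> \<in> ?A"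
  proof -
    have "act g \<zero>\<^bsub>R\<^esub> = \<zero>\<^bsub>R\<^esub>" if "g \<in> carrier G" for g
      using act_add[OF that R.zero_closed R.zero_closed] act_closed[OF that R.zero_closed]
      by (simp add: R.add.l_cancel_one')
    then show ?thesis using uc by simp
  qed
  have one: "\<one>\<^bsub>R\<^esub> \<in> ?A" using uc by (simp add: act_one)
  have add: "r \<oplus>\<^bsub>R\<^esub> s \<in> ?A" if "r \<in> ?A" "s \<in> ?A" for r s
    using that uc by (simp add: act_add R.l_distr)
  have mult: "r \<otimes>\<^bsub>R\<^esub> s \<in> ?A" if "r \<in> ?A" "s \<in> ?A" for r s
  proof -
    have "act g (r \<otimes>\<^bsub>R\<^esub> s) = r \<otimes>\<^bsub>R\<^esub> s \<otimes>\<^bsub>R\<^esub> u g" if g: "g \<in> carrier G" for g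
    proof -
      have "act g (r \<otimes>\<^bsub>R\<^esub> s) = (r \<otimes>\<^bsub>R\<^esub> u g) \<otimes>\<^bsub>R\<^esub> (s \<otimes>\<^bsub>R\<^esub> u g)"
        using \<open>r \<in> ?A\<close> \<open>s \<in> ?A\<close> g by (simp add: act_mult)
      also have "\<dots> = (r \<otimes>\<^bsub>R\<^esub> s) \<otimes>\<^bsub>R\<^esub> (u g \<otimes>\<^bsub>R\<^esub> u g)"
        using \<open>r \<in> ?A\<close> \<open>s \<in> ?A\<close> uc[OF g] by (simp add: R.m_ac)
      finally show ?thesis by (simp add: u_idem[OF g])
    qed
    then show ?thesis using that by simp
  qed
  have minus: "\<ominus>\<^bsub>R\<^esub> r \<in> ?A" if r: "r \<in> ?A" for r
  proof -
    have rc: "r \<in> carrier R" using r by simp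
    have "act g (\<ominus>\<^bsub>R\<^esub> r) = \<ominus>\<^bsub>R\<^esub> r \<otimes>\<^bsub>R\<^esub> u g" if g: "g \<in> carrier G" for g
    proof -
      have "act g (\<ominus>\<^bsub>R\<^esub> r) \<oplus>\<^bsub>R\<^esub> act g r = \<zero>\<^bsub>R\<^esub>"
        using act_add[OF g _ rc, of "\<ominus>\<^bsub>R\<^esub> r"] rc zero g uc by (simp add: R.l_neg)
      then have "act g (\<ominus>\<^bsub>R\<^esub> r) = \<ominus>\<^bsub>R\<^esub> (act g r)"
        using rc act_closed[OF g] by (intro R.minus_equality[symmetric]) simp_all
      then show ?thesis
        using r g uc[OF g] by (simp add: R.l_minus)
    qed
    then show ?thesis using rc by simp
  qed
  have "cring ?S"
    unfolding S
  proof (rule cringI)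
    show "abelian_group (R\<lparr>carrier := ?A\<rparr>)"
    proof (rule abelian_groupI)
      fix x assume x: "x \<in> carrier (R\<lparr>carrier := ?A\<rparr>)"
      show "\<exists>y\<in>carrier (R\<lparr>carrier := ?A\<rparr>). y \<oplus>\<^bsub>R\<lparr>carrier := ?A\<rparr>\<^esub> x = \<zero>\<^bsub>R\<lparr>carrier := ?A\<rparr>\<^esub>"
        using minus[of x] x by (intro bexI[of _ "\<ominus>\<^bsub>R\<^esub> x"]) (simp_all add: R.l_neg)
    qed (use zero add in \<open>simp_all add: R.a_ac\<close>)
    show "comm_monoid (R\<lparr>carrier := ?A\<rparr>)"
      by (rule comm_monoidI) (use one mult in \<open>simp_all add: R.m_ac\<close>)
  qed (simp add: R.l_distr)
  then show ?thesis
    by (intro subring_extension.intro subring_extension_axioms.intro R.is_cring S) simp_all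
qed

text \<open>
  The map \<open>a \<otimes> x \<mapsto> act g a \<otimes> x\<close> is written as \<open>act g a\<close> times \<open>u g \<otimes> x\<close>, which is the form in
  which the universal property of base change produces it.  It requires \<open>x \<mapsto> u g \<otimes> x\<close> to be linear
  over the invariants for the twisted scalar multiplication, and this is what invariance means.
\<close>

lemma transportable_base_change:
  fixes E :: "('a, 'e) module"
  defines "S \<equiv> invariants G R u \<alpha>"
  assumes E: "invertible_module S E" and g: "g \<in> carrier G"
  shows "transportable g (base_change S R E)"
proof -
  let ?A = "{r \<in> carrier R. \<forall>g\<in>carrier G. act g r = r \<otimes>\<^bsub>R\<^esub> u g}"
  interpret S: subring_extension R S ?A
    unfolding S_def by (rule subring_extension_invariants)
  have mE: "module S E" using E by (rule invertible_imp_module)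
  let ?B = "base_change S R E"
  interpret B: module R ?B by (rule S.module_base_change[OF mE])
  note p = S.pt_base_change[OF mE]
  let ?h = "inv\<^bsub>G\<^esub> g"
  have h: "?h \<in> carrier G" using g by simp
  note uc = u_closed[OF g] u_closed[OF h]
  note [simp del] = S.base_change_simps
  have "(\<lambda>x. S.pt E (u g) x) \<in> mod_hom S E (twisted g ?B)"
  proof (rule mod_homI)
    fix x assume x: "x \<in> carrier E"
    show "S.pt E (u g) x \<in> carrier (twisted g ?B)"
      using p(1)[OF uc(1) x] p(4)[OF uc(1) uc(1) x] by (simp add: u_idem[OF g])
    { fix y assume "y \<in> carrier E"
      then show "S.pt E (u g) (x \<oplus>\<^bsub>E\<^esub> y) = S.pt E (u g) x \<oplus>\<^bsub>twisted g ?B\<^esub> S.pt E (u g) y"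
        using p(2)[OF uc(1) x] by simp }
    { fix s assume s: "s \<in> carrier S"
      then have sA: "s \<in> ?A" by simp
      then have sR: "s \<in> carrier R" and a: "act g s = s \<otimes>\<^bsub>R\<^esub> u g" using g by simp_all
      have "S.pt E (u g) (s \<odot>\<^bsub>E\<^esub> x) = S.pt E (s \<otimes>\<^bsub>R\<^esub> u g) x"
        using p(3)[OF sA uc(1) x] p(4)[OF sR uc(1) x] by simp
      also have "\<dots> = S.pt E (act g s \<otimes>\<^bsub>R\<^esub> u g) x"
        unfolding a using sR uc by (simp add: R.m_assoc u_idem[OF g])
      also have "\<dots> = act g s \<odot>\<^bsub>?B\<^esub> S.pt E (u g) x"
        by (rule p(4)[OF act_closed[OF g sR] uc(1) x, symmetric])
      finally show "S.pt E (u g) (s \<odot>\<^bsub>E\<^esub> x) = s \<odot>\<^bsub>twisted g ?B\<^esub> S.pt E (u g) x"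
        by simp }
  qed
  then obtain \<Phi> where \<Phi>: "\<Phi> \<in> mod_hom R ?B (twisted g ?B)"
      and \<Phi>p: "\<And>a x. a \<in> carrier R \<Longrightarrow> x \<in> carrier E \<Longrightarrow>
        \<Phi> (S.pt E a x) = a \<odot>\<^bsub>twisted g ?B\<^esub> S.pt E (u g) x"
    by (rule S.base_change_lift[OF mE module_twisted[OF B.module_axioms g]]) blast
  show ?thesis
  proof (rule transportableI[OF S.invertible_base_change[OF E] g semilinear_of_hom[OF \<Phi>]])
    let ?I = "\<Phi> ` component ?h ?B"
    have "u g \<odot>\<^bsub>?B\<^esub> t \<in> ?I" if t: "t \<in> carrier ?B" for t
      using mE t
    proof (induction rule: S.base_change_induct)
      case (pure a x)
      note c = act_closed[OF h pure(1)]
      have "\<Phi> (S.pt E (act ?h a) x) = (u g \<otimes>\<^bsub>R\<^esub> a) \<odot>\<^bsub>?B\<^esub> S.pt E (u g) x"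
        using \<Phi>p[OF c pure(2)] act_act_inv[OF g pure(1)] by simp
      also have "\<dots> = S.pt E (u g \<otimes>\<^bsub>R\<^esub> a \<otimes>\<^bsub>R\<^esub> u g) x"
        using pure uc by (intro p(4)) simp_all
      also have "u g \<otimes>\<^bsub>R\<^esub> a \<otimes>\<^bsub>R\<^esub> u g = (u g \<otimes>\<^bsub>R\<^esub> u g) \<otimes>\<^bsub>R\<^esub> a"
        using pure uc by (simp add: R.m_ac)
      also have "\<dots> = u g \<otimes>\<^bsub>R\<^esub> a" by (simp add: u_idem[OF g])
      finally have "u g \<odot>\<^bsub>?B\<^esub> S.pt E a x = \<Phi> (S.pt E (act ?h a) x)"
        using p(4)[OF uc(1) pure] by simp
      moreover have "S.pt E (act ?h a) x \<in> component ?h ?B"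
        using p(1)[OF c pure(2)] p(4)[OF uc(2) c pure(2)] u_act[OF h pure(1)] by simp
      ultimately show ?case by (rule image_eqI)
    next
      case (add s t)
      from add(3) obtain a where a: "u g \<odot>\<^bsub>?B\<^esub> s = \<Phi> a" "a \<in> component ?h ?B" by (rule imageE)
      from add(4) obtain b where b: "u g \<odot>\<^bsub>?B\<^esub> t = \<Phi> b" "b \<in> component ?h ?B" by (rule imageE)
      have "u g \<odot>\<^bsub>?B\<^esub> (s \<oplus>\<^bsub>?B\<^esub> t) = \<Phi> (a \<oplus>\<^bsub>?B\<^esub> b)"
        using add(1,2) uc a b mod_hom_add[OF \<Phi>, of a b] by (simp add: B.smult_r_distr)
      then show ?case
        using component_add[OF B.module_axioms h a(2) b(2)] by (rule image_eqI)
    qed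
    then show "t \<in> ?I" if "t \<in> component g ?B" for t
      using that by fastforce
  qed
qed


lemma twist_simps [simp]:
  "carrier (twist G R u \<alpha> g M) = carrier M" "add (twist G R u \<alpha> g M) = add M"
  "zero (twist G R u \<alpha> g M) = zero M"
  by (simp_all add: twist_def)

lemma twist_smult:
  "g \<in> carrier G \<Longrightarrow> r \<odot>\<^bsub>twist G R u \<alpha> g M\<^esub> x = act (inv\<^bsub>G\<^esub> g) r \<odot>\<^bsub>M\<^esub> x"
  by (simp add: twist_def act_def)

lemma mod_iso_twist:
  assumes "mod_iso R M N" "g \<in> carrier G"
  shows "mod_iso R (twist G R u \<alpha> g M) (twist G R u \<alpha> g N)"
proof -
  obtain f where f: "f \<in> mod_hom R M N" "bij_betw f (carrier M) (carrier N)"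
    using assms(1) unfolding mod_iso_def by blast
  have h: "inv\<^bsub>G\<^esub> g \<in> carrier G" using assms(2) by simp
  have "f \<in> mod_hom R (twist G R u \<alpha> g M) (twist G R u \<alpha> g N)"
    by (rule mod_homI)
      (simp_all add: twist_smult[OF assms(2)] mod_hom_closed[OF f(1)] mod_hom_add[OF f(1)]
        mod_hom_smult[OF f(1)] act_closed[OF h])
  then show ?thesis
    unfolding mod_iso_def using f(2) by (intro bexI[of _ f]) simp_all
qed

text \<open>
  A map that turns \<open>act (inv g) r\<close> into \<open>r\<close> turns \<open>r\<close> into \<open>act g r\<close>: the two ways of twisting differ by
  the idempotents of the summands, and these act as the identity.
\<close>

lemma twist_corner_iff_transportable:
  assumes E: "module R E" and g: "g \<in> carrier G"
  shows "mod_iso R (twist G R u \<alpha> g (corner E (u (inv\<^bsub>G\<^esub> g)))) (corner E (u g)) \<longleftrightarrow> transportable g E"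
proof -
  interpret E: module R E by (rule E)
  let ?h = "inv\<^bsub>G\<^esub> g"
  let ?W = "twist G R u \<alpha> g (corner E (u ?h))" and ?C = "corner E (u g)"
  have h: "?h \<in> carrier G" using g by simp
  note uc = u_closed[OF g] u_closed[OF h]
  have "\<theta> \<in> mod_hom R ?W ?C \<longleftrightarrow> semilinear g E E \<theta>" for \<theta>
  proof
    assume \<theta>: "\<theta> \<in> mod_hom R ?W ?C"
    show "semilinear g E E \<theta>"
    proof (rule semilinearI)
      fix x assume x: "x \<in> component ?h E"
      then show "\<theta> x \<in> component g E"
        using mod_hom_closed[OF \<theta>, of x] by simp
      show "\<theta> (x \<oplus>\<^bsub>E\<^esub> y) = \<theta> x \<oplus>\<^bsub>E\<^esub> \<theta> y" if "y \<in> component ?h E" for y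
        using mod_hom_add[OF \<theta>, of x y] x that by simp
      fix r assume r: "r \<in> carrier R"
      have "r \<odot>\<^bsub>E\<^esub> x = r \<odot>\<^bsub>E\<^esub> (u ?h \<odot>\<^bsub>E\<^esub> x)"
        using x by simp
      also have "\<dots> = (r \<otimes>\<^bsub>R\<^esub> u ?h) \<odot>\<^bsub>E\<^esub> x"
        using x r uc by (intro E.smult_assoc1[symmetric]) simp_all
      also have "r \<otimes>\<^bsub>R\<^esub> u ?h = act ?h (act g r)"
        using r uc by (simp add: act_inv_act[OF g r] R.m_comm)
      finally show "\<theta> (r \<odot>\<^bsub>E\<^esub> x) = act g r \<odot>\<^bsub>E\<^esub> \<theta> x"
        using mod_hom_smult[OF \<theta> act_closed[OF g r], of x] x by (simp add: twist_smult[OF g])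
    qed
  next
    assume \<theta>: "semilinear g E E \<theta>"
    note \<theta>D = semilinearD[OF \<theta>]
    show "\<theta> \<in> mod_hom R ?W ?C"
    proof (rule mod_homI)
      fix x assume "x \<in> carrier ?W"
      then have x: "x \<in> component ?h E" by simp
      show "\<theta> x \<in> carrier ?C"
        using \<theta>D(1,2)[OF x] by simp
      show "\<theta> (x \<oplus>\<^bsub>?W\<^esub> y) = \<theta> x \<oplus>\<^bsub>?C\<^esub> \<theta> y" if "y \<in> carrier ?W" for y
        using \<theta>D(3)[OF x, of y] that by simp
      fix r assume r: "r \<in> carrier R"
      have "\<theta> (act ?h r \<odot>\<^bsub>E\<^esub> x) = (u g \<otimes>\<^bsub>R\<^esub> r) \<odot>\<^bsub>E\<^esub> \<theta> x"
        using \<theta>D(4)[OF act_closed[OF h r] x] act_act_inv[OF g r] by simp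
      also have "\<dots> = r \<odot>\<^bsub>E\<^esub> (u g \<odot>\<^bsub>E\<^esub> \<theta> x)"
        using r uc \<theta>D(1)[OF x] by (simp add: E.smult_assoc1[symmetric] R.m_comm)
      also have "\<dots> = r \<odot>\<^bsub>E\<^esub> \<theta> x"
        using \<theta>D(2)[OF x] by simp
      finally show "\<theta> (r \<odot>\<^bsub>?W\<^esub> x) = r \<odot>\<^bsub>?C\<^esub> \<theta> x"
        by (simp add: twist_smult[OF g])
    qed
  qed
  then show ?thesis
    by (auto simp: mod_iso_def transportable_def)
qed

lemma module_twist_D_tensor:
  assumes E: "module R E" and g: "g \<in> carrier G"
  shows "module R (D_module R (u g))" "module R (tensor R (D_module R (u g)) E)"
proof -
  show D: "module R (D_module R (u g))"
    unfolding D_module_eq_corner[OF R.is_cring u_closed[OF g] u_idem[OF g]]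
    by (intro module_corner module_self R.is_cring u_closed[OF g])
  show "module R (tensor R (D_module R (u g)) E)"
    by (rule module_tensor[OF D E])
qed

lemma twist_tensor_iff_transportable:
  assumes E: "module R E" and g: "g \<in> carrier G"
  shows "mod_iso R (twist G R u \<alpha> g (tensor R (D_module R (u (inv\<^bsub>G\<^esub> g))) E))
      (tensor R (D_module R (u g)) E) \<longleftrightarrow> transportable g E"
    (is "mod_iso R (twist _ _ _ _ _ ?T') ?T \<longleftrightarrow> _")
proof -
  let ?h = "inv\<^bsub>G\<^esub> g"
  have h: "?h \<in> carrier G" using g by simp
  let ?C' = "corner E (u ?h)" and ?C = "corner E (u g)"
  note i = tensor_D_module[OF E u_closed[OF g] u_idem[OF g]]
    and i' = tensor_D_module[OF E u_closed[OF h] u_idem[OF h]]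
  note T = module_twist_D_tensor(2)[OF E g] and T' = module_twist_D_tensor(2)[OF E h]
  note j = mod_iso_sym[OF T i] and j' = mod_iso_sym[OF T' i']
  have "mod_iso R (twist G R u \<alpha> g ?T') ?T" if "mod_iso R (twist G R u \<alpha> g ?C') ?C"
    by (rule mod_iso_trans[OF mod_iso_trans[OF mod_iso_twist[OF i' g] that] j])
  moreover have "mod_iso R (twist G R u \<alpha> g ?C') ?C" if "mod_iso R (twist G R u \<alpha> g ?T') ?T"
    by (rule mod_iso_trans[OF mod_iso_trans[OF mod_iso_twist[OF j' g] that] i])
  ultimately have "mod_iso R (twist G R u \<alpha> g ?T') ?T \<longleftrightarrow> mod_iso R (twist G R u \<alpha> g ?C') ?C"
    by blast
  then show ?thesis
    by (simp add: twist_corner_iff_transportable[OF E g])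
qed

abbreviation invariant_Pic :: "('a, nat \<Rightarrow> 'a) module set set" where
  "invariant_Pic \<equiv> PicS_inv G R u \<alpha> \<inter> carrier (Pic R)"

lemma invariant_PicI:
  assumes E: "invertible_module R E" and tr: "\<And>g. g \<in> carrier G \<Longrightarrow> transportable g E"
  shows "iso_class R E \<in> invariant_Pic"
proof
  have mE: "module R E" using E by (rule invertible_imp_module)
  show "iso_class R E \<in> carrier (Pic R)" by (rule iso_class_in_Pic[OF E])
  show "iso_class R E \<in> PicS_inv G R u \<alpha>"
  proof (rule ex_standard_copy[OF E])
    fix M :: "('a, nat \<Rightarrow> 'a) module" assume M: "invertible_module R M" "mod_iso R E M"
    have mM: "module R M" using M(1) by (rule invertible_imp_module)
    have "transportable g M" if "g \<in> carrier G" for g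
      by (rule transportable_iso[OF E mM M(2) that tr[OF that]])
    then have "\<forall>g\<in>carrier G. mod_iso R (twist G R u \<alpha> g (tensor R (D_module R (u (inv\<^bsub>G\<^esub> g))) M))
        (tensor R (D_module R (u g)) M)"
      by (simp add: twist_tensor_iff_transportable[OF mM])
    then show ?thesis
      unfolding PicS_inv_def iso_class_eqI[OF mE M(2)] using invertible_pics_module[OF M(1)] by blast
  qed
qed

text \<open>
  The two memberships may be witnessed by different modules, but these are isomorphic, and so the
  module that witnesses invariance is invertible as well.
\<close>

lemma invariant_PicE:
  assumes "X \<in> invariant_Pic"
  obtains E :: "('a, nat \<Rightarrow> 'a) module" where "invertible_module R E" "X = iso_class R E"
    "\<And>g. g \<in> carrier G \<Longrightarrow> transportable g E"
proof -
  obtain E :: "('a, nat \<Rightarrow> 'a) module" where X: "X = iso_class R E" and pics: "pics_module R E"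
      and iso: "\<forall>g\<in>carrier G. mod_iso R (twist G R u \<alpha> g (tensor R (D_module R (u (inv\<^bsub>G\<^esub> g))) E))
        (tensor R (D_module R (u g)) E)"
    using assms unfolding PicS_inv_def by blast
  obtain F :: "('a, nat \<Rightarrow> 'a) module" where F: "invertible_module R F" "X = iso_class R F"
    using IntD2[OF assms] unfolding Pic_carrier_iff by blast
  have mE: "module R E" using pics by (simp add: pics_module_def fgp_module_def)
  have "F \<in> iso_class R E"
    using F mod_iso_refl invertible_imp_module[OF F(1)] unfolding X[symmetric] F(2) mem_iso_class by blast
  then have E: "invertible_module R E"
    using invertible_iso[OF F(1) mE] by (simp add: mem_iso_class)
  have "transportable g E" if "g \<in> carrier G" for g
    using iso that twist_tensor_iff_transportable[OF mE that] by blast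
  from that[OF E X this] show thesis .
qed

lemma subgroup_invariant_Pic: "subgroup invariant_Pic (Pic R)"
proof (rule group.subgroupI[OF group_Pic[OF R.is_cring]])
  interpret P: group "Pic R" by (rule group_Pic[OF R.is_cring])
  show "invariant_Pic \<subseteq> carrier (Pic R)" by blast
  show "invariant_Pic \<noteq> {}"
    using invariant_PicI[OF invertible_self[OF R.is_cring] transportable_self] by blast
  fix X assume "X \<in> invariant_Pic"
  then obtain E :: "('a, nat \<Rightarrow> 'a) module" where E: "invertible_module R E" "X = iso_class R E"
      and trE: "\<And>g. g \<in> carrier G \<Longrightarrow> transportable g E"
    by (rule invariant_PicE) blast
  note D = invertible_dual[OF E(1)]
  have "iso_class R (dual_module R E) \<otimes>\<^bsub>Pic R\<^esub> X = \<one>\<^bsub>Pic R\<^esub>"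
    using iso_class_eqI[OF invertible_imp_module[OF invertible_tensor[OF D E(1)]] tensor_dual[OF E(1)]]
    by (simp add: E(2) class_mult_eq[OF D E(1)])
  then have "inv\<^bsub>Pic R\<^esub> X = iso_class R (dual_module R E)"
    using iso_class_in_Pic[OF D] iso_class_in_Pic[OF E(1)] E(2) by (intro P.inv_equality) simp_all
  then show "inv\<^bsub>Pic R\<^esub> X \<in> invariant_Pic"
    using invariant_PicI[OF D transportable_dual[OF E(1) _ trE]] by simp
  fix Y assume "Y \<in> invariant_Pic"
  then obtain F :: "('a, nat \<Rightarrow> 'a) module" where F: "invertible_module R F" "Y = iso_class R F"
      and trF: "\<And>g. g \<in> carrier G \<Longrightarrow> transportable g F"
    by (rule invariant_PicE) blast
  show "X \<otimes>\<^bsub>Pic R\<^esub> Y \<in> invariant_Pic"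
    using invariant_PicI[OF invertible_tensor[OF E(1) F(1)] transportable_tensor[OF E(1) F(1) _ trE trF]]
    by (simp add: E(2) F(2) class_mult_eq[OF E(1) F(1)])
qed

lemma phi2_group_hom:
  defines "S \<equiv> invariants G R u \<alpha>"
  shows "group_hom (Pic S) ((PicS R)\<lparr>carrier := invariant_Pic\<rparr>) (phi2 S R)"
proof -
  interpret S: subring_extension R S "{r \<in> carrier R. \<forall>g\<in>carrier G. act g r = r \<otimes>\<^bsub>R\<^esub> u g}"
    unfolding S_def by (rule subring_extension_invariants)
  let ?H = "(PicS R)\<lparr>carrier := invariant_Pic\<rparr>"
  have "?H = (Pic R)\<lparr>carrier := invariant_Pic\<rparr>"
    by (simp add: PicS_def Pic_def)
  then have H: "group ?H"
    using group.subgroup_imp_group[OF group_Pic[OF R.is_cring] subgroup_invariant_Pic] by simp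
  have "phi2 S R \<in> hom (Pic S) ?H"
  proof (rule homI)
    fix X assume "X \<in> carrier (Pic S)"
    then obtain E :: "('a, nat \<Rightarrow> 'a) module" where E: "invertible_module S E" "X = iso_class S E"
      unfolding Pic_carrier_iff by blast
    note BE = S.invertible_base_change[OF E(1)]
    show "phi2 S R X \<in> carrier ?H"
      using invariant_PicI[OF BE transportable_base_change[OF E(1)[unfolded S_def], folded S_def]]
      by (simp add: E(2) S.phi2_iso_class[OF E(1)])
    fix Y assume "Y \<in> carrier (Pic S)"
    then obtain F :: "('a, nat \<Rightarrow> 'a) module" where F: "invertible_module S F" "Y = iso_class S F"
      unfolding Pic_carrier_iff by blast
    note BF = S.invertible_base_change[OF F(1)]
    note EF = invertible_tensor[OF E(1) F(1)]
    have "phi2 S R (X \<otimes>\<^bsub>Pic S\<^esub> Y) = iso_class R (base_change S R (tensor S E F))"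
      by (simp add: E(2) F(2) class_mult_eq[OF E(1) F(1)] S.phi2_iso_class[OF EF])
    also have "\<dots> = iso_class R (tensor R (base_change S R E) (base_change S R F))"
      by (rule iso_class_eqI[OF invertible_imp_module[OF S.invertible_base_change[OF EF]]
            S.base_change_tensor[OF E(1) F(1)]])
    also have "\<dots> = phi2 S R X \<otimes>\<^bsub>?H\<^esub> phi2 S R Y"
      by (simp add: E(2) F(2) S.phi2_iso_class[OF E(1)] S.phi2_iso_class[OF F(1)]
          class_mult_eq[OF BE BF] PicS_def)
    finally show "phi2 S R (X \<otimes>\<^bsub>Pic S\<^esub> Y) = phi2 S R X \<otimes>\<^bsub>?H\<^esub> phi2 S R Y" .
  qed
  then show ?thesis
    by (intro group_hom.intro group_hom_axioms.intro group_Pic[OF S.S_cring] H)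
qed

end

theorem proposition4p10:
  fixes G :: "'g monoid" and R :: "'a ring"
    and u :: "'g \<Rightarrow> 'a" and \<alpha> :: "'g \<Rightarrow> 'a \<Rightarrow> 'a"
  assumes "finite (carrier G)"
    and "unital_partial_action G R u \<alpha>"
    and "partial_galois G R u \<alpha>"
  shows "group_hom (Pic (invariants G R u \<alpha>))
           ((PicS R)\<lparr>carrier := PicS_inv G R u \<alpha> \<inter> carrier (Pic R)\<rparr>)
           (phi2 (invariants G R u \<alpha>) R) \<and>
         (\<forall>E :: ('a, 'e) module. pic_module (invariants G R u \<alpha>) E \<longrightarrow>
           iso_class (invariants G R u \<alpha>) E \<in> carrier (Pic (invariants G R u \<alpha>)) \<and>
           phi2 (invariants G R u \<alpha>) R (iso_class (invariants G R u \<alpha>) E) =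
           iso_class R (base_change (invariants G R u \<alpha>) R E))"
proof -
  interpret unital_partial_action G R u \<alpha> by fact
  interpret S: subring_extension R "invariants G R u \<alpha>"
    "{r \<in> carrier R. \<forall>g\<in>carrier G. act g r = r \<otimes>\<^bsub>R\<^esub> u g}"
    by (rule subring_extension_invariants)
  show ?thesis
  proof (intro conjI allI impI)
    show "group_hom (Pic (invariants G R u \<alpha>))
        ((PicS R)\<lparr>carrier := PicS_inv G R u \<alpha> \<inter> carrier (Pic R)\<rparr>) (phi2 (invariants G R u \<alpha>) R)"
      by (rule phi2_group_hom)
    fix E :: "('a, 'e) module" assume "pic_module (invariants G R u \<alpha>) E"
    then have E: "invertible_module (invariants G R u \<alpha>) E" by (rule pic_module_imp_invertible)
    show "iso_class (invariants G R u \<alpha>) E \<in> carrier (Pic (invariants G R u \<alpha>))"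
      by (rule iso_class_in_Pic[OF E])
    show "phi2 (invariants G R u \<alpha>) R (iso_class (invariants G R u \<alpha>) E) =
        iso_class R (base_change (invariants G R u \<alpha>) R E)"
      by (rule S.phi2_iso_class[OF E])
  qed
qed

end
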